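(* Let $a,b,\lambda$ be non-zero complex numbers with $a\neq b$. The quadratic differential $$\varpi(\lambda,a,b,z)=\lambda^{2}\,\frac{(z-a)(z-b)}{z^{4}}\,dz^{2}$$ on the Riemann sphere $\widehat{\mathbb{C}}$ has a finite critical trajectory connecting $a$ and $b$ if and only if $$\Re\left(\lambda\,\frac{(\sqrt{a}+\sqrt{b})^{2}}{\sqrt{ab}}\right)=0\quad\text{or}\quad \Re\left(\lambda\,\frac{(\sqrt{a}-\sqrt{b})^{2}}{\sqrt{ab}}\right)=0 .$$
   Context: The finite critical points of $\varpi(\lambda,a,b,z)$ are its simple zeros $a$ and $b$; its infinite critical points are the pole of order $4$ at $0$ and the double pole at $\infty$. All other points of $\widehat{\mathbb{C}}$ are regular. A (horizontal) trajectory of $\varpi(\lambda,a,b,z)$ is a maximal curve through regular points along which $\lambda^{2}\frac{(z-a)(z-b)}{z^{4}}\,dz^{2}>0$; equivalently, along which $\Im\int^{z}\lambda\frac{\sqrt{(t-a)(t-b)}}{t^{2}}\,dt$ is constant. A trajectory going through (i.e. having as an endpoint) $a$ or $b$ is called critical. A critical trajectory that starts and ends at points of $\{a,b\}$ is called a finite critical trajectory (or short trajectory); it connects $a$ and $b$ if one of its endpoints is $a$ and the other is $b$. The square roots $\sqrt{a},\sqrt{b}$ are any fixed choices, and $\sqrt{ab}=\sqrt{a}\sqrt{b}$. *)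

theory Defs
  imports "HOL-Analysis.Analysis"
begin

text \<open>
  The quadratic differential is given by its coefficient in the coordinate \<open>z\<close> of the plane.
  In the coordinate \<open>w = 1/z\<close> it reads \<open>\<lambda>\<^sup>2 (1 - a w) (1 - b w) / w\<^sup>2 dw\<^sup>2\<close>, so the
  point at infinity is a double pole. Hence every trajectory on the Riemann sphere stays in the
  finite plane, and plane curves are enough.
\<close>

definition quad_diff :: "complex \<Rightarrow> complex \<Rightarrow> complex \<Rightarrow> complex \<Rightarrow> complex" where
  "quad_diff l a b z = l\<^sup>2 * ((z - a) * (z - b) / z ^ 4)"

definition regular_points :: "complex \<Rightarrow> complex \<Rightarrow> complex set" where
  "regular_points a b = - {0, a, b}"

text \<open>
  Curves are parametrised over the open unit interval; this is no restriction, as every open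
  interval is diffeomorphic to it. A closed trajectory is covered by a parametrisation that runs
  around it more than once; for this reason injectivity is not required.
\<close>

definition horizontal_curve ::
    "complex \<Rightarrow> complex \<Rightarrow> complex \<Rightarrow> (real \<Rightarrow> complex) \<Rightarrow> bool" where
  "horizontal_curve l a b g \<longleftrightarrow>
     g C1_differentiable_on {0<..<1} \<and>
     (\<forall>t\<in>{0<..<1}. g t \<in> regular_points a b \<and>
        quad_diff l a b (g t) * (vector_derivative g (at t))\<^sup>2 \<in> complex_of_real ` {0<..})"

text \<open>Maximality refers to the traces of the curves, not to their parametrisations.\<close>

definition trajectory ::
    "complex \<Rightarrow> complex \<Rightarrow> complex \<Rightarrow> (real \<Rightarrow> complex) \<Rightarrow> bool" where
  "trajectory l a b g \<longleftrightarrow>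
     horizontal_curve l a b g \<and>
     (\<forall>h. horizontal_curve l a b h \<and> g ` {0<..<1} \<subseteq> h ` {0<..<1} \<longrightarrow>
          h ` {0<..<1} = g ` {0<..<1})"

definition has_endpoints :: "(real \<Rightarrow> complex) \<Rightarrow> complex \<Rightarrow> complex \<Rightarrow> bool" where
  "has_endpoints g p q \<longleftrightarrow> (g \<longlongrightarrow> p) (at_right 0) \<and> (g \<longlongrightarrow> q) (at_left 1)"

definition finite_critical_trajectory ::
    "complex \<Rightarrow> complex \<Rightarrow> complex \<Rightarrow> (real \<Rightarrow> complex) \<Rightarrow> bool" where
  "finite_critical_trajectory l a b g \<longleftrightarrow>
     trajectory l a b g \<and> (\<exists>p\<in>{a, b}. \<exists>q\<in>{a, b}. has_endpoints g p q)"

definition connects :: "(real \<Rightarrow> complex) \<Rightarrow> complex \<Rightarrow> complex \<Rightarrow> bool" where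
  "connects g p q \<longleftrightarrow> has_endpoints g p q \<or> has_endpoints g q p"

end

theory Submission
  imports Defs "HOL-Complex_Analysis.Complex_Analysis"
begin

text \<open>
  On the double cover of the sphere branched at \<open>a\<close> and \<open>b\<close>, again a sphere, the square root of the quadratic
  differential is a meromorphic form \<open>\<omega>\<close> that is odd under \<open>v \<mapsto> 1 / v\<close>.

  A connecting trajectory lifts to a simple arc from \<open>1\<close> to \<open>-1\<close> along which \<open>\<omega>\<close> is real; it is completed by its image
  under \<open>v \<mapsto> 1 / v\<close> to a Jordan curve. The curve separates \<open>0\<close> from \<open>\<infinity>\<close> and \<open>p\<close> from \<open>1 / p\<close>, so the residue theorem gives
  the two possible values of the real integral of \<open>\<omega>\<close> over the arc, which is the necessary condition.

  For the converse normalise \<open>\<omega>\<close> so that the prescribed integral is 1 and move \<open>p\<close>. Arcs of length 1 persist under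
  small perturbations, because the integral depends only on winding numbers. A limit of such arcs contains an arc of length at most 1,
  and it has length 1 whenever \<open>p\<^sup>2\<close> is not real, since the other possible lengths \<open>1 / p\<^sup>2, -1 / p\<^sup>2\<close> are not real then. For real \<open>p\<close> the
  arc is a unit semicircle. Connecting \<open>1 / 3\<close> or \<open>-1 / 3\<close> to \<open>p\<close> inside a quadrant, and a final limit for imaginary \<open>p\<close>, give all cases.
\<close>

text \<open>The continuity argument works without a global structure theory of trajectories because
  the length of a connecting arc depends only on two signs. In a limit, an arc can break only at the
  zeros \<open>1\<close> and \<open>-1\<close>: it may touch them at interior times, and the part
  kept between them is then shorter. Normalising the length turns the question whether this has
  happened into arithmetic. For imaginary \<open>p\<close> a shorter piece may really be all that is
  left, but these parameters are reached last, and an arc of any length is then enough. The starting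
  parameter has to be one where the length can be identified. At \<open>1 / 3\<close> and
  \<open>-1 / 3\<close> the candidates are 1, 9 and -9, so a crude bound on the speed decides. In
  the converse only one of the two conditions has to be treated: changing the sign of
  \<open>sb\<close> exchanges them and replaces \<open>p\<close> by \<open>1 / p\<close>.\<close>

text \<open>The substitution \<open>z = (a + b) / 2 + (a - b) / 4 * (v + 1 / v)\<close> sends \<open>v = 1, -1\<close> to \<open>z = a, b\<close> and turns
  \<open>l * sqrt ((z - a) * (z - b)) / z\<^sup>2 dz\<close> into \<open>lform l p v dv\<close>, where \<open>p\<close> and \<open>1 / p\<close> are the points over
  \<open>z = 0\<close>. The ratio below is the residue at \<open>p\<close> divided by the residue \<open>l\<close> at \<open>0\<close>.\<close>

definition lform :: "complex \<Rightarrow> complex \<Rightarrow> complex \<Rightarrow> complex" where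
  "lform l p v = l * (v\<^sup>2 - 1)\<^sup>2 / (v * (v - p)\<^sup>2 * (v - 1 / p)\<^sup>2)"

definition res_ratio :: "complex \<Rightarrow> complex" where
  "res_ratio p = (p\<^sup>2 + 1) / (p\<^sup>2 - 1)"

text \<open>Partial fractions: the residues at \<open>0\<close>, \<open>p\<close> and
  \<open>1 / p\<close> are 1, \<open>res_ratio p\<close> and \<open>- res_ratio p\<close>. The
  subtracted quotient is the derivative of (v^2 - 1) / ((v - p) (v - 1 / p)), which carries the
  double poles and vanishes at \<open>1\<close> and \<open>-1\<close>.\<close>

lemma lform_primitive_identity:
  assumes "v \<noteq> 0" "v \<noteq> p" "v \<noteq> 1 / p" "p \<noteq> 0" "p\<^sup>2 \<noteq> 1"
  shows "lform 1 p v = 1 / v + res_ratio p * (1 / (v - p) - 1 / (v - 1 / p))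
     - (2 * v * ((v - p) * (v - 1 / p)) - (v\<^sup>2 - 1) * (2 * v - p - 1 / p)) / ((v - p) * (v - 1 / p))\<^sup>2"
proof -
  define q where "q = 1 / p"
  have pq: "p * q = 1" "q \<noteq> 0" "v - q \<noteq> 0" "v - p \<noteq> 0" using assms by (auto simp: q_def)
  have r: "res_ratio p = (p + q) / (p - q)"
    using assms by (simp add: res_ratio_def q_def field_simps power2_eq_square)
  have pq': "p - q \<noteq> 0" using assms by (auto simp: q_def field_simps power2_eq_square)
  have *: "res_ratio p * (1 / (v - p) - 1 / (v - q)) = (p + q) / ((v - p) * (v - q))"
    unfolding r using pq' pq by (simp add: divide_simps)
  have "(v\<^sup>2 - 1)\<^sup>2 / (v * (v - p)\<^sup>2 * (v - q)\<^sup>2) = 1 / v + (p + q) / ((v - p) * (v - q))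
      - (2 * v * ((v - p) * (v - q)) - (v\<^sup>2 - 1) * (2 * v - p - q)) / ((v - p) * (v - q))\<^sup>2"
  proof -
    have e: "1 / v + (p + q) / ((v - p) * (v - q))
      - (2 * v * ((v - p) * (v - q)) - (v\<^sup>2 - 1) * (2 * v - p - q)) / ((v - p) * (v - q))\<^sup>2
      = (((v - p) * (v - q))\<^sup>2 + v * (p + q) * ((v - p) * (v - q)) - v * (2 * v * ((v - p) * (v - q)) - (v\<^sup>2 - 1) * (2 * v - p - q)))
       / (v * (v - p)\<^sup>2 * (v - q)\<^sup>2)"
      using assms(1) pq(3,4) by (simp add: divide_simps power2_eq_square) (simp add: algebra_simps)
    have D: "(v - p) * (v - q) = v\<^sup>2 - (p + q) * v + 1"
      using pq(1) by (simp add: algebra_simps power2_eq_square)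
    have n: "((v - p) * (v - q))\<^sup>2 + v * (p + q) * ((v - p) * (v - q)) - v * (2 * v * ((v - p) * (v - q)) - (v\<^sup>2 - 1) * (2 * v - p - q)) = (v\<^sup>2 - 1)\<^sup>2"
      unfolding D by (simp add: algebra_simps power2_eq_square)
    show ?thesis unfolding e n ..
  qed
  then show ?thesis unfolding lform_def using * by (simp add: q_def)
qed

text \<open>Since d(1 / v) = - dv / v^2, this is the oddness of the form under inversion.\<close>

lemma lform_inverse:
  assumes "v \<noteq> 0" "p \<noteq> 0"
  shows "lform l p (1 / v) = v\<^sup>2 * lform l p v"
\<comment> \<open>At the poles both sides are 0, by the convention for division by zero.\<close>
proof (cases "v = p \<or> v = 1 / p")
  case True
  then show ?thesis using assms by (auto simp: lform_def)
next
  case False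
  have 1: "1 / v - p = - p * (v - 1 / p) / v" "1 / v - 1 / p = - (v - p) / (p * v)"
    "(1 / v)\<^sup>2 - 1 = - (v\<^sup>2 - 1) / v\<^sup>2"
    using assms by (simp_all add: field_simps)
  have 2: "v - p \<noteq> 0" "v - 1 / p \<noteq> 0" using False by auto
  show ?thesis unfolding lform_def 1 using 2 assms
    by (simp add: power_divide power_mult_distrib) (simp add: divide_simps power2_eq_square, simp add: algebra_simps)
qed


lemma lform_holomorphic: "lform l p holomorphic_on - {0, p, 1 / p}"
  unfolding lform_def by (intro holomorphic_intros) auto

lemma lform_nonzero:
  assumes "l \<noteq> 0" "v \<notin> {0, 1, -1, p, 1 / p}"
  shows "lform l p v \<noteq> 0"
  using assms by (auto simp: lform_def power2_eq_1_iff)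

lemma lform_scale: "lform (c * l) p v = c * lform l p v"
  by (simp add: lform_def)

section \<open>Continuous logarithms and the primitive of the form along a path\<close>

lemma log_along_path:
  assumes "path g" "z \<notin> path_image g"
  obtains L where "continuous_on {0..1} L"
    "L 1 - L 0 = 2 * of_real pi * \<i> * winding_number g z"
    "\<And>t. t \<in> {0..1} \<Longrightarrow> g t = z + exp (L t)"
    "\<And>t d. \<lbrakk>t \<in> {0<..<1}; (g has_vector_derivative d) (at t)\<rbrakk>
       \<Longrightarrow> (L has_vector_derivative d / (g t - z)) (at t)"
proof -
  obtain L where L: "path L" "pathfinish L - pathstart L = 2 * of_real pi * \<i> * winding_number g z"
    "\<And>t. t \<in> {0..1} \<Longrightarrow> g t = z + exp (L t)"
    using winding_number_as_continuous_log[OF assms] by metis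
  have cL: "continuous_on {0..1} L" using L(1) by (simp add: path_def)
  have "(L has_vector_derivative d / (g t - z)) (at t)"
    if t: "t \<in> {0<..<1}" and d: "(g has_vector_derivative d) (at t)" for t d
  proof -
    have nz: "g t - z \<noteq> 0" using L(3)[of t] t by auto
    have "continuous (at t) L"
      using cL t by (metis continuous_on_eq_continuous_at continuous_on_subset
          greaterThanLessThan_subseteq_atLeastAtMost_iff open_greaterThanLessThan order_refl)
    then have "eventually (\<lambda>s. dist (L s) (L t) < 1) (at t)"
      by (simp add: continuous_at tendsto_iff)
    moreover have "eventually (\<lambda>s. s \<in> {0<..<1}) (at t)"
      using t by (metis eventually_at_topological open_greaterThanLessThan)
    \<comment> \<open>Close to \<open>t\<close> the logarithm moves by less than 1, hence by less
      than pi, so its increment is the principal branch \<open>Ln\<close> of the ratio. That branch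
      can be differentiated.\<close>
    ultimately have "eventually (\<lambda>s. L t + Ln ((g s - z) / (g t - z)) = L s) (at t)"
    proof eventually_elim
      case (elim s)
      have "g s - z = exp (L s)" "g t - z = exp (L t)" using L(3)[of s] L(3)[of t] elim t by auto
      then have e: "(g s - z) / (g t - z) = exp (L s - L t)" by (simp add: exp_diff)
      have "\<bar>Im (L s - L t)\<bar> < 1"
        using elim(1) abs_Im_le_cmod[of "L s - L t"] by (simp add: dist_norm)
      then have "Ln (exp (L s - L t)) = L s - L t"
        using pi_gt3 by (intro Ln_exp) auto
      then show ?case unfolding e by simp
    qed
    then obtain S where S: "open S" "t \<in> S" "\<And>s. s \<in> S \<Longrightarrow> s \<noteq> t \<Longrightarrow> L t + Ln ((g s - z) / (g t - z)) = L s"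
      unfolding eventually_at_topological by auto
    have "((\<lambda>s. L t + Ln ((g s - z) / (g t - z))) has_vector_derivative d / (g t - z)) (at t)"
    proof -
      have 1: "((\<lambda>s. (g s - z) / (g t - z)) has_vector_derivative d / (g t - z)) (at t)"
        unfolding divide_inverse
        using has_vector_derivative_mult_left[OF has_vector_derivative_diff[OF d has_vector_derivative_const[of z]]]
        by auto
      have 2: "((\<lambda>w. L t + Ln w) has_field_derivative 1) (at ((g t - z) / (g t - z)))"
        using nz by (auto intro!: derivative_eq_intros)
      show ?thesis using field_vector_diff_chain_at[OF 1 2] by (simp add: o_def)
    qed
    then show ?thesis
      by (rule has_vector_derivative_transform_within_open[OF _ S(1,2)]) (use S(3) nz in \<open>metis Ln_1 add.right_neutral divide_self\<close>)
  qed
  then show ?thesis using that[of L] cL L by (auto simp: pathfinish_def pathstart_def)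
qed

text \<open>A primitive carried along \<open>g\<close> takes the place of a contour integral,
  because the horizontal arcs below have unbounded velocity at \<open>1\<close> and
  \<open>-1\<close>; a derivative is therefore asked only at interior times. The rational part of
  the primitive vanishes at both ends, so the total change depends on winding numbers alone.\<close>

lemma lform_integral_along:
  assumes "path g" "pathstart g = 1" "pathfinish g = -1"
    and av: "0 \<notin> path_image g" "p \<notin> path_image g" "1 / p \<notin> path_image g"
    and p: "p \<noteq> 0" "p\<^sup>2 \<noteq> 1"
    and d: "\<And>t. t \<in> {0<..<1} \<Longrightarrow> (g has_vector_derivative g' t) (at t)"
  obtains \<phi> where "continuous_on {0..1} \<phi>" "\<phi> 0 = 0"
    "\<And>t. t \<in> {0<..<1} \<Longrightarrow> (\<phi> has_vector_derivative lform l p (g t) * g' t) (at t)"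
    "\<phi> 1 = 2 * of_real pi * \<i> * l *
      (winding_number g 0 + res_ratio p * (winding_number g p - winding_number g (1 / p)))"
proof -
  obtain L0 where L0: "continuous_on {0..1} L0" "L0 1 - L0 0 = 2 * of_real pi * \<i> * winding_number g 0"
    "\<And>t d. \<lbrakk>t \<in> {0<..<1}; (g has_vector_derivative d) (at t)\<rbrakk>
       \<Longrightarrow> (L0 has_vector_derivative d / (g t - 0)) (at t)"
    using log_along_path[OF assms(1) av(1)] by metis
  obtain L1 where L1: "continuous_on {0..1} L1" "L1 1 - L1 0 = 2 * of_real pi * \<i> * winding_number g p"
    "\<And>t d. \<lbrakk>t \<in> {0<..<1}; (g has_vector_derivative d) (at t)\<rbrakk>
       \<Longrightarrow> (L1 has_vector_derivative d / (g t - p)) (at t)"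
    using log_along_path[OF assms(1) av(2)] by metis
  obtain L2 where L2: "continuous_on {0..1} L2" "L2 1 - L2 0 = 2 * of_real pi * \<i> * winding_number g (1/p)"
    "\<And>t d. \<lbrakk>t \<in> {0<..<1}; (g has_vector_derivative d) (at t)\<rbrakk>
       \<Longrightarrow> (L2 has_vector_derivative d / (g t - 1/p)) (at t)"
    using log_along_path[OF assms(1) av(3)] by metis
  define K where "K = (\<lambda>v. (v\<^sup>2 - 1) / ((v - p) * (v - 1 / p)))"
  define P where "P = (\<lambda>t. l * (L0 t + res_ratio p * (L1 t - L2 t) - K (g t)))"
  have nin: "g t \<noteq> 0" "g t \<noteq> p" "g t \<noteq> 1 / p" if "t \<in> {0..1}" for t
    using av that unfolding path_image_def by (metis imageI)+
  have g01: "g 0 = 1" "g 1 = -1" using assms(2,3) by (auto simp: pathstart_def pathfinish_def)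
  have cP: "continuous_on {0..1} P" unfolding P_def K_def
    using assms(1) nin by (intro continuous_intros L0 L1 L2) (auto simp: path_def)
  have dP: "(P has_vector_derivative lform l p (g t) * g' t) (at t)" if t: "t \<in> {0<..<1}" for t
  proof -
    have n: "g t \<noteq> 0" "g t \<noteq> p" "g t \<noteq> 1 / p" using nin[of t] t by auto
    have dK: "(K has_field_derivative (2 * g t * ((g t - p) * (g t - 1 / p)) - ((g t)\<^sup>2 - 1) * (2 * g t - p - 1 / p)) / ((g t - p) * (g t - 1 / p))\<^sup>2) (at (g t))"
      unfolding K_def using n
      by (auto intro!: derivative_eq_intros simp: power2_eq_square)
    have "(P has_vector_derivative l * ((g' t / (g t - 0) + res_ratio p * (g' t / (g t - p) - g' t / (g t - 1/p)))
       - g' t * ((2 * g t * ((g t - p) * (g t - 1 / p)) - ((g t)\<^sup>2 - 1) * (2 * g t - p - 1 / p)) / ((g t - p) * (g t - 1 / p))\<^sup>2))) (at t)"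
      unfolding P_def
      by (intro has_vector_derivative_mult_right has_vector_derivative_diff has_vector_derivative_add
          L0(3)[OF t d[OF t]] L1(3)[OF t d[OF t]] L2(3)[OF t d[OF t]]
          field_vector_diff_chain_at[OF d[OF t] dK, unfolded o_def])
    moreover have "lform l p (g t) * g' t = l * ((g' t / (g t - 0) + res_ratio p * (g' t / (g t - p) - g' t / (g t - 1/p)))
       - g' t * Q)" if "lform 1 p (g t) = 1 / g t + res_ratio p * (1 / (g t - p) - 1 / (g t - 1 / p)) - Q" for Q
    proof -
      have e: "lform l p (g t) = l * lform 1 p (g t)" by (simp add: lform_def)
      show ?thesis unfolding e that by (simp add: divide_inverse algebra_simps)
    qed
    ultimately show ?thesis using lform_primitive_identity[OF n p] by presburger
  qed
  have P1: "P 1 - P 0 = 2 * of_real pi * \<i> * l *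
      (winding_number g 0 + res_ratio p * (winding_number g p - winding_number g (1 / p)))"
  proof -
    have "P 1 - P 0 = l * ((L0 1 - L0 0) + res_ratio p * ((L1 1 - L1 0) - (L2 1 - L2 0)))"
      by (simp add: P_def K_def g01 algebra_simps)
    then show ?thesis unfolding L0(2) L1(2) L2(2) by (simp add: algebra_simps)
  qed
  show ?thesis
  proof (rule that[of "\<lambda>t. P t - P 0"])
    show "((\<lambda>t. P t - P 0) has_vector_derivative lform l p (g t) * g' t) (at t)" if "t \<in> {0<..<1}" for t
      using has_vector_derivative_diff[OF dP[OF that] has_vector_derivative_const[of "P 0"]] by simp
  qed (use P1 cP in \<open>auto intro!: continuous_intros\<close>)
qed

lemma exp_eq_minus_one_odd:
  assumes "exp (2 * of_real pi * \<i> * x) = -1"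
  obtains n :: int where "2 * x = of_int n" "odd n"
proof -
  have "exp (2 * of_real pi * \<i> * x - \<i> * of_real pi) = 1"
    using assms by (simp add: exp_diff mult.commute)
  then obtain n :: int where "Re (2 * of_real pi * \<i> * x - \<i> * of_real pi) = 0"
     "Im (2 * of_real pi * \<i> * x - \<i> * of_real pi) = of_int (2 * n) * pi"
    unfolding exp_eq_1 by auto
  then have "Im x = 0" and "pi * (2 * Re x) = pi * (2 * of_int n + 1)"
    by (simp_all add: algebra_simps)
  then have "Im x = 0" "2 * Re x = 2 * of_int n + 1"
    by (metis mult_cancel_left pi_neq_zero)+
  then have "2 * x = of_int (2 * n + 1)" by (auto simp: complex_eq_iff)
  then show ?thesis using that[of "2 * n + 1"] by simp
qed

text \<open>For an open path with winding number w about z, exp (2 pi i w) is the ratio of the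
  displacements of its ends from z, here (-1 - z) / (1 - z). This is -1 for z = 0, and its values at
  \<open>p\<close> and \<open>1 / p\<close> have quotient -1. So the winding numbers in question are
  half of odd integers.\<close>

lemma winding_numbers_odd:
  assumes "path g" "pathstart g = 1" "pathfinish g = -1"
    and av: "0 \<notin> path_image g" "p \<notin> path_image g" "1 / p \<notin> path_image g"
    and p: "p \<noteq> 0"
  obtains m n :: int where "2 * winding_number g 0 = of_int m" "odd m"
    "2 * (winding_number g p - winding_number g (1 / p)) = of_int n" "odd n"
proof -
  have e: "exp (2 * of_real pi * \<i> * winding_number g z) = (-1 - z) / (1 - z)" if z: "z \<notin> path_image g" for z
  proof -
    obtain L where L: "L 1 - L 0 = 2 * of_real pi * \<i> * winding_number g z"
      "\<And>t. t \<in> {0..1} \<Longrightarrow> g t = z + exp (L t)"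
      using log_along_path[OF assms(1) z] by metis
    have "exp (L 0) = 1 - z" "exp (L 1) = -1 - z"
      using L(2)[of 0] L(2)[of 1] assms(2,3) by (auto simp: pathstart_def pathfinish_def algebra_simps)
    then show ?thesis unfolding L(1)[symmetric] by (simp add: exp_diff)
  qed
  have p1: "p \<noteq> 1" "p \<noteq> -1"
    using av(2) assms(2,3) pathstart_in_path_image[of g] pathfinish_in_path_image[of g] by auto
  have "exp (2 * of_real pi * \<i> * winding_number g 0) = -1" using e[OF av(1)] by simp
  moreover have "exp (2 * of_real pi * \<i> * (winding_number g p - winding_number g (1 / p))) = -1"
  proof -
    have "exp (2 * of_real pi * \<i> * (winding_number g p - winding_number g (1 / p)))
      = ((-1 - p) / (1 - p)) / ((-1 - 1/p) / (1 - 1/p))"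
      unfolding right_diff_distrib exp_diff e[OF av(2)] e[OF av(3)] ..
    also have "\<dots> = -1"
    proof -
      have n: "1 - p \<noteq> 0" "1 + p \<noteq> 0" using p1 by (auto simp: add_eq_0_iff)
      have e: "-1 - 1/p = - (1 + p) / p" "1 - 1/p = - (1 - p) / p" "-1 - p = - (1 + p)"
        using p by (auto simp: field_simps)
      show ?thesis unfolding e using p n p1 by (auto simp: divide_simps)
    qed
    finally show ?thesis .
  qed
  ultimately obtain m n :: int where "2 * winding_number g 0 = of_int m" "odd m"
    "2 * (winding_number g p - winding_number g (1 / p)) = of_int n" "odd n"
    by (meson exp_eq_minus_one_odd)
  then show ?thesis by (rule that)
qed

section \<open>Horizontal arcs of the lifted form\<close>

lemma has_vector_derivative_compose_field:
  assumes "(g has_vector_derivative d) (at t)" "(F has_field_derivative c) (at (g t))"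
  shows "((\<lambda>s. F (g s)) has_vector_derivative d * c) (at t)"
  using field_vector_diff_chain_at[OF assms] by (simp add: o_def)

lemma vector_derivative_bound:
  fixes f :: "real \<Rightarrow> 'a::real_normed_vector"
  assumes "a \<le> b" "continuous_on {a..b} f"
    and "\<And>t. t \<in> {a<..<b} \<Longrightarrow> (f has_vector_derivative f' t) (at t)"
    and "\<And>t. t \<in> {a<..<b} \<Longrightarrow> norm (f' t) \<le> M"
  shows "norm (f b - f a) \<le> M * (b - a)"
proof (cases "a = b")
  case False
  have "norm (f b - f a) \<le> (\<lambda>t. M * t) b - (\<lambda>t. M * t) a"
  proof (rule differentiable_bound_general[of a b f "\<lambda>t. M * t" f' "\<lambda>t. M"])
    show "((\<lambda>t. M * t) has_vector_derivative M) (at t)" for t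
      by (auto intro!: derivative_eq_intros)
  qed (use assms False in \<open>auto intro!: continuous_intros\<close>)
  then show ?thesis by (simp add: algebra_simps)
qed simp

lemma endpoint_extension:
  fixes g :: "real \<Rightarrow> 'a::topological_space"
  assumes "\<And>t. t \<in> {0<..<1} \<Longrightarrow> isCont g t"
    and lim: "(g \<longlongrightarrow> p) (at_right 0)" "(g \<longlongrightarrow> q) (at_left 1)"
  obtains k where "continuous_on {0..1} k" "k 0 = p" "k 1 = q" "\<And>t. t \<in> {0<..<1} \<Longrightarrow> k t = g t"
proof -
  define k where "k t = (if t \<le> 0 then p else if 1 \<le> t then q else g t)" for t
  have kg: "k t = g t" if "t \<in> {0<..<1}" for t using that by (auto simp: k_def)
  have k01: "k 0 = p" "k 1 = q" by (simp_all add: k_def)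
  have "continuous_on {0..1} k"
  proof (rule continuous_on_IccI)
    have "eventually (\<lambda>t. k t = g t) (at_right 0)"
      using eventually_at_right_real[of 0 1] by (auto elim!: eventually_mono simp: kg)
    then show "(k \<longlongrightarrow> k 0) (at_right 0)" using lim(1) by (simp add: k01 tendsto_cong)
    have "eventually (\<lambda>t. k t = g t) (at_left 1)"
      using eventually_at_left_real[of 0 1] by (auto elim!: eventually_mono simp: kg)
    then show "(k \<longlongrightarrow> k 1) (at_left 1)" using lim(2) by (simp add: k01 tendsto_cong)
    show "(k \<longlongrightarrow> k t) (at t)" if t: "0 < t" "t < 1" for t
    proof -
      have "(g \<longlongrightarrow> k t) (at t)" using assms(1)[of t] t by (simp add: continuous_at kg)
      moreover have "eventually (\<lambda>s. k s = g s) (at t)"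
        using eventually_at_in_open'[of "{0<..<1}" t] t by (auto elim!: eventually_mono simp: kg)
      ultimately show ?thesis using tendsto_cong by blast
    qed
  qed auto
  then show ?thesis using that k01 kg by blast
qed

text \<open>\<open>F\<close> is the natural coordinate of the form \<open>f\<close>: curves on which
  the form is real become horizontal segments in it.\<close>

lemma local_injective_primitive:
  assumes "open U" "f holomorphic_on U" "z \<in> U" "f z \<noteq> 0"
  obtains r F where "r > 0" "ball z r \<subseteq> U" "inj_on F (ball z r)"
    "\<And>w. w \<in> ball z r \<Longrightarrow> (F has_field_derivative f w) (at w)"
proof -
  obtain R where R: "R > 0" "ball z R \<subseteq> U" using assms(1,3) open_contains_ball by blast
  obtain F where "\<And>w. w \<in> ball z R \<Longrightarrow> (F has_field_derivative f w) (at w within ball z R)"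
    using holomorphic_convex_primitive'[of "ball z R" f] holomorphic_on_subset[OF assms(2) R(2)]
    by auto
  then have F: "\<And>w. w \<in> ball z R \<Longrightarrow> (F has_field_derivative f w) (at w)"
    by (simp add: at_within_open[OF _ open_ball])
  have hF: "F holomorphic_on ball z R"
    unfolding holomorphic_on_def using F field_differentiable_def has_field_derivative_at_within by blast
  have "deriv F z \<noteq> 0" using DERIV_imp_deriv[OF F[of z]] R(1) assms(4) by simp
  then obtain r where "r > 0" "ball z r \<subseteq> ball z R" "inj_on F (ball z r)"
    using has_complex_derivative_locally_injective[OF hF, of z] R(1) by auto
  then show ?thesis using that[of r F] R(2) F by blast
qed

text \<open>In the coordinate \<open>F\<close> both solutions move with the constant velocity
  \<open>c\<close>, so their difference is constant, and it is 0 where they meet.\<close>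

lemma ode_unique_locally:
  assumes f: "open U" "f holomorphic_on U" "\<And>v. v \<in> U \<Longrightarrow> f v \<noteq> 0"
    and t: "t \<in> {a<..<b}" and eq: "g t = h t"
    and g: "\<And>s. s \<in> {a<..<b} \<Longrightarrow> g s \<in> U \<and> (g has_vector_derivative c / f (g s)) (at s)"
    and h: "\<And>s. s \<in> {a<..<b} \<Longrightarrow> h s \<in> U \<and> (h has_vector_derivative c / f (h s)) (at s)"
  shows "eventually (\<lambda>s. g s = h s) (nhds t)"
proof -
  obtain r F where r: "r > 0" "ball (g t) r \<subseteq> U" "inj_on F (ball (g t) r)"
    and F: "\<And>w. w \<in> ball (g t) r \<Longrightarrow> (F has_field_derivative f w) (at w)"
    using local_injective_primitive[OF f(1,2), of "g t"] g[OF t] f(3) by metis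
  have "isCont g t" "isCont h t" using g[OF t] h[OF t] has_vector_derivative_continuous by blast+
  then have "eventually (\<lambda>s. dist (g s) (g t) < r) (nhds t)" "eventually (\<lambda>s. dist (h s) (g t) < r) (nhds t)"
    using r(1) eq by (auto simp: continuous_at tendsto_iff eventually_nhds_conv_at)
  moreover have "eventually (\<lambda>s. s \<in> {a<..<b}) (nhds t)"
    using t by (intro eventually_nhds_in_open) auto
  ultimately have "eventually (\<lambda>s. g s \<in> ball (g t) r \<and> h s \<in> ball (g t) r \<and> s \<in> {a<..<b}) (nhds t)"
    by eventually_elim (auto simp: dist_commute)
  then obtain d where d: "d > 0"
    "\<And>s. s \<in> ball t d \<Longrightarrow> g s \<in> ball (g t) r \<and> h s \<in> ball (g t) r \<and> s \<in> {a<..<b}"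
    unfolding eventually_nhds_metric by (auto simp: dist_commute)
  have "g s = h s" if s: "s \<in> ball t d" for s
  proof -
    have D: "((\<lambda>s. F (k s)) has_vector_derivative c) (at x within ball t d)"
      if x: "x \<in> ball t d" and k: "k x \<in> ball (g t) r" "(k has_vector_derivative c / f (k x)) (at x)" for k x
    proof -
      have "f (k x) \<noteq> 0" using k(1) r(2) f(3) by auto
      then show ?thesis
        using has_vector_derivative_compose_field[OF k(2) F[OF k(1)]] has_vector_derivative_at_within by force
    qed
    have "((\<lambda>s. F (g s) - F (h s)) has_vector_derivative 0) (at x within ball t d)" if "x \<in> ball t d" for x
      using has_vector_derivative_diff[OF D[OF that, of g] D[OF that, of h]] d(2)[OF that] g h by auto
    then obtain C where "\<And>x. x \<in> ball t d \<Longrightarrow> F (g x) - F (h x) = C"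
      using has_vector_derivative_zero_constant[of "ball t d" "\<lambda>s. F (g s) - F (h s)"] by auto
    then have "F (g s) = F (h s)" using d(1) eq s by (metis centre_in_ball diff_self right_minus_eq)
    then show ?thesis using r(3) d(2)[OF s] by (auto dest: inj_onD)
  qed
  then show ?thesis unfolding eventually_nhds_metric using d(1) by (auto simp: dist_commute)
qed

lemma ode_unique:
  assumes f: "open U" "f holomorphic_on U" "\<And>v. v \<in> U \<Longrightarrow> f v \<noteq> 0"
    and t: "t \<in> {a<..<b}" and eq: "g t = h t"
    and g: "\<And>s. s \<in> {a<..<b} \<Longrightarrow> g s \<in> U \<and> (g has_vector_derivative c / f (g s)) (at s)"
    and h: "\<And>s. s \<in> {a<..<b} \<Longrightarrow> h s \<in> U \<and> (h has_vector_derivative c / f (h s)) (at s)"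
    and s: "s \<in> {a<..<b}"
  shows "g s = h s"
proof -
  let ?I = "{a<..<b}" let ?E = "{s \<in> ?I. g s = h s}"
  have cont: "continuous_on ?I (\<lambda>s. g s - h s)"
    using g h by (intro continuous_on_diff continuous_at_imp_continuous_on ballI)
      (metis has_vector_derivative_continuous)+
  have "open ?E"
    unfolding open_subopen[of ?E]
  proof safe
    fix x assume x: "x \<in> ?I" "g x = h x"
    obtain S where "open S" "x \<in> S" "\<And>y. y \<in> S \<Longrightarrow> g y = h y"
      using ode_unique_locally[OF f x g h] unfolding eventually_nhds by blast
    then show "\<exists>T. open T \<and> x \<in> T \<and> T \<subseteq> ?E"
      using x by (intro exI[of _ "S \<inter> ?I"]) auto
  qed
  moreover have "closedin (top_of_set ?I) ?E"
    using continuous_closedin_preimage_constant[OF cont, of 0] by simp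
  moreover have "connected ?I" by simp
  ultimately have "?E = {} \<or> ?E = ?I"
    unfolding connected_clopen using open_subset[of ?E ?I] by blast
  then show ?thesis using t eq s by blast
qed

text \<open>A horizontal arc from \<open>1\<close> to \<open>-1\<close> parametrised proportionally
  to its length \<open>T\<close> in the metric of the form: the form applied to the velocity is
  constantly \<open>T\<close>. At the ends the form vanishes and the velocity blows up, so the
  equation is imposed at interior times only.\<close>

definition harc :: "complex \<Rightarrow> complex \<Rightarrow> real \<Rightarrow> (real \<Rightarrow> complex) \<Rightarrow> bool" where
  "harc l p T g \<longleftrightarrow> path g \<and> pathstart g = 1 \<and> pathfinish g = -1 \<and> 0 < T \<and>
     (\<forall>t\<in>{0<..<1}. g t \<notin> {0, 1, -1, p, 1 / p} \<and>
        (g has_vector_derivative of_real T / lform l p (g t)) (at t))"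

lemma regular_inverse:
  assumes "v \<in> - {0, 1, -1, p, 1 / p}"
  shows "1 / v \<in> - {0, 1, -1, p, 1 / (p::complex)}"
proof
  assume a: "1 / v \<in> {0, 1, -1, p, 1 / p}"
  have "v = 1 / (1 / v)" by simp
  then have "v \<in> (\<lambda>w. 1 / w) ` {0, 1, -1, p, 1 / p}" using a by blast
  then show False using assms by auto
qed

lemma harc_avoids:
  assumes "harc l p T g" "p \<noteq> 0" "p\<^sup>2 \<noteq> 1"
  shows "0 \<notin> path_image g" "p \<notin> path_image g" "1 / p \<notin> path_image g"
proof -
  have "p \<noteq> 1" "p \<noteq> -1" using assms by auto
  then have p1: "p \<noteq> 1" "p \<noteq> -1" "1 / p \<noteq> 1" "1 / p \<noteq> -1"
    using regular_inverse[of p 0] assms(2) by auto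
  have "g t \<noteq> 0 \<and> g t \<noteq> p \<and> g t \<noteq> 1 / p" if "t \<in> {0..1}" for t
  proof -
    have "t = 0 \<or> t = 1 \<or> t \<in> {0<..<1}" using that by (simp, linarith)
    then consider "t = 0" | "t = 1" | "t \<in> {0<..<1}" by blast
    then show ?thesis
      using assms(1) p1 by cases (auto simp: harc_def pathstart_def pathfinish_def)
  qed
  then show "0 \<notin> path_image g" "p \<notin> path_image g" "1 / p \<notin> path_image g"
    unfolding path_image_def by (metis imageE)+
qed

lemma harc_regular:
  assumes "harc l p T g" "t \<in> {0<..<1}"
  shows "g t \<in> - {0, 1, -1, p, 1 / p}" "(g has_vector_derivative of_real T / lform l p (g t)) (at t)"
  using assms by (auto simp: harc_def)

text \<open>Along the arc the primitive grows at the constant rate \<open>T\<close>, so its final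
  value is \<open>T\<close>.\<close>

lemma harc_length_formula:
  assumes "harc l p T g" "p \<noteq> 0" "p\<^sup>2 \<noteq> 1" "l \<noteq> 0"
  shows "of_real T = 2 * of_real pi * \<i> * l *
      (winding_number g 0 + res_ratio p * (winding_number g p - winding_number g (1 / p)))"
proof -
  have h: "path g" "pathstart g = 1" "pathfinish g = -1" using assms(1) by (auto simp: harc_def)
  obtain \<phi> where f: "continuous_on {0..1} \<phi>" "\<phi> 0 = 0"
    "\<And>t. t \<in> {0<..<1} \<Longrightarrow> (\<phi> has_vector_derivative lform l p (g t) * (of_real T / lform l p (g t))) (at t)"
    "\<phi> 1 = 2 * of_real pi * \<i> * l *
      (winding_number g 0 + res_ratio p * (winding_number g p - winding_number g (1 / p)))"
    using lform_integral_along[OF h harc_avoids[OF assms(1-3)] assms(2,3) harc_regular(2)[OF assms(1)], of l]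
    by metis
  have "((\<lambda>t. \<phi> t - of_real T * of_real t) has_vector_derivative 0) (at t)" if t: "t \<in> {0<..<1}" for t
  proof -
    have "lform l p (g t) \<noteq> 0" using lform_nonzero[OF assms(4)] harc_regular(1)[OF assms(1) t] by auto
    then have 1: "(\<phi> has_vector_derivative of_real T) (at t)" using f(3)[OF t] by simp
    have 2: "((\<lambda>t. of_real T * of_real t) has_vector_derivative complex_of_real T) (at t)"
      by (auto intro!: derivative_eq_intros)
    show ?thesis using has_vector_derivative_diff[OF 1 2] by simp
  qed
  then have "norm ((\<phi> 1 - of_real T * of_real 1) - (\<phi> 0 - of_real T * of_real 0)) \<le> 0 * (1 - 0)"
    by (intro vector_derivative_bound[of 0 1 "\<lambda>t. \<phi> t - of_real T * of_real t" "\<lambda>_. 0"] continuous_intros f(1)) auto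
  then show ?thesis using f by simp
qed

text \<open>If the arc met itself at interior times differing by \<open>\<tau>\<close>, its
  translate by \<open>\<tau>\<close> would solve the same equation and hence coincide with it.
  Letting the time tend to 0 gives \<open>g \<tau> = 1\<close>, which is excluded at an interior
  time.\<close>

lemma harc_arc:
  assumes "harc l p T g" "p \<noteq> 0" "p\<^sup>2 \<noteq> 1" "l \<noteq> 0"
  shows "arc g"
proof -
  have h: "path g" "g 0 = 1" "g 1 = -1"
    using assms(1) by (auto simp: harc_def pathstart_def pathfinish_def)
  let ?U = "- {0, 1, -1, p, 1 / p}"
  have U: "open ?U" by (simp add: open_Compl finite_imp_closed)
  have hol: "lform l p holomorphic_on ?U"
    by (rule holomorphic_on_subset[OF lform_holomorphic]) auto
  have W0: "lform l p v \<noteq> 0" if "v \<in> ?U" for v using lform_nonzero[OF assms(4)] that by auto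
  have reg: "g t \<in> ?U \<and> (g has_vector_derivative of_real T / lform l p (g t)) (at t)" if "t \<in> {0<..<1}" for t
    using harc_regular[OF assms(1) that] by simp
  have no: False if st: "0 < s" "s < t" "t < 1" and eq: "g s = g t" for s t
  proof -
    define \<tau> where "\<tau> = t - s"
    have shift: "g (x + \<tau>) \<in> ?U \<and> ((\<lambda>x. g (x + \<tau>)) has_vector_derivative of_real T / lform l p (g (x + \<tau>))) (at x)"
      if "x \<in> {0<..<1 - \<tau>}" for x
    proof -
      have "x + \<tau> \<in> {0<..<1}" using that st by (auto simp: \<tau>_def)
      moreover have "((\<lambda>x. x + \<tau>) has_vector_derivative 1) (at x)"
        by (auto intro!: derivative_eq_intros)
      ultimately show ?thesis
        using vector_diff_chain_at[of "\<lambda>x. x + \<tau>" 1 x g "of_real T / lform l p (g (x + \<tau>))"] reg[of "x + \<tau>"]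
        by (simp add: o_def)
    qed
    have eq2: "g x = g (x + \<tau>)" if "x \<in> {0<..<1 - \<tau>}" for x
    proof (rule ode_unique[OF U hol W0 _ _ _ shift that])
      show "s \<in> {0<..<1 - \<tau>}" "g s = g (s + \<tau>)" using st eq by (auto simp: \<tau>_def)
      show "g x \<in> ?U \<and> (g has_vector_derivative of_real T / lform l p (g x)) (at x)" if "x \<in> {0<..<1 - \<tau>}" for x
        by (rule reg) (use that st in \<open>auto simp: \<tau>_def\<close>)
    qed
    have cont: "continuous_on {0..1} g" using h(1) by (simp add: path_def)
    have "continuous_on {0..1 - \<tau>} (\<lambda>x. g x - g (x + \<tau>))"
    proof (intro continuous_on_diff)
      show "continuous_on {0..1 - \<tau>} g"
        by (rule continuous_on_subset[OF cont]) (use st in \<open>auto simp: \<tau>_def\<close>)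
      show "continuous_on {0..1 - \<tau>} (\<lambda>x. g (x + \<tau>))"
        by (rule continuous_on_compose2[OF cont]) (use st in \<open>auto simp: \<tau>_def intro!: continuous_intros\<close>)
    qed
    moreover have "closure {0<..<1 - \<tau>} = {0..1 - \<tau>}" using st by (simp add: \<tau>_def)
    ultimately have "g 0 - g (0 + \<tau>) = 0"
      using continuous_constant_on_closure[of "{0<..<1 - \<tau>}" "\<lambda>x. g x - g (x + \<tau>)" 0 0] eq2 st
      by (simp add: \<tau>_def)
    then have "g \<tau> = 1" using h by simp
    then show False using reg[of \<tau>] st by (auto simp: \<tau>_def)
  qed
  have "inj_on g {0..1}"
  proof (rule linorder_inj_onI)
    fix s t :: real assume st: "s < t" "s \<in> {0..1}" "t \<in> {0..1}"
    show "g s \<noteq> g t"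
    proof (cases "s = 0 \<or> t = 1")
      case True
      then have "s = 0 \<and> t = 1 \<or> s = 0 \<and> t \<in> {0<..<1} \<or> t = 1 \<and> s \<in> {0<..<1}"
        using st by (simp, linarith)
      then consider "s = 0" "t = 1" | "s = 0" "t \<in> {0<..<1}" | "t = 1" "s \<in> {0<..<1}" by blast
      then show ?thesis
      proof cases
        case 1 then show ?thesis using h by simp
      next
        case 2 then show ?thesis using h reg[of t] by auto
      next
        case 3 then show ?thesis using h reg[of s] by auto
      qed
    next
      case False
      then show ?thesis using no[of s t] st by auto
    qed
  qed auto
  then show ?thesis using h(1) by (simp add: arc_def)
qed

text \<open>The form is odd under inversion, so \<open>1 / g\<close> run backwards solves the same
  equation as \<open>g\<close>. If \<open>g s = 1 / g t\<close>, then x |-> 1 / g (s + t - x) agrees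
  with \<open>g\<close> at \<open>s\<close>, hence also at the midpoint (s + t) / 2. There
  \<open>g\<close> equals its own inverse, so it would be \<open>1\<close> or
  \<open>-1\<close>.\<close>

lemma harc_inverse_disjoint:
  assumes "harc l p T g" "p \<noteq> 0" "p\<^sup>2 \<noteq> 1" "l \<noteq> 0" "s \<in> {0<..<1}" "t \<in> {0<..<1}"
  shows "g s \<noteq> 1 / g t"
proof
  assume eq: "g s = 1 / g t"
  let ?U = "- {0, 1, -1, p, 1 / p}"
  have U: "open ?U" by (simp add: open_Compl finite_imp_closed)
  have hol: "lform l p holomorphic_on ?U"
    by (rule holomorphic_on_subset[OF lform_holomorphic]) auto
  have W0: "lform l p v \<noteq> 0" if "v \<in> ?U" for v using lform_nonzero[OF assms(4)] that by auto
  have reg: "g t \<in> ?U \<and> (g has_vector_derivative of_real T / lform l p (g t)) (at t)" if "t \<in> {0<..<1}" for t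
    using harc_regular[OF assms(1) that] by simp
  \<comment> \<open>Between these bounds both \<open>x\<close> and \<open>s + t - x\<close> are
    interior times.\<close>
  define A where "A = max 0 (s + t - 1)" define B where "B = min 1 (s + t)"
  have inv: "1 / g (s + t - x) \<in> ?U \<and> ((\<lambda>x. 1 / g (s + t - x)) has_vector_derivative of_real T / lform l p (1 / g (s + t - x))) (at x)"
    if "x \<in> {A<..<B}" for x
  proof -
    have x: "s + t - x \<in> {0<..<1}" using that by (auto simp: A_def B_def)
    let ?v = "g (s + t - x)"
    have v: "?v \<in> ?U" "?v \<noteq> 0" using reg[OF x] by auto
    have "((\<lambda>x. s + t - x) has_vector_derivative -1) (at x)"
      by (auto intro!: derivative_eq_intros)
    then have "((\<lambda>x. g (s + t - x)) has_vector_derivative - (of_real T / lform l p ?v)) (at x)"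
      using vector_diff_chain_at[of "\<lambda>x. s + t - x" "-1" x g "of_real T / lform l p ?v"] conjunct2[OF reg[OF x]]
      by (simp add: o_def)
    moreover have "((\<lambda>v. 1 / v) has_field_derivative - (1 / ?v\<^sup>2)) (at ?v)"
      using v by (auto intro!: derivative_eq_intros simp: power2_eq_square)
    ultimately have "((\<lambda>x. 1 / g (s + t - x)) has_vector_derivative - (of_real T / lform l p ?v) * - (1 / ?v\<^sup>2)) (at x)"
      by (rule has_vector_derivative_compose_field)
    moreover have "- (of_real T / lform l p ?v) * - (1 / ?v\<^sup>2) = of_real T / lform l p (1 / ?v)"
      unfolding lform_inverse[OF v(2) assms(2)] by (simp add: field_simps)
    ultimately show ?thesis using regular_inverse[OF v(1)] by metis
  qed
  have m: "(s + t) / 2 \<in> {A<..<B}" "(s + t) / 2 \<in> {0<..<1}"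
    using assms(5,6) by (auto simp: A_def B_def max_def min_def)
  have sAB: "s \<in> {A<..<B}" using assms(5,6) by (auto simp: A_def B_def max_def min_def)
  have "g ((s + t) / 2) = 1 / g (s + t - (s + t) / 2)"
  proof (rule ode_unique[OF U hol W0 sAB _ _ inv m(1)])
    show "g s = 1 / g (s + t - s)" using eq by simp
    show "g x \<in> ?U \<and> (g has_vector_derivative of_real T / lform l p (g x)) (at x)" if "x \<in> {A<..<B}" for x
      by (rule reg) (use that in \<open>auto simp: A_def B_def\<close>)
  qed
  also have "s + t - (s + t) / 2 = (s + t) / 2" by (simp add: field_simps)
  finally have "(g ((s + t) / 2))\<^sup>2 = 1"
    using nonzero_eq_divide_eq[of "g ((s + t) / 2)" "g ((s + t) / 2)" 1] reg[OF m(2)]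
    by (auto simp: power2_eq_square)
  then show False using reg[OF m(2)] by (simp add: power2_eq_1_iff)
qed


section \<open>Winding numbers under inversion and their admissible values\<close>

lemma winding_number_continuous_log:
  assumes "path g" "z \<notin> path_image g" "continuous_on {0..1} L" "\<And>t. t \<in> {0..1} \<Longrightarrow> g t = z + exp (L t)"
  shows "L 1 - L 0 = 2 * of_real pi * \<i> * winding_number g z"
proof -
  obtain K where K: "continuous_on {0..1} K" "K 1 - K 0 = 2 * of_real pi * \<i> * winding_number g z"
    "\<And>t. t \<in> {0..1} \<Longrightarrow> g t = z + exp (K t)"
    using log_along_path[OF assms(1,2)] by metis
  have e: "exp (L t - K t) = 1" if "t \<in> {0..1}" for t
    using assms(4)[OF that] K(3)[OF that] by (simp add: exp_diff)
  \<comment> \<open>Two logarithms of the same path differ by multiples of 2 pi i. These lie at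
    distance at least 2 pi from each other, so a continuous difference is constant.\<close>
  have "(\<lambda>t. L t - K t) constant_on {0..1}"
  proof (rule continuous_discrete_range_constant)
    show "continuous_on {0..1} (\<lambda>t. L t - K t)" by (intro continuous_intros K assms)
    fix x :: real assume x: "x \<in> {0..1}"
    have "2 * pi \<le> norm (L y - K y - (L x - K x))" if "y \<in> {0..1}" "L y - K y \<noteq> L x - K x" for y
    proof -
      have "exp (L y - K y) = exp (L x - K x)" using e[OF x] e[OF that(1)] by simp
      then obtain n :: int where n: "L y - K y = L x - K x + of_int (2 * n) * pi * \<i>"
        unfolding exp_eq by blast
      then have "n \<noteq> 0" using that(2) by auto
      then have "1 \<le> \<bar>real_of_int n\<bar>" by linarith
      moreover have "norm (L y - K y - (L x - K x)) = 2 * \<bar>real_of_int n\<bar> * pi"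
        unfolding n by (simp add: norm_mult)
      ultimately show ?thesis by (simp add: mult_left_mono)
    qed
    then show "\<exists>e>0. \<forall>y. y \<in> {0..1} \<and> L y - K y \<noteq> L x - K x \<longrightarrow> e \<le> norm (L y - K y - (L x - K x))"
      using pi_gt_zero by (intro exI[of _ "2 * pi"]) auto
  qed simp
  then have "L 1 - K 1 = L 0 - K 0" unfolding constant_on_def by force
  then show ?thesis using K(2) by (simp add: algebra_simps)
qed

lemma winding_number_inverse_zero:
  assumes "path g" "0 \<notin> path_image g"
  shows "winding_number (\<lambda>t. 1 / g t) 0 = - winding_number g 0"
proof -
  have nz: "g t \<noteq> 0" if "t \<in> {0..1}" for t using assms(2) that unfolding path_image_def by (metis imageI)
  obtain L where L: "continuous_on {0..1} L" "L 1 - L 0 = 2 * of_real pi * \<i> * winding_number g 0"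
    "\<And>t. t \<in> {0..1} \<Longrightarrow> g t = 0 + exp (L t)"
    using log_along_path[OF assms] by metis
  have "- L 1 - - L 0 = 2 * of_real pi * \<i> * winding_number (\<lambda>t. 1 / g t) 0"
  proof (rule winding_number_continuous_log)
    show "path (\<lambda>t. 1 / g t)" using assms(1) nz unfolding path_def by (intro continuous_intros) auto
    show "0 \<notin> path_image (\<lambda>t. 1 / g t)" using nz unfolding path_image_def by auto
    show "continuous_on {0..1} (\<lambda>t. - L t)" using L(1) by (intro continuous_intros)
    show "1 / g t = 0 + exp (- L t)" if "t \<in> {0..1}" for t
      unfolding exp_minus using L(3)[OF that] by (simp add: inverse_eq_divide)
  qed
  then have "2 * of_real pi * \<i> * winding_number (\<lambda>t. 1 / g t) 0 = - (L 1 - L 0)" by simp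
  then show ?thesis unfolding L(2) by (metis mult_minus_right mult_cancel_left mult_eq_0_iff
    complex_i_not_zero of_real_eq_0_iff pi_neq_zero zero_neq_numeral)
qed

text \<open>From 1 / v - z = - z (v - 1 / z) / v: a logarithm of v - 1 / z minus one of v is, up to
  a constant, a logarithm of the left side.\<close>

lemma winding_number_inverse:
  assumes "path g" "0 \<notin> path_image g" "1 / z \<notin> path_image g" "z \<noteq> 0"
  shows "winding_number (\<lambda>t. 1 / g t) z = winding_number g (1 / z) - winding_number g 0"
proof -
  have nz: "g t \<noteq> 0" "g t \<noteq> 1 / z" if "t \<in> {0..1}" for t
    using assms(2,3) that unfolding path_image_def by (metis imageI)+
  obtain L where L: "continuous_on {0..1} L" "L 1 - L 0 = 2 * of_real pi * \<i> * winding_number g 0"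
    "\<And>t. t \<in> {0..1} \<Longrightarrow> g t = 0 + exp (L t)"
    using log_along_path[OF assms(1,2)] by metis
  obtain K where K: "continuous_on {0..1} K" "K 1 - K 0 = 2 * of_real pi * \<i> * winding_number g (1 / z)"
    "\<And>t. t \<in> {0..1} \<Longrightarrow> g t = 1 / z + exp (K t)"
    using log_along_path[OF assms(1,3)] by metis
  have "(K 1 - L 1 + Ln (- z)) - (K 0 - L 0 + Ln (- z)) = 2 * of_real pi * \<i> * winding_number (\<lambda>t. 1 / g t) z"
  proof (rule winding_number_continuous_log)
    show "path (\<lambda>t. 1 / g t)" using assms(1) nz unfolding path_def by (intro continuous_intros) auto
    show "z \<notin> path_image (\<lambda>t. 1 / g t)" 
    proof
      assume "z \<in> path_image (\<lambda>t. 1 / g t)"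
      then obtain t where "t \<in> {0..1}" "z = 1 / g t" unfolding path_image_def by blast
      then show False using nz[of t] by simp
    qed
    show "continuous_on {0..1} (\<lambda>t. K t - L t + Ln (- z))" by (intro continuous_intros K L)
    fix t :: real assume t: "t \<in> {0..1}"
    have "exp (K t - L t + Ln (- z)) = exp (K t) / exp (L t) * (- z)"
      using assms(4) by (simp add: exp_add exp_diff)
    also have "\<dots> = (g t - 1 / z) / g t * (- z)" using K(3)[OF t] L(3)[OF t] by simp
    finally have e: "exp (K t - L t + Ln (- z)) = (g t - 1 / z) / g t * (- z)" .
    show "1 / g t = z + exp (K t - L t + Ln (- z))"
      unfolding e using nz[OF t] assms(4) by (simp add: field_simps)
  qed
  then have "2 * of_real pi * \<i> * winding_number (\<lambda>t. 1 / g t) z = (K 1 - K 0) - (L 1 - L 0)"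
    by (simp add: algebra_simps)
  then have "2 * of_real pi * \<i> * winding_number (\<lambda>t. 1 / g t) z =
      2 * of_real pi * \<i> * (winding_number g (1 / z) - winding_number g 0)"
    unfolding L(2) K(2) right_diff_distrib .
  then show ?thesis by (metis mult_cancel_left mult_eq_0_iff
    complex_i_not_zero of_real_eq_0_iff pi_neq_zero zero_neq_numeral)
qed

text \<open>The deck transformation \<open>v \<mapsto> 1 / v\<close> reverses the form, so an arc and its image can only meet at fixed points
  of the transformation; together they form a Jordan curve, whose winding numbers are at most 1 in modulus.\<close>

lemma harc_loop_simple:
  assumes "harc l p T g" "p \<noteq> 0" "p\<^sup>2 \<noteq> 1" "l \<noteq> 0"
  shows "simple_path (g +++ reversepath (\<lambda>t. 1 / g t))"
proof -
  have h: "path g" "g 0 = 1" "g 1 = -1"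
    using assms(1) by (auto simp: harc_def pathstart_def pathfinish_def)
  have nz: "g t \<noteq> 0" if "t \<in> {0..1}" for t
    using harc_avoids(1)[OF assms(1-3)] that unfolding path_image_def by (metis imageI)
  have inj: "inj_on g {0..1}" using harc_arc[OF assms] by (simp add: arc_def)
  have "arc (\<lambda>t. 1 / g t)"
    unfolding arc_def path_def
  proof
    show "continuous_on {0..1} (\<lambda>t. 1 / g t)"
      using h(1) nz unfolding path_def by (intro continuous_intros) auto
    show "inj_on (\<lambda>t. 1 / g t) {0..1}"
      using inj nz by (auto simp: inj_on_def)
  qed
  moreover have "path_image g \<inter> path_image (\<lambda>t. 1 / g t) \<subseteq> {1, -1}"
  proof
    fix x assume "x \<in> path_image g \<inter> path_image (\<lambda>t. 1 / g t)"
    then obtain s t where s: "s \<in> {0..1}" "x = g s" and t: "t \<in> {0..1}" "x = 1 / g t"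
      unfolding path_image_def by blast
    have s01: "s = 0 \<or> s = 1 \<or> s \<in> {0<..<1}" using s(1) by (simp, linarith)
    have t01: "t = 0 \<or> t = 1 \<or> t \<in> {0<..<1}" using t(1) by (simp, linarith)
    show "x \<in> {1, -1}"
    proof (cases "s \<in> {0<..<1} \<and> t \<in> {0<..<1}")
      case True
      then show ?thesis using harc_inverse_disjoint[OF assms, of s t] s t by simp
    next
      case False
      then have "g s = 1 \<or> g s = -1 \<or> g t = 1 \<or> g t = -1" using s01 t01 h by auto
      then show ?thesis using s(2) t(2) by auto
    qed
  qed
  moreover have "pathstart g = 1" "pathfinish g = -1"
    "pathstart (\<lambda>t. 1 / g t) = 1" "pathfinish (\<lambda>t. 1 / g t) = -1"
    using h by (auto simp: pathstart_def pathfinish_def)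
  ultimately show ?thesis
    using harc_arc[OF assms] by (intro simple_path_join_loop) (auto simp: arc_reversepath)
qed

text \<open>With the odd integers m and n of \<open>winding_numbers_odd\<close>, the Jordan curve
  winds m times around \<open>0\<close>, (m + n) / 2 times around \<open>p\<close> and (m - n) / 2
  times around \<open>1 / p\<close>. All three numbers lie in {-1, 0, 1}; with m and n odd this
  leaves only 1 and -1 for each of them.\<close>

lemma harc_windings:
  assumes "harc l p T g" "p \<noteq> 0" "p\<^sup>2 \<noteq> 1" "l \<noteq> 0"
  shows "2 * winding_number g 0 \<in> {1, -1}"
    and "2 * (winding_number g p - winding_number g (1 / p)) \<in> {1, -1}"
proof -
  have h: "path g" "pathstart g = 1" "pathfinish g = -1" using assms(1) by (auto simp: harc_def)
  note av = harc_avoids[OF assms(1-3)]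
  have nz: "g t \<noteq> 0" if "t \<in> {0..1}" for t
    using av(1) that unfolding path_image_def by (metis imageI)
  let ?h = "\<lambda>t. 1 / g t"
  let ?J = "g +++ reversepath ?h"
  have hpath: "path ?h" using h(1) nz unfolding path_def by (intro continuous_intros) auto
  have hav: "1 / z \<notin> path_image ?h" if z: "z \<notin> path_image g" for z
  proof
    assume "1 / z \<in> path_image ?h"
    then obtain t where "t \<in> {0..1}" "1 / z = 1 / g t" unfolding path_image_def by blast
    then show False using z unfolding path_image_def by (metis divide_divide_eq_right div_by_1 mult_1 imageI)
  qed
  have h0: "0 \<notin> path_image ?h" using hav[OF av(1)] by simp
  have hp: "p \<notin> path_image ?h" "1 / p \<notin> path_image ?h" using hav[OF av(3)] hav[OF av(2)] by auto
  have ends: "pathfinish g = pathstart (reversepath ?h)" "pathstart ?h = 1"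
    using h by (auto simp: pathstart_def pathfinish_def reversepath_def)
  have J: "winding_number ?J z = winding_number g z - winding_number ?h z"
    if "z \<notin> path_image g" "z \<notin> path_image ?h" for z
    using that h hpath ends by (simp add: winding_number_join winding_number_reversepath)
  have cases: "winding_number ?J z \<in> {-1, 0, 1}" if "z \<notin> path_image g" "z \<notin> path_image ?h" for z
    by (rule simple_closed_path_winding_number_cases[OF harc_loop_simple[OF assms]])
       (use that h ends in \<open>auto simp: path_image_join\<close>)
  obtain m n :: int where mn: "2 * winding_number g 0 = of_int m" "odd m"
    "2 * (winding_number g p - winding_number g (1 / p)) = of_int n" "odd n"
    using winding_numbers_odd[OF h av assms(2)] by metis
  have J0: "winding_number ?J 0 = of_int m"
    using J[OF av(1) h0] winding_number_inverse_zero[OF h(1) av(1)] mn(1) by simp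
  have Jp: "2 * winding_number ?J p = of_int (n + m)"
    unfolding J[OF av(2) hp(1)] winding_number_inverse[OF h(1) av(1,3) assms(2)] of_int_add
      mn(1)[symmetric] mn(3)[symmetric] by (simp add: algebra_simps)
  have Jq: "2 * winding_number ?J (1 / p) = of_int (m - n)"
  proof -
    have "winding_number ?h (1 / p) = winding_number g p - winding_number g 0"
      using winding_number_inverse[OF h(1) av(1), of "1 / p"] av(2) assms(2) by simp
    note e = J[OF av(3) hp(2), unfolded this]
    show ?thesis unfolding e of_int_diff
      mn(1)[symmetric] mn(3)[symmetric] by (simp add: algebra_simps)
  qed
  have lift: "k \<in> {-1, 0, 1}" if "of_int k \<in> {-1, 0, 1 :: complex}" for k :: int
    using that by (auto simp: complex_eq_iff)
  have lift2: "k \<in> {-2, 0, 2}" if "of_int k = 2 * c" "c \<in> {-1, 0, 1 :: complex}" for k :: int and c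
    using that by (auto simp: complex_eq_iff)
  have "m \<in> {-1, 0, 1}" by (rule lift) (use J0 cases[OF av(1) h0] in simp)
  moreover have "n + m \<in> {-2, 0, 2}" "m - n \<in> {-2, 0, 2}"
    using lift2[OF Jp[symmetric] cases[OF av(2) hp(1)]] lift2[OF Jq[symmetric] cases[OF av(3) hp(2)]] by auto
  ultimately have m: "m = 1 \<or> m = -1" and n: "n = 1 \<or> n = -1" using mn(2) by auto
  show "2 * winding_number g 0 \<in> {1, -1}" unfolding mn(1) using m by auto
  show "2 * (winding_number g p - winding_number g (1 / p)) \<in> {1, -1}" unfolding mn(3) using n by auto
qed

section \<open>Passing between the plane and the lift\<close>

lemma increasing_inverse:
  fixes f :: "real \<Rightarrow> real"
  assumes "continuous_on {0..1} f" "f 0 = 0" "f 1 = 1"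
    and d: "\<And>t. t \<in> {0<..<1} \<Longrightarrow> (f has_real_derivative f' t) (at t)"
    and pos: "\<And>t. t \<in> {0<..<1} \<Longrightarrow> 0 < f' t"
  obtains \<theta> where "continuous_on {0..1} \<theta>" "\<theta> 0 = 0" "\<theta> 1 = 1"
    "\<And>s. s \<in> {0..1} \<Longrightarrow> \<theta> s \<in> {0..1}"
    "\<And>s. s \<in> {0<..<1} \<Longrightarrow> \<theta> s \<in> {0<..<1} \<and> (\<theta> has_real_derivative 1 / f' (\<theta> s)) (at s)"
proof -
  have inc: "f s < f t" if "s \<in> {0..1}" "t \<in> {0..1}" "s < t" for s t
  proof (rule DERIV_pos_imp_increasing_open[OF that(3)])
    show "\<exists>y. (f has_real_derivative y) (at x) \<and> 0 < y" if "s < x" "x < t" for x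
      using d[of x] pos[of x] that \<open>s \<in> {0..1}\<close> \<open>t \<in> {0..1}\<close> by auto
    show "continuous_on {s..t} f"
      by (rule continuous_on_subset[OF assms(1)]) (use that in auto)
  qed
  have inj: "inj_on f {0..1}" using inc by (intro linorder_inj_onI) (auto simp: less_imp_neq)
  have im: "f ` {0..1} = {0..1}"
  proof
    show "f ` {0..1} \<subseteq> {0..1}"
    proof safe
      fix t :: real assume t: "t \<in> {0..1}"
      show "f t \<in> {0..1}"
        using inc[of 0 t] inc[of t 1] t assms(2,3) by (cases "t = 0"; cases "t = 1") auto
    qed
    show "{0..1} \<subseteq> f ` {0..1}"
    proof
      fix y :: real assume "y \<in> {0..1}"
      then show "y \<in> f ` {0..1}" using IVT'[of f 0 y 1] assms(1-3) by auto
    qed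
  qed
  define \<theta> where "\<theta> = inv_into {0..1} f"
  have th: "\<theta> s \<in> {0..1}" "f (\<theta> s) = s" if "s \<in> {0..1}" for s
    using that im inv_into_into[of s f "{0..1}"] f_inv_into_f[of s f "{0..1}"] by (auto simp: \<theta>_def)
  have ft: "\<theta> (f t) = t" if "t \<in> {0..1}" for t
    using inj that by (simp add: \<theta>_def)
  have cont: "continuous_on {0..1} \<theta>"
    using continuous_on_inv[OF assms(1) compact_Icc, of \<theta>] ft im by auto
  have e: "\<theta> 0 = 0" "\<theta> 1 = 1" using ft[of 0] ft[of 1] assms(2,3) by auto
  have "\<theta> s \<in> {0<..<1} \<and> (\<theta> has_real_derivative 1 / f' (\<theta> s)) (at s)" if s: "s \<in> {0<..<1}" for s
  proof
    have "\<theta> s \<noteq> 0" "\<theta> s \<noteq> 1" using th(2)[of s] s assms(2,3) by auto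
    then show t: "\<theta> s \<in> {0<..<1}" using th(1)[of s] s by (simp add: less_le)
    have "isCont \<theta> s"
      using cont s by (metis continuous_on_eq_continuous_at continuous_on_subset
          greaterThanLessThan_subseteq_atLeastAtMost_iff open_greaterThanLessThan order_refl)
    then have "(\<theta> has_real_derivative inverse (f' (\<theta> s))) (at s)"
      using pos[OF t] s th(2) by (intro DERIV_inverse_function[where f = f and g = \<theta> and x = s and a = 0 and b = 1] d[OF t]) auto
    then show "(\<theta> has_real_derivative 1 / f' (\<theta> s)) (at s)" by (simp add: inverse_eq_divide)
  qed
  then show ?thesis using that cont e th(1) by blast
qed

text \<open>The primitive along such a path is real and increasing; divided by its final value
  \<open>T\<close> it becomes the new parameter. The bound of \<open>T\<close> by the speed
  \<open>q\<close> serves to identify the length of the seed arc later on.\<close>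

lemma harc_reparametrize:
  assumes "path g" "pathstart g = 1" "pathfinish g = -1" "p \<noteq> 0" "p\<^sup>2 \<noteq> 1"
    and reg: "\<And>t. t \<in> {0<..<1} \<Longrightarrow> g t \<notin> {0, 1, -1, p, 1 / p}"
    and d: "\<And>t. t \<in> {0<..<1} \<Longrightarrow> (g has_vector_derivative g' t) (at t)"
    and pos: "\<And>t. t \<in> {0<..<1} \<Longrightarrow> lform l p (g t) * g' t = of_real (q t) \<and> 0 < q t"
  obtains T h where "harc l p T h" "\<And>M. (\<And>t. t \<in> {0<..<1} \<Longrightarrow> q t \<le> M) \<Longrightarrow> T \<le> M"
proof -
  have g01: "g 0 = 1" "g 1 = -1" using assms by (auto simp: pathstart_def pathfinish_def)
  have "p \<noteq> 1" "p \<noteq> -1" using assms by auto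
  then have p1: "p \<noteq> 1" "p \<noteq> -1" "1 / p \<noteq> 1" "1 / p \<noteq> -1"
    using regular_inverse[of p 0] assms(4) by auto
  have nin: "g t \<noteq> 0 \<and> g t \<noteq> p \<and> g t \<noteq> 1 / p" if "t \<in> {0..1}" for t
  proof -
    have "t = 0 \<or> t = 1 \<or> t \<in> {0<..<1}" using that by (simp, linarith)
    then consider "t = 0" | "t = 1" | "t \<in> {0<..<1}" by blast
    then show ?thesis using reg[of t] g01 p1 by cases auto
  qed
  have av: "0 \<notin> path_image g" "p \<notin> path_image g" "1 / p \<notin> path_image g"
    using nin unfolding path_image_def by (metis imageE)+
  obtain \<phi> where f: "continuous_on {0..1} \<phi>" "\<phi> 0 = 0"
    "\<And>t. t \<in> {0<..<1} \<Longrightarrow> (\<phi> has_vector_derivative lform l p (g t) * g' t) (at t)"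
    using lform_integral_along[OF assms(1-3) av assms(4,5) d, of l] by metis
  have dRe: "((\<lambda>t. Re (\<phi> t)) has_real_derivative q t) (at t)" if "t \<in> {0<..<1}" for t
  proof -
    have "((\<lambda>t. Re (\<phi> t)) has_vector_derivative Re (of_real (q t))) (at t)"
      using f(3)[OF that] pos[OF that]
        bounded_linear.has_vector_derivative[OF bounded_linear_Re, of \<phi> "of_real (q t)"] by simp
    then show ?thesis by (simp add: has_real_derivative_iff_has_vector_derivative)
  qed
  have cRe: "continuous_on {0..1} (\<lambda>t. Re (\<phi> t))" by (intro continuous_intros f)
  define T where "T = Re (\<phi> 1)"
  have "Re (\<phi> 0) < Re (\<phi> 1)"
    by (rule DERIV_pos_imp_increasing_open[OF _ _ cRe]) (use dRe pos in auto)
  then have T: "0 < T" using f(2) by (simp add: T_def)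
  obtain \<theta> where th: "continuous_on {0..1} \<theta>" "\<theta> 0 = 0" "\<theta> 1 = 1"
    "\<And>s. s \<in> {0..1} \<Longrightarrow> \<theta> s \<in> {0..1}"
    "\<And>s. s \<in> {0<..<1} \<Longrightarrow> \<theta> s \<in> {0<..<1} \<and> (\<theta> has_real_derivative 1 / (q (\<theta> s) / T)) (at s)"
  proof (rule increasing_inverse[of "\<lambda>t. Re (\<phi> t) / T" "\<lambda>t. q t / T"])
    show "continuous_on {0..1} (\<lambda>t. Re (\<phi> t) / T)" using T by (intro continuous_intros cRe) auto
    show "((\<lambda>t. Re (\<phi> t) / T) has_real_derivative q t / T) (at t)" if "t \<in> {0<..<1}" for t
      by (rule DERIV_cdivide[OF dRe[OF that]])
  qed (use f T pos that in \<open>auto simp: T_def\<close>)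
  have "harc l p T (g \<circ> \<theta>)"
    unfolding harc_def
  proof (intro conjI ballI)
    show "path (g \<circ> \<theta>)"
      using assms(1) th(4) unfolding path_def o_def by (intro continuous_on_compose2[OF _ th(1)]) auto
    fix s :: real assume s: "s \<in> {0<..<1}"
    let ?t = "\<theta> s"
    have t: "?t \<in> {0<..<1}" and dt: "(\<theta> has_vector_derivative 1 / (q ?t / T)) (at s)"
      using th(5)[OF s] by (auto simp: has_real_derivative_iff_has_vector_derivative)
    show "(g \<circ> \<theta>) s \<notin> {0, 1, -1, p, 1 / p}" using reg[OF t] by simp
    have nz: "q ?t \<noteq> 0" "g' ?t \<noteq> 0" "lform l p (g ?t) \<noteq> 0" using pos[OF t] by auto
    have "((g \<circ> \<theta>) has_vector_derivative (1 / (q ?t / T)) *\<^sub>R g' ?t) (at s)"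
      by (rule vector_diff_chain_at[OF dt d[OF t]])
    moreover have "(1 / (q ?t / T)) *\<^sub>R g' ?t = of_real T * g' ?t / of_real (q ?t)"
      using T nz by (simp add: scaleR_conv_of_real)
    moreover have "of_real T * g' ?t / of_real (q ?t) = of_real T / lform l p ((g \<circ> \<theta>) s)"
      using pos[OF t] nz by (simp flip: conjunct1[OF pos[OF t]])
    ultimately show "((g \<circ> \<theta>) has_vector_derivative of_real T / lform l p ((g \<circ> \<theta>) s)) (at s)" by metis
  qed (use T th g01 in \<open>auto simp: pathstart_def pathfinish_def\<close>)
  moreover have "T \<le> M" if M: "\<And>t. t \<in> {0<..<1} \<Longrightarrow> q t \<le> M" for M
  proof -
    have "norm (\<phi> 1 - \<phi> 0) \<le> M * (1 - 0)"
    proof (rule vector_derivative_bound[OF _ f(1) f(3)])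
      show "norm (lform l p (g t) * g' t) \<le> M" if "t \<in> {0<..<1}" for t
        unfolding conjunct1[OF pos[OF that]] using M[OF that] pos[OF that] by simp
    qed auto
    then show ?thesis using f(2) complex_Re_le_cmod[of "\<phi> 1"] by (simp add: T_def)
  qed
  ultimately show ?thesis by (rule that)
qed

text \<open>Near \<open>t\<close> the ratio \<open>y s / y t\<close> has positive real part, so it
  is the principal root of \<open>f s / f t\<close>. This expresses \<open>y\<close> through the
  differentiable function \<open>csqrt\<close>.\<close>

lemma has_vector_derivative_continuous_sqrt:
  fixes y f :: "real \<Rightarrow> complex"
  assumes "isCont y t" "eventually (\<lambda>s. y s ^ 2 = f s) (nhds t)" "y t \<noteq> 0"
    and d: "(f has_vector_derivative d) (at t)"
  shows "(y has_vector_derivative d / (2 * y t)) (at t)"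
proof -
  have "((\<lambda>s. y s / y t) \<longlongrightarrow> y t / y t) (at t)"
    using assms(1,3) by (intro tendsto_intros) (auto simp: continuous_at)
  then have "eventually (\<lambda>s. dist (y s / y t) 1 < 1) (at t)"
    using assms(3) by (auto simp: tendsto_iff)
  then have "eventually (\<lambda>s. dist (y s / y t) 1 < 1) (nhds t)"
    unfolding eventually_at_filter by (rule eventually_mono) (use assms(3) in force)
  then have "eventually (\<lambda>s. y t * csqrt (f s / f t) = y s) (nhds t)"
    using assms(2)
  proof eventually_elim
    case (elim s)
    have "\<bar>Re (y s / y t - 1)\<bar> < 1"
      using elim(1) abs_Re_le_cmod[of "y s / y t - 1"] by (simp add: dist_norm)
    then have "0 < Re (y s / y t)" by simp
    moreover have "f s / f t = (y s / y t)\<^sup>2"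
      using elim(2) eventually_nhds_x_imp_x[OF assms(2)] by (simp add: power_divide)
    ultimately show ?case using assms(3) by (simp add: csqrt_square)
  qed
  then obtain S where S: "open S" "t \<in> S" "\<And>s. s \<in> S \<Longrightarrow> y t * csqrt (f s / f t) = y s"
    unfolding eventually_nhds by auto
  have ft: "f t = (y t)\<^sup>2" "f t \<noteq> 0" using eventually_nhds_x_imp_x[OF assms(2)] assms(3) by auto
  have "((\<lambda>w. y t * csqrt (w / f t)) has_field_derivative y t * (1 / f t / (2 * csqrt 1))) (at (f t))"
    using ft(2) by (auto intro!: derivative_eq_intros)
  then have "((\<lambda>s. y t * csqrt (f s / f t)) has_vector_derivative d * (y t * (1 / f t / (2 * csqrt 1)))) (at t)"
    by (rule has_vector_derivative_compose_field[OF d])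
  moreover have "d * (y t * (1 / f t / (2 * csqrt 1))) = d / (2 * y t)"
    using ft assms(3) by (simp add: power2_eq_square)
  ultimately have "((\<lambda>s. y t * csqrt (f s / f t)) has_vector_derivative d / (2 * y t)) (at t)" by simp
  then show ?thesis by (rule has_vector_derivative_transform_within_open[OF _ S])
qed

definition joukowski :: "complex \<Rightarrow> complex \<Rightarrow> complex \<Rightarrow> complex" where
  "joukowski a b v = (a + b) / 2 + (a - b) / 4 * (v + 1 / v)"

lemma joukowski_factor:
  assumes "v \<noteq> 0" "a \<noteq> b"
  shows "joukowski a b v - a = (a - b) / 4 * (v - 1)\<^sup>2 / v"
    and "joukowski a b v - b = (a - b) / 4 * (v + 1)\<^sup>2 / v"
  using assms by (simp_all add: joukowski_def field_simps power2_eq_square)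

lemma joukowski_zero_factor:
  assumes "v \<noteq> 0" "p \<noteq> 0" "a \<noteq> b" "p + 1 / p = - 2 * (a + b) / (a - b)"
  shows "joukowski a b v = (a - b) / 4 * (v - p) * (v - 1 / p) / v"
proof -
  have "a + b = - (a - b) / 2 * (p + 1 / p)" unfolding assms(4) using assms(3) by (simp add: field_simps)
  moreover have "(a + b) / 2 + (a - b) / 4 * w = (a - b) / 4 * (w - P)" if "a + b = - (a - b) / 2 * P" for w P
    unfolding that by (simp add: field_simps)
  ultimately have "joukowski a b v = (a - b) / 4 * (v + 1 / v - (p + 1 / p))"
    unfolding joukowski_def by blast
  also have "v + 1 / v - (p + 1 / p) = (v - p) * (v - 1 / p) / v"
    using assms(1,2) by (simp add: field_simps)
  finally show ?thesis by simp
qed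

text \<open>The square of the lifted form is the pullback of the quadratic differential. The scale
  (a - b) / 4 cancels because the differential is unchanged when z, a and b are multiplied by a
  common factor.\<close>

lemma quad_diff_joukowski:
  assumes "v \<noteq> 0" "p \<noteq> 0" "a \<noteq> b" "p + 1 / p = - 2 * (a + b) / (a - b)"
  shows "quad_diff l a b (joukowski a b v) * ((a - b) / 4 * (1 - 1 / v\<^sup>2) * d)\<^sup>2 = (lform l p v * d)\<^sup>2"
proof -
  define c where "c = (a - b) / 4"
  define D where "D = (v - p) * (v - 1 / p)"
  have c: "c \<noteq> 0" using assms by (simp add: c_def)
  have 1: "joukowski a b v = c * D / v" "joukowski a b v - a = c * (v - 1)\<^sup>2 / v"
    "joukowski a b v - b = c * (v + 1)\<^sup>2 / v"
    using joukowski_factor[OF assms(1,3)] joukowski_zero_factor[OF assms] by (simp_all add: c_def D_def)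
  have "quad_diff l a b (joukowski a b v) * (c * (1 - 1 / v\<^sup>2) * d)\<^sup>2
     = l\<^sup>2 * ((c * (v - 1)\<^sup>2 / v) * (c * (v + 1)\<^sup>2 / v) / (c * D / v) ^ 4) * (c * ((v - 1) * (v + 1) / v\<^sup>2) * d)\<^sup>2"
  proof -
    have "1 - 1 / v\<^sup>2 = (v - 1) * (v + 1) / v\<^sup>2"
      using assms(1) by (simp add: field_simps power2_eq_square)
    then show ?thesis unfolding quad_diff_def 1(2,3) unfolding 1(1) by simp
  qed
  also have "\<dots> = (l * ((v - 1) * (v + 1))\<^sup>2 / (v * D\<^sup>2) * d)\<^sup>2"
    using assms(1) c by (cases "D = 0") (simp_all add: field_simps power2_eq_square power4_eq_xxxx)
  also have "l * ((v - 1) * (v + 1))\<^sup>2 / (v * D\<^sup>2) = lform l p v"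
  proof -
    have "(v - 1) * (v + 1) = v\<^sup>2 - 1" by (simp add: algebra_simps power2_eq_square)
    then show ?thesis by (simp add: lform_def D_def power_mult_distrib mult.assoc)
  qed
  finally show ?thesis by (simp add: c_def)
qed


lemma real_square_constant_sign:
  fixes w :: "real \<Rightarrow> complex"
  assumes "continuous_on {0<..<1} w" "\<And>t. t \<in> {0<..<1} \<Longrightarrow> (w t)\<^sup>2 \<in> complex_of_real ` {0<..}"
  shows "(\<forall>t\<in>{0<..<1}. w t = of_real (Re (w t)) \<and> 0 < Re (w t)) \<or>
         (\<forall>t\<in>{0<..<1}. w t = of_real (Re (w t)) \<and> Re (w t) < 0)"
proof -
  have re: "Im (w t) = 0 \<and> Re (w t) \<noteq> 0" if t: "t \<in> {0<..<1}" for t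
  proof -
    obtain r where r: "(w t)\<^sup>2 = of_real r" "0 < r" using assms(2)[OF t] by auto
    then have "Re (w t) * Im (w t) = 0" "(Re (w t))\<^sup>2 - (Im (w t))\<^sup>2 = r"
      by (auto simp: complex_eq_iff power2_eq_square)
    then show ?thesis using r(2) by auto
  qed
  have c: "continuous_on {0<..<1} (\<lambda>t. Re (w t))" by (intro continuous_intros assms)
  have "connected ((\<lambda>t. Re (w t)) ` {0<..<1})" by (rule connected_continuous_image[OF c]) simp
  then have "\<not> (Re (w s) < 0 \<and> 0 < Re (w t))" if "s \<in> {0<..<1}" "t \<in> {0<..<1}" for s t
    using connectedD_interval[of "(\<lambda>t. Re (w t)) ` {0<..<1}" "Re (w s)" "Re (w t)" 0] re that by force
  then have "(\<forall>t\<in>{0<..<1}. 0 < Re (w t)) \<or> (\<forall>t\<in>{0<..<1}. Re (w t) < 0)"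
    using re by (meson linorder_neqE_linordered_idom)
  then show ?thesis using re by (auto simp: complex_eq_iff)
qed

lemma harc_from_signed:
  assumes lim: "(v \<longlongrightarrow> 1) (at_right 0)" "(v \<longlongrightarrow> -1) (at_left 1)"
    and p: "p \<noteq> 0" "p\<^sup>2 \<noteq> 1"
    and reg: "\<And>t. t \<in> {0<..<1} \<Longrightarrow> v t \<notin> {0, 1, -1, p, 1 / p}"
    and d: "\<And>t. t \<in> {0<..<1} \<Longrightarrow> (v has_vector_derivative v' t) (at t)"
    and pos: "\<And>t. t \<in> {0<..<1} \<Longrightarrow> lform l p (v t) * v' t = of_real (q t) \<and> 0 < q t"
  shows "\<exists>T h. harc l p T h"
proof -
  obtain g where g: "continuous_on {0..1} g" "g 0 = 1" "g 1 = -1" and gv: "\<And>t. t \<in> {0<..<1} \<Longrightarrow> g t = v t"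
    using endpoint_extension[OF has_vector_derivative_continuous[OF d] lim] by blast
  have dg: "(g has_vector_derivative v' t) (at t)" if t: "t \<in> {0<..<1}" for t
    by (rule has_vector_derivative_transform_within_open[OF d[OF t], of "{0<..<1}"]) (use t gv in auto)
  have "path g" "pathstart g = 1" "pathfinish g = -1"
    using g by (simp_all add: path_def pathstart_def pathfinish_def)
  moreover have "g t \<notin> {0, 1, -1, p, 1 / p}" "lform l p (g t) * v' t = of_real (q t) \<and> 0 < q t"
    if "t \<in> {0<..<1}" for t
    unfolding gv[OF that] using reg pos that by blast+
  ultimately show ?thesis using harc_reparametrize[of g p v' l q] p dg by metis
qed

text \<open>With x = v + 1 / v as normalised coordinate of the plane, choosing a lift v amounts to
  choosing a root y = v - 1 / v of x^2 - 4. The latter has no zeros on a curve of regular points and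
  the interval is contractible, so a continuous root exists. On the lift the form is real without
  zeros, hence of constant sign.\<close>

lemma harc_of_horizontal_curve:
  assumes hc: "horizontal_curve l a b g" and ends: "has_endpoints g a b"
    and p: "p \<noteq> 0" "p\<^sup>2 \<noteq> 1" "a \<noteq> b" "p + 1 / p = - 2 * (a + b) / (a - b)"
  shows "\<exists>T h. harc l p T h"
proof -
  let ?I = "{0<..<1::real}"
  define c where "c = (a - b) / 4"
  have c: "c \<noteq> 0" using p(3) by (simp add: c_def)
  obtain g' where g': "\<And>t. t \<in> ?I \<Longrightarrow> (g has_vector_derivative g' t) (at t)" "continuous_on ?I g'"
    using hc unfolding horizontal_curve_def C1_differentiable_on_def by blast
  have greg: "g t \<noteq> 0" "g t \<noteq> a" "g t \<noteq> b"
    "quad_diff l a b (g t) * (g' t)\<^sup>2 \<in> complex_of_real ` {0<..}" if t: "t \<in> ?I" for t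
  proof -
    have h: "g t \<in> regular_points a b \<and>
        quad_diff l a b (g t) * (vector_derivative g (at t))\<^sup>2 \<in> complex_of_real ` {0<..}"
      using hc t unfolding horizontal_curve_def by blast
    show "g t \<noteq> 0" "g t \<noteq> a" "g t \<noteq> b" using h by (auto simp: regular_points_def)
    show "quad_diff l a b (g t) * (g' t)\<^sup>2 \<in> complex_of_real ` {0<..}"
      using h unfolding vector_derivative_at[OF g'(1)[OF t]] by blast
  qed
  define x where "x t = (g t - (a + b) / 2) / c" for t
  have gx: "g t = (a + b) / 2 + c * x t" for t using c by (simp add: x_def)
  have dx: "(x has_vector_derivative g' t / c) (at t)" if "t \<in> ?I" for t
  proof -
    have "((\<lambda>z. (z - (a + b) / 2) / c) has_field_derivative 1 / c) (at (g t))"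
      using c by (auto intro!: derivative_eq_intros)
    from has_vector_derivative_compose_field[OF g'(1)[OF that] this] show ?thesis by (simp add: x_def[abs_def])
  qed
  have cg: "continuous_on ?I g"
    using g'(1) by (intro continuous_at_imp_continuous_on ballI) (metis has_vector_derivative_continuous)
  have cx: "continuous_on ?I x" unfolding x_def using c by (intro continuous_intros cg) auto
  have x4: "(x t)\<^sup>2 - 4 \<noteq> 0" if "t \<in> ?I" for t
  proof
    assume "(x t)\<^sup>2 - 4 = 0"
    then have "(x t - 2) * (x t + 2) = 0" by (simp add: algebra_simps power2_eq_square)
    then have "x t = 2 \<or> x t = -2"
      by (metis eq_iff_diff_eq_0 eq_neg_iff_add_eq_0 mult_eq_0_iff)
    then have "g t = a \<or> g t = b" unfolding gx c_def by (auto simp: field_simps)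
    then show False using greg[OF that] by blast
  qed
  obtain y where y: "continuous_on ?I y" "\<And>t. t \<in> ?I \<Longrightarrow> (x t)\<^sup>2 - 4 = (y t)\<^sup>2"
  proof (rule continuous_sqrt_on_contractible[of ?I "\<lambda>t. (x t)\<^sup>2 - 4"])
    show "continuous_on ?I (\<lambda>t. (x t)\<^sup>2 - 4)" by (intro continuous_intros cx)
    show "contractible ?I" by (simp add: convex_imp_contractible)
  qed (use x4 in auto)
  have y0: "y t \<noteq> 0" if "t \<in> ?I" for t using x4[OF that] y(2)[OF that] by auto
  define v where "v t = (x t + y t) / 2" for t
  have vu: "v t * ((x t - y t) / 2) = 1" if "t \<in> ?I" for t
    using y(2)[OF that] by (simp add: v_def field_simps power2_eq_square)
  have rec: "q \<noteq> 0" "1 / q = r" if "q * r = 1" for q r :: complex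
    using that by (auto simp: divide_eq_eq mult.commute)
  have v0: "v t \<noteq> 0" and vinv: "1 / v t = (x t - y t) / 2" if "t \<in> ?I" for t
    using rec[OF vu[OF that]] by auto
  have xv: "v t + 1 / v t = x t" if "t \<in> ?I" for t
    unfolding vinv[OF that] by (simp add: v_def field_simps)
  have yv: "v t - 1 / v t = y t" if "t \<in> ?I" for t
    unfolding vinv[OF that] by (simp add: v_def field_simps)
  have gv: "g t = joukowski a b (v t)" if "t \<in> ?I" for t
    unfolding joukowski_def xv[OF that] gx c_def ..
  define v' where "v' t = (g' t / c + (2 * x t * (g' t / c)) / (2 * y t)) / 2" for t
  have dv: "(v has_vector_derivative v' t) (at t)" if t: "t \<in> ?I" for t
  proof -
    have 1: "isCont y t" using y(1) t by (simp add: continuous_on_eq_continuous_at)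
    have 2: "eventually (\<lambda>s. y s ^ 2 = (x s)\<^sup>2 - 4) (nhds t)"
      using eventually_nhds_in_open[of ?I t] t y(2) by (auto elim!: eventually_mono)
    have 3: "((\<lambda>z. z\<^sup>2 - 4) has_field_derivative 2 * x t) (at (x t))"
      by (auto intro!: derivative_eq_intros)
    have "(y has_vector_derivative g' t / c * (2 * x t) / (2 * y t)) (at t)"
      by (rule has_vector_derivative_continuous_sqrt[OF 1 2 y0[OF t] has_vector_derivative_compose_field[OF dx[OF t] 3]])
    from has_vector_derivative_add[OF dx[OF t] this]
    have "((\<lambda>s. x s + y s) has_vector_derivative g' t / c + g' t / c * (2 * x t) / (2 * y t)) (at t)" .
    from has_vector_derivative_mult_right[OF this, of "1 / 2"]
    show ?thesis by (simp add: v_def[abs_def] v'_def mult.commute)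
  qed
  have g'v: "g' t = c * (1 - 1 / (v t)\<^sup>2) * v' t" if t: "t \<in> ?I" for t
  proof -
    have "v' t = g' t / c * v t / y t"
      using y0[OF t] c by (simp add: v'_def v_def field_simps)
    moreover have "1 - 1 / (v t)\<^sup>2 = y t / v t"
      unfolding yv[OF t, symmetric] using v0[OF t] by (simp add: field_simps power2_eq_square)
    ultimately show ?thesis using y0[OF t] v0[OF t] c by simp
  qed
  have cv: "continuous_on ?I v" unfolding v_def by (intro continuous_intros cx y) auto
  have cv': "continuous_on ?I v'" unfolding v'_def using c y0 by (intro continuous_intros cx y g'(2)) auto
  have vreg: "v t \<notin> {0, 1, -1, p, 1 / p}" if t: "t \<in> ?I" for t
  proof -
    have "v t \<noteq> p" "v t \<noteq> 1 / p"
      using joukowski_zero_factor[OF v0[OF t] p(1,3,4)] greg(1)[OF t] gv[OF t] by auto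
    moreover have "v t \<noteq> 1" "v t \<noteq> -1" using yv[OF t] y0[OF t] by auto
    ultimately show ?thesis using v0[OF t] by auto
  qed
  have sq: "(lform l p (v t) * v' t)\<^sup>2 \<in> complex_of_real ` {0<..}" if t: "t \<in> ?I" for t
    using greg(4)[OF t] quad_diff_joukowski[OF v0[OF t] p(1,3,4), of l "v' t"]
    unfolding gv[OF t] g'v[OF t] c_def by simp
  have cW: "continuous_on ?I (\<lambda>t. lform l p (v t) * v' t)"
  proof (intro continuous_on_mult cv')
    have "v ` ?I \<subseteq> - {0, p, 1 / p}"
    proof (rule image_subsetI)
      show "v t \<in> - {0, p, 1 / p}" if "t \<in> ?I" for t using vreg[OF that] by simp
    qed
    then show "continuous_on ?I (\<lambda>t. lform l p (v t))"
      by (rule continuous_on_compose2[OF holomorphic_on_imp_continuous_on[OF lform_holomorphic] cv])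
  qed
  have lx: "(x \<longlongrightarrow> 2) (at_right 0)" "(x \<longlongrightarrow> -2) (at_left 1)"
  proof -
    have "(x \<longlongrightarrow> (a - (a + b) / 2) / c) (at_right 0)" "(x \<longlongrightarrow> (b - (a + b) / 2) / c) (at_left 1)"
      unfolding x_def using ends c
      by (auto intro!: tendsto_divide tendsto_diff tendsto_const simp: has_endpoints_def)
    moreover have "(a - (a + b) / 2) / c = 2" "(b - (a + b) / 2) / c = -2"
      using p(3) by (simp_all add: c_def field_simps)
    ultimately show "(x \<longlongrightarrow> 2) (at_right 0)" "(x \<longlongrightarrow> -2) (at_left 1)" by simp_all
  qed
  have evI: "eventually (\<lambda>t. t \<in> ?I) (at_right 0)" "eventually (\<lambda>t. t \<in> ?I) (at_left 1)"
    using eventually_at_right_real[of 0 1] eventually_at_left_real[of 0 1] by auto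
  \<comment> \<open>At the ends x tends to 2 or -2, so y tends to 0 and v = (x + y) / 2 tends to
    \<open>1\<close> or \<open>-1\<close>, whichever root was chosen.\<close>
  have ly: "(y \<longlongrightarrow> 0) F" if F: "eventually (\<lambda>t. t \<in> ?I) F" "(x \<longlongrightarrow> k) F" "k\<^sup>2 = 4" for F k
  proof -
    have "((\<lambda>t. (x t)\<^sup>2 - 4) \<longlongrightarrow> k\<^sup>2 - 4) F" by (intro tendsto_intros F)
    moreover have "eventually (\<lambda>t. (x t)\<^sup>2 - 4 = (y t)\<^sup>2) F"
      using F(1) by (rule eventually_mono) (rule y(2))
    ultimately have "((\<lambda>t. (y t)\<^sup>2) \<longlongrightarrow> 0) F"
      using F(3) Lim_transform_eventually by fastforce
    then have "((\<lambda>t. sqrt (norm ((y t)\<^sup>2))) \<longlongrightarrow> sqrt 0) F"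
      by (intro tendsto_real_sqrt tendsto_norm_zero)
    then have "((\<lambda>t. norm (y t)) \<longlongrightarrow> 0) F" by (simp add: norm_power)
    then show ?thesis by (rule tendsto_norm_zero_cancel)
  qed
  have lv: "(v \<longlongrightarrow> 1) (at_right 0)" "(v \<longlongrightarrow> -1) (at_left 1)"
  proof -
    have "(v \<longlongrightarrow> (2 + 0) / 2) (at_right 0)"
      unfolding v_def by (intro tendsto_divide tendsto_add tendsto_const lx(1) ly[OF evI(1) lx(1)]) auto
    moreover have "(v \<longlongrightarrow> (-2 + 0) / 2) (at_left 1)"
      unfolding v_def by (intro tendsto_divide tendsto_add tendsto_const lx(2) ly[OF evI(2) lx(2)]) auto
    ultimately show "(v \<longlongrightarrow> 1) (at_right 0)" "(v \<longlongrightarrow> -1) (at_left 1)" by simp_all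
  qed
  from real_square_constant_sign[OF cW sq] show ?thesis
  proof
    assume pos: "\<forall>t\<in>?I. lform l p (v t) * v' t = of_real (Re (lform l p (v t) * v' t)) \<and> 0 < Re (lform l p (v t) * v' t)"
    show ?thesis by (rule harc_from_signed[OF lv p(1,2) vreg dv bspec[OF pos]])
  next
    assume neg: "\<forall>t\<in>?I. lform l p (v t) * v' t = of_real (Re (lform l p (v t) * v' t)) \<and> Re (lform l p (v t) * v' t) < 0"
    \<comment> \<open>The other lift \<open>1 / v\<close> has the same ends, and on it the form has
      the opposite sign.\<close>
    have l': "((\<lambda>t. 1 / v t) \<longlongrightarrow> 1 / 1) (at_right 0)" "((\<lambda>t. 1 / v t) \<longlongrightarrow> 1 / -1) (at_left 1)"
      by (rule tendsto_divide[OF tendsto_const lv(1)], simp)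
         (rule tendsto_divide[OF tendsto_const lv(2)], simp)
    have r': "1 / v t \<notin> {0, 1, -1, p, 1 / p}" if "t \<in> ?I" for t
      using regular_inverse[of "v t" p] vreg[OF that] by auto
    have d': "((\<lambda>t. 1 / v t) has_vector_derivative v' t * - (1 / (v t)\<^sup>2)) (at t)" if t: "t \<in> ?I" for t
    proof (rule has_vector_derivative_compose_field[OF dv[OF t]])
      show "((\<lambda>v. 1 / v) has_field_derivative - (1 / (v t)\<^sup>2)) (at (v t))"
        using v0[OF t] by (auto intro!: derivative_eq_intros simp: power2_eq_square)
    qed
    show ?thesis
    proof (rule harc_from_signed[OF _ _ p(1,2) r' d'])
      show "((\<lambda>t. 1 / v t) \<longlongrightarrow> 1) (at_right 0)" "((\<lambda>t. 1 / v t) \<longlongrightarrow> - 1) (at_left 1)"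
        using l' by simp_all
      fix t assume t: "t \<in> ?I"
      have "lform l p (1 / v t) * (v' t * - (1 / (v t)\<^sup>2)) = - (lform l p (v t) * v' t)"
        unfolding lform_inverse[OF v0[OF t] p(1)] using v0[OF t] by simp
      then show "lform l p (1 / v t) * (v' t * - (1 / (v t)\<^sup>2)) = of_real (- Re (lform l p (v t) * v' t)) \<and> 0 < - Re (lform l p (v t) * v' t)"
        using neg t by (metis neg_0_less_iff_less of_real_minus)
    qed
  qed
qed

section \<open>Maximality of horizontal curves that end at zeros\<close>

lemma quad_diff_holomorphic: "quad_diff l a b holomorphic_on - {0}"
  unfolding quad_diff_def by (intro holomorphic_intros) auto

lemma horizontal_curve_derivative:
  assumes "horizontal_curve l a b g" "t \<in> {0<..<1}"
  shows "(g has_vector_derivative vector_derivative g (at t)) (at t)"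
    "g t \<in> regular_points a b"
    "quad_diff l a b (g t) * (vector_derivative g (at t))\<^sup>2 \<in> complex_of_real ` {0<..}"
  using assms unfolding horizontal_curve_def C1_differentiable_on_eq
  by (auto simp: vector_derivative_works)

text \<open>Horizontality determines the square of the velocity in the coordinate \<open>F\<close>,
  so this velocity is real and nonzero but of unknown sign. That suffices to fix the imaginary part
  and to let the real part pass strictly through its value at \<open>t\<close>.\<close>

lemma horizontal_local_primitive:
  assumes "horizontal_curve l a b g" "t \<in> {0<..<1}" "0 < r"
    and q: "\<And>w. w \<in> ball (g t) r \<Longrightarrow> (f w)\<^sup>2 = quad_diff l a b w"
    and F: "\<And>w. w \<in> ball (g t) r \<Longrightarrow> (F has_field_derivative f w) (at w)"
  obtains d D where "0 < d" "D \<noteq> 0" "ball t d \<subseteq> {0<..<1}" "g ` ball t d \<subseteq> ball (g t) r"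
    "\<And>s. s \<in> ball t d \<Longrightarrow> Im (F (g s)) = Im (F (g t))"
    "((\<lambda>s. Re (F (g s))) has_real_derivative D) (at t)"
    "\<And>s. s \<in> ball t d \<Longrightarrow> isCont (\<lambda>s. Re (F (g s))) s"
proof -
  let ?g' = "\<lambda>s. vector_derivative g (at s)"
  note h = horizontal_curve_derivative[OF assms(1)]
  have "isCont g t" using h(1)[OF assms(2)] has_vector_derivative_continuous by blast
  then have "eventually (\<lambda>s. dist (g s) (g t) < r) (nhds t)"
    using assms(3) by (auto simp: continuous_at tendsto_iff eventually_nhds_conv_at)
  moreover have "eventually (\<lambda>s. s \<in> {0<..<1}) (nhds t)"
    using assms(2) by (intro eventually_nhds_in_open) auto
  ultimately have "eventually (\<lambda>s. g s \<in> ball (g t) r \<and> s \<in> {0<..<1}) (nhds t)"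
    by eventually_elim (auto simp: dist_commute)
  then obtain d where d: "d > 0" "\<And>s. s \<in> ball t d \<Longrightarrow> g s \<in> ball (g t) r \<and> s \<in> {0<..<1}"
    unfolding eventually_nhds_metric by (auto simp: dist_commute)
  have real: "Im (?g' s * f (g s)) = 0" "Re (?g' s * f (g s)) \<noteq> 0" if s: "s \<in> ball t d" for s
  proof -
    have "(?g' s * f (g s))\<^sup>2 = quad_diff l a b (g s) * (?g' s)\<^sup>2"
      using q[of "g s"] d(2)[OF s] by (simp add: power_mult_distrib mult.commute)
    then obtain x where x: "(?g' s * f (g s))\<^sup>2 = of_real x" "0 < x"
      using h(3)[of s] d(2)[OF s] by auto
    then have "Re (?g' s * f (g s)) * Im (?g' s * f (g s)) = 0"
      "(Re (?g' s * f (g s)))\<^sup>2 - (Im (?g' s * f (g s)))\<^sup>2 = x"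
      by (metis Im_complex_of_real Im_power2 mult_eq_0_iff zero_neq_numeral, metis Re_complex_of_real Re_power2)
    then show "Im (?g' s * f (g s)) = 0" "Re (?g' s * f (g s)) \<noteq> 0" using x(2)
      by (metis mult_eq_0_iff diff_0 neg_0_less_iff_less not_sum_power2_lt_zero power_zero_numeral add_0 zero_less_power2 order_less_asym)+
  qed
  have D: "((\<lambda>s. F (g s)) has_vector_derivative ?g' s * f (g s)) (at s)" if s: "s \<in> ball t d" for s
    using has_vector_derivative_compose_field[OF h(1) F] d(2)[OF s] by blast
  have DRe: "((\<lambda>s. Re (F (g s))) has_real_derivative Re (?g' s * f (g s))) (at s)" if s: "s \<in> ball t d" for s
    using bounded_linear.has_vector_derivative[OF bounded_linear_Re D[OF s]]
    by (simp add: has_real_derivative_iff_has_vector_derivative)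
  have DIm: "((\<lambda>s. Im (F (g s))) has_vector_derivative 0) (at s within ball t d)" if s: "s \<in> ball t d" for s
    using bounded_linear.has_vector_derivative[OF bounded_linear_Im D[OF s]] real(1)[OF s]
      has_vector_derivative_at_within by fastforce
  have Im: "Im (F (g s)) = Im (F (g t))" if s: "s \<in> ball t d" for s
  proof -
    obtain C where "\<And>x. x \<in> ball t d \<Longrightarrow> Im (F (g x)) = C"
      using has_vector_derivative_zero_constant[of "ball t d" "\<lambda>s. Im (F (g s))"] DIm by auto
    then show ?thesis using s d(1) by simp
  qed
  have sub: "ball t d \<subseteq> {0<..<1}" "g ` ball t d \<subseteq> ball (g t) r" using d(2) by blast+
  show ?thesis
    by (rule that[OF d(1) real(2) sub Im DRe DERIV_isCont[OF DRe]]) (use d(1) in auto)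
qed

text \<open>In the coordinate \<open>F\<close> both curves lie on one horizontal line near the
  common point. The real part along \<open>g\<close> takes values on both sides of that point, so by
  connectedness \<open>g\<close> covers an open segment around it, and \<open>h\<close> stays in
  this segment for a while.\<close>

lemma horizontal_curves_meet_locally:
  assumes g: "horizontal_curve l a b g" and h: "horizontal_curve l a b h" and l: "l \<noteq> 0"
    and s: "s \<in> {0<..<1}" and t: "t \<in> {0<..<1}" and eq: "h t = g s"
  shows "eventually (\<lambda>u. h u \<in> g ` {0<..<1}) (nhds t)"
proof -
  let ?z = "g s"
  have reg: "?z \<in> regular_points a b" using horizontal_curve_derivative(2)[OF g s] .
  have op: "open (regular_points a b)" unfolding regular_points_def by (intro open_Compl finite_imp_closed) auto
  obtain R where R: "R > 0" "ball ?z R \<subseteq> regular_points a b"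
    using op reg open_contains_ball by blast
  have hol: "quad_diff l a b holomorphic_on ball ?z R"
  proof (rule holomorphic_on_subset[OF quad_diff_holomorphic])
    show "ball ?z R \<subseteq> - {0}" using R(2) unfolding regular_points_def by blast
  qed
  have nz: "quad_diff l a b w \<noteq> 0" if "w \<in> ball ?z R" for w
  proof -
    have "w \<in> - {0, a, b}" using R(2) that unfolding regular_points_def by blast
    then show ?thesis using l by (simp add: quad_diff_def)
  qed
  obtain f where f: "f holomorphic_on ball ?z R" "\<And>w. w \<in> ball ?z R \<Longrightarrow> quad_diff l a b w = (f w)\<^sup>2"
    using contractible_imp_holomorphic_sqrt[OF hol _ nz] convex_imp_contractible[OF convex_ball] by blast
  have fz: "f ?z \<noteq> 0" using f(2)[of ?z] nz[of ?z] R(1) by auto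
  obtain r F where r: "r > 0" "ball ?z r \<subseteq> ball ?z R" "inj_on F (ball ?z r)"
    and F: "\<And>w. w \<in> ball ?z r \<Longrightarrow> (F has_field_derivative f w) (at w)"
    using local_injective_primitive[OF open_ball f(1) _ fz] R(1) by auto
  have q: "(f w)\<^sup>2 = quad_diff l a b w" if "w \<in> ball ?z r" for w
    using f(2) r(2) that by (metis subsetD)
  obtain d D where d: "0 < d" "D \<noteq> 0" "ball s d \<subseteq> {0<..<1}" "g ` ball s d \<subseteq> ball ?z r"
    "\<And>x. x \<in> ball s d \<Longrightarrow> Im (F (g x)) = Im (F ?z)"
    "((\<lambda>x. Re (F (g x))) has_real_derivative D) (at s)"
    "\<And>x. x \<in> ball s d \<Longrightarrow> isCont (\<lambda>x. Re (F (g x))) x"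
    using horizontal_local_primitive[OF g s r(1) q F] by metis
  obtain e E where e: "0 < e" "E \<noteq> 0" "ball t e \<subseteq> {0<..<1}" "h ` ball t e \<subseteq> ball ?z r"
    "\<And>x. x \<in> ball t e \<Longrightarrow> Im (F (h x)) = Im (F ?z)"
    "((\<lambda>x. Re (F (h x))) has_real_derivative E) (at t)"
    "\<And>x. x \<in> ball t e \<Longrightarrow> isCont (\<lambda>x. Re (F (h x))) x"
    using horizontal_local_primitive[OF h t r(1), of f F] q F unfolding eq by metis
  let ?\<phi> = "\<lambda>x. Re (F (g x))"
  \<comment> \<open>Either sign of \<open>D\<close> gives times on the two sides; they only change
    roles.\<close>
  obtain x y where xy: "x \<in> ball s d" "y \<in> ball s d" "?\<phi> x < ?\<phi> s" "?\<phi> s < ?\<phi> y"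
  proof (cases "D > 0")
    case True
    obtain d1 where d1: "d1 > 0" "\<And>k. 0 < k \<Longrightarrow> k < d1 \<Longrightarrow> ?\<phi> s < ?\<phi> (s + k)"
      using DERIV_pos_inc_right[OF d(6) True] by auto
    obtain d2 where d2: "d2 > 0" "\<And>k. 0 < k \<Longrightarrow> k < d2 \<Longrightarrow> ?\<phi> (s - k) < ?\<phi> s"
      using DERIV_pos_inc_left[OF d(6) True] by auto
    define k where "k = min (d / 2) (min (d1 / 2) (d2 / 2))"
    have "0 < k" "k < d" "k < d1" "k < d2" using d(1) d1(1) d2(1) by (auto simp: k_def min_def)
    then show ?thesis using that[of "s - k" "s + k"] d1 d2 by (auto simp: dist_real_def)
  next
    case False
    then have neg: "D < 0" using d(2) by simp
    obtain d1 where d1: "d1 > 0" "\<And>k. 0 < k \<Longrightarrow> k < d1 \<Longrightarrow> ?\<phi> (s + k) < ?\<phi> s"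
      using DERIV_neg_dec_right[OF d(6) neg] by auto
    obtain d2 where d2: "d2 > 0" "\<And>k. 0 < k \<Longrightarrow> k < d2 \<Longrightarrow> ?\<phi> s < ?\<phi> (s - k)"
      using DERIV_neg_dec_left[OF d(6) neg] by auto
    define k where "k = min (d / 2) (min (d1 / 2) (d2 / 2))"
    have "0 < k" "k < d" "k < d1" "k < d2" using d(1) d1(1) d2(1) by (auto simp: k_def min_def)
    then show ?thesis using that[of "s + k" "s - k"] d1 d2 by (auto simp: dist_real_def)
  qed
  have cont: "continuous_on (ball s d) ?\<phi>" using d(7) by (intro continuous_at_imp_continuous_on) blast
  have conn: "connected (?\<phi> ` ball s d)"
    by (rule connected_continuous_image[OF cont]) (simp add: convex_connected)
  have "isCont (\<lambda>x. Re (F (h x))) t" using e(1,7) by simp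
  then have "((\<lambda>x. Re (F (h x))) \<longlongrightarrow> ?\<phi> s) (at t)" by (simp add: continuous_at eq)
  then have "eventually (\<lambda>u. ?\<phi> x < Re (F (h u)) \<and> Re (F (h u)) < ?\<phi> y) (at t)"
    using xy(3,4) by (intro eventually_conj order_tendstoD)
  then have "eventually (\<lambda>u. ?\<phi> x < Re (F (h u)) \<and> Re (F (h u)) < ?\<phi> y) (nhds t)"
    unfolding eventually_nhds_conv_at using xy(3,4) by (simp add: eq)
  moreover have "eventually (\<lambda>u. u \<in> ball t e) (nhds t)"
    using e(1) by (intro eventually_nhds_in_open) auto
  ultimately show ?thesis
  proof eventually_elim
    case (elim u)
    then have "Re (F (h u)) \<in> ?\<phi> ` ball s d"
      using connectedD_interval[OF conn imageI[OF xy(1)] imageI[OF xy(2)]] by simp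
    then obtain w where w: "w \<in> ball s d" "Re (F (g w)) = Re (F (h u))" by force
    have "F (g w) = F (h u)" using w(2) d(5)[OF w(1)] e(5)[OF elim(2)] by (simp add: complex_eq_iff)
    moreover have "g w \<in> ball ?z r" "h u \<in> ball ?z r" using d(4) w(1) e(4) elim(2) by blast+
    ultimately have "g w = h u" using r(3) by (auto dest: inj_onD)
    then show ?case using d(3) w(1) by (metis imageI subsetD)
  qed
qed

text \<open>The closure of the trace of \<open>g\<close> adds only its end points, which are not
  regular and so are never met by \<open>h\<close>. Hence the times at which \<open>h\<close> lies
  on the trace form a closed set in the interval as well as an open one.\<close>

lemma trajectory_of_endpoints:
  assumes g: "horizontal_curve l a b g" and l: "l \<noteq> 0" and ends: "has_endpoints g p q" "p \<in> {a, b}" "q \<in> {a, b}"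
  shows "trajectory l a b g"
  unfolding trajectory_def
proof (intro conjI allI impI g)
  fix h assume h: "horizontal_curve l a b h \<and> g ` {0<..<1} \<subseteq> h ` {0<..<1}"
  let ?I = "{0<..<1::real}"
  have cg: "isCont g t" if "t \<in> ?I" for t
    using horizontal_curve_derivative(1)[OF g that] has_vector_derivative_continuous by blast
  have "(g \<longlongrightarrow> p) (at_right 0)" "(g \<longlongrightarrow> q) (at_left 1)" using ends(1) by (simp_all add: has_endpoints_def)
  then obtain k where k: "continuous_on {0..1} k" "k 0 = p" "k 1 = q" and kg: "\<And>t. t \<in> ?I \<Longrightarrow> k t = g t"
    using endpoint_extension[OF cg] by blast
  have "compact (k ` {0..1})" by (intro compact_continuous_image k(1)) auto
  then have "closed (k ` {0..1})" by (rule compact_imp_closed)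
  have ki: "k ` {0..1} = g ` ?I \<union> {p, q}"
  proof -
    have "{0..1} = ?I \<union> {0, 1::real}" by auto
    then have "k ` {0..1} = k ` ?I \<union> {k 0, k 1}" by simp
    moreover have "k ` ?I = g ` ?I" using kg by (intro image_cong) auto
    ultimately show ?thesis by (simp add: k(2,3))
  qed
  have reg: "h t \<in> regular_points a b" if "t \<in> ?I" for t
    using horizontal_curve_derivative(2) h that by blast
  let ?E = "{t \<in> ?I. h t \<in> g ` ?I}"
  have ch: "continuous_on ?I h"
    using horizontal_curve_derivative(1) h
    by (intro continuous_at_imp_continuous_on ballI) (metis has_vector_derivative_continuous)
  have Eeq: "?E = {t \<in> ?I. h t \<in> k ` {0..1}}"
    unfolding ki using reg ends(2,3) by (auto simp: regular_points_def)
  have cl: "closedin (top_of_set ?I) ?E"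
    unfolding Eeq using continuous_closedin_preimage[OF ch \<open>closed (k ` {0..1})\<close>]
    by (simp add: vimage_def Int_def conj_commute)
  have "open ?E"
    unfolding open_subopen[of ?E]
  proof safe
    fix t s assume t: "t \<in> ?I" and s: "h t = g s" "s \<in> ?I"
    obtain S where "open S" "t \<in> S" "\<And>y. y \<in> S \<Longrightarrow> h y \<in> g ` ?I"
      using horizontal_curves_meet_locally[of l a b g h s t, OF g conjunct1[OF h] l s(2) t s(1)]
      unfolding eventually_nhds by blast
    then show "\<exists>T. open T \<and> t \<in> T \<and> T \<subseteq> ?E"
      using t by (intro exI[of _ "S \<inter> ?I"]) auto
  qed
  then have op: "openin (top_of_set ?I) ?E" by (intro open_subset) auto
  have "connected ?I" by simp
  then have "?E = {} \<or> ?E = ?I" unfolding connected_clopen using op cl by blast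
  moreover have "?E \<noteq> {}"
  proof -
    have "g (1/2) \<in> h ` ?I" using h by (auto simp: image_subset_iff)
    then obtain t where "t \<in> ?I" "g (1/2) = h t" by blast
    then have "t \<in> ?E" by (auto intro!: image_eqI[of _ _ "1/2"])
    then show ?thesis by blast
  qed
  ultimately have "?E = ?I" by blast
  then have "h ` ?I \<subseteq> g ` ?I" by blast
  then show "h ` ?I = g ` ?I" using h by blast
qed

lemma trajectory_of_harc:
  assumes hg: "harc l p T g" and p: "p \<noteq> 0" "p\<^sup>2 \<noteq> 1" "a \<noteq> b" "p + 1 / p = - 2 * (a + b) / (a - b)"
    and l: "l \<noteq> 0"
  shows "\<exists>g. finite_critical_trajectory l a b g \<and> connects g a b"
proof -
  let ?I = "{0<..<1::real}"
  let ?z = "\<lambda>t. joukowski a b (g t)"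
  define d where "d t = (a - b) / 4 * (1 - 1 / (g t)\<^sup>2) * (of_real T / lform l p (g t))" for t
  have reg: "g t \<in> - {0, 1, -1, p, 1 / p}" "(g has_vector_derivative of_real T / lform l p (g t)) (at t)" if "t \<in> ?I" for t
    using harc_regular[OF hg that] by auto
  have T: "0 < T" and gp: "path g" "g 0 = 1" "g 1 = -1"
    using hg by (auto simp: harc_def pathstart_def pathfinish_def)
  have W0: "lform l p (g t) \<noteq> 0" if "t \<in> ?I" for t using lform_nonzero[OF l] reg(1)[OF that] by auto
  have dz: "(?z has_vector_derivative d t) (at t)" if t: "t \<in> ?I" for t
  proof -
    have "(joukowski a b has_field_derivative (a - b) / 4 * (1 - 1 / (g t)\<^sup>2)) (at (g t))"
      unfolding joukowski_def[abs_def] using reg(1)[OF t]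
      by (auto intro!: derivative_eq_intros simp: power2_eq_square)
    from has_vector_derivative_compose_field[OF reg(2)[OF t] this] show ?thesis
      by (simp add: d_def mult.commute)
  qed
  have cg: "continuous_on {0..1} g" using gp by (simp add: path_def)
  have cgI: "continuous_on ?I g" by (rule continuous_on_subset[OF cg]) auto
  have "g ` ?I \<subseteq> - {0, p, 1 / p}"
  proof (rule image_subsetI)
    show "g t \<in> - {0, p, 1 / p}" if "t \<in> ?I" for t using reg(1)[OF that] by simp
  qed
  then have cW: "continuous_on ?I (\<lambda>t. lform l p (g t))"
    by (rule continuous_on_compose2[OF holomorphic_on_imp_continuous_on[OF lform_holomorphic] cgI])
  have cd: "continuous_on ?I d"
    unfolding d_def using reg(1) W0 by (intro continuous_intros cW cgI) auto
  have zreg: "?z t \<in> regular_points a b" if t: "t \<in> ?I" for t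
  proof -
    have v: "g t \<noteq> 0" "g t \<noteq> 1" "g t \<noteq> -1" "g t - p \<noteq> 0" "g t - 1 / p \<noteq> 0" using reg(1)[OF t] by auto
    then have "?z t \<noteq> 0" using joukowski_zero_factor[OF v(1) p(1,3,4)] p(3) by simp
    moreover have "g t + 1 \<noteq> 0" using v(3) by (simp add: add_eq_0_iff2)
    then have "?z t - a \<noteq> 0" "?z t - b \<noteq> 0"
      using joukowski_factor[OF v(1) p(3)] p(3) v by simp_all
    ultimately show ?thesis by (auto simp: regular_points_def)
  qed
  have hc: "horizontal_curve l a b ?z"
    unfolding horizontal_curve_def
  proof (intro conjI ballI)
    show "?z C1_differentiable_on ?I" unfolding C1_differentiable_on_def using dz cd by blast
    fix t assume t: "t \<in> ?I"
    show "?z t \<in> regular_points a b" by (rule zreg[OF t])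
    have "quad_diff l a b (?z t) * (d t)\<^sup>2 = (of_real T)\<^sup>2"
      unfolding d_def using quad_diff_joukowski[of "g t" p a b l "of_real T / lform l p (g t)"] p reg(1)[OF t] W0[OF t]
      by simp
    then have "quad_diff l a b (?z t) * (vector_derivative ?z (at t))\<^sup>2 = of_real (T\<^sup>2)"
      unfolding vector_derivative_at[OF dz[OF t]] by simp
    moreover have "0 < T\<^sup>2" using T by simp
    ultimately show "quad_diff l a b (?z t) * (vector_derivative ?z (at t))\<^sup>2 \<in> complex_of_real ` {0<..}"
      by (metis greaterThan_iff imageI)
  qed
  have ends: "has_endpoints ?z a b"
    unfolding has_endpoints_def
  proof
    have "(g \<longlongrightarrow> 1) (at_right 0)" "(g \<longlongrightarrow> -1) (at_left 1)"
      using continuous_on_Icc_at_rightD[OF cg] continuous_on_Icc_at_leftD[OF cg] gp by simp_all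
    then have "(?z \<longlongrightarrow> (a + b) / 2 + (a - b) / 4 * (1 + 1 / 1)) (at_right 0)"
      "(?z \<longlongrightarrow> (a + b) / 2 + (a - b) / 4 * (-1 + 1 / -1)) (at_left 1)"
      unfolding joukowski_def by (intro tendsto_add tendsto_mult tendsto_divide tendsto_const; simp)+
    moreover have "(a + b) / 2 + (a - b) / 4 * (1 + 1 / 1) = a" "(a + b) / 2 + (a - b) / 4 * (-1 + 1 / -1) = b"
      by (simp_all add: field_simps)
    ultimately show "(?z \<longlongrightarrow> a) (at_right 0)" "(?z \<longlongrightarrow> b) (at_left 1)" by simp_all
  qed
  have "trajectory l a b ?z" by (rule trajectory_of_endpoints[OF hc l ends]) auto
  then show ?thesis unfolding finite_critical_trajectory_def connects_def using ends by blast
qed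

section \<open>Stability under perturbation\<close>

lemma near_affine_bound:
  assumes "\<And>u. u \<in> ball z R \<Longrightarrow> (F has_field_derivative A u) (at u)"
    and "\<And>u. u \<in> ball z R \<Longrightarrow> norm (A u - \<alpha>) \<le> k"
    and "u \<in> ball z R" "w \<in> ball z R"
  shows "norm (F u - F w - \<alpha> * (u - w)) \<le> k * norm (u - w)"
proof -
  have "norm ((F u - \<alpha> * u) - (F w - \<alpha> * w)) \<le> k * norm (u - w)"
  proof (rule field_differentiable_bound[of "ball z R" "\<lambda>u. F u - \<alpha> * u" "\<lambda>u. A u - \<alpha>"])
    show "((\<lambda>u. F u - \<alpha> * u) has_field_derivative A v - \<alpha>) (at v within ball z R)" if "v \<in> ball z R" for v
      using has_field_derivative_at_within[OF assms(1)[OF that]]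
      by (auto intro!: derivative_eq_intros)
  qed (use assms in auto)
  then show ?thesis by (simp add: algebra_simps)
qed

text \<open>Newton's iteration with the slope frozen at \<open>\<alpha>\<close> contracts by the
  factor 1/4. The first step has length at most 3/4 \<rho>, and the contraction adds at most 1/4
  \<rho>, so the disc is mapped into itself.\<close>

lemma near_affine_solution:
  fixes F :: "complex \<Rightarrow> complex"
  assumes near: "\<And>u w. \<lbrakk>u \<in> ball z R; w \<in> ball z R\<rbrakk> \<Longrightarrow> norm (F u - F w - \<alpha> * (u - w)) \<le> norm \<alpha> / 4 * norm (u - w)"
    and "\<alpha> \<noteq> 0" "0 < \<rho>" "\<rho> < R" "norm (\<tau> - F z) \<le> 3 / 4 * norm \<alpha> * \<rho>"
  shows "\<exists>u\<in>cball z \<rho>. F u = \<tau>"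
proof -
  let ?f = "\<lambda>u. u - (F u - \<tau>) / \<alpha>"
  have sub: "cball z \<rho> \<subseteq> ball z R" using assms(4) by auto
  have diff: "norm (?f u - ?f w) \<le> 1 / 4 * norm (u - w)" if "u \<in> cball z \<rho>" "w \<in> cball z \<rho>" for u w
  proof -
    have "?f u - ?f w = - (F u - F w - \<alpha> * (u - w)) / \<alpha>"
      using assms(2) by (simp add: field_simps)
    then have "norm (?f u - ?f w) = norm (F u - F w - \<alpha> * (u - w)) / norm \<alpha>"
      by (simp add: norm_divide norm_minus_commute)
    also have "\<dots> \<le> (norm \<alpha> / 4 * norm (u - w)) / norm \<alpha>"
    proof (rule divide_right_mono)
      have "u \<in> ball z R" "w \<in> ball z R" using that sub by blast+
      then show "norm (F u - F w - \<alpha> * (u - w)) \<le> norm \<alpha> / 4 * norm (u - w)" by (rule near)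
    qed simp
    finally show ?thesis using assms(2) by simp
  qed
  have z: "z \<in> cball z \<rho>" using assms(3) by simp
  have "?f u \<in> cball z \<rho>" if u: "u \<in> cball z \<rho>" for u
  proof -
    have "?f z - z = (\<tau> - F z) / \<alpha>" using assms(2) by (simp add: field_simps)
    then have "norm (?f z - z) = norm (\<tau> - F z) / norm \<alpha>" by (simp only: norm_divide)
    also have "\<dots> \<le> (3 / 4 * norm \<alpha> * \<rho>) / norm \<alpha>" using assms(5) by (intro divide_right_mono) auto
    finally have 1: "norm (?f z - z) \<le> 3 / 4 * \<rho>" using assms(2) by simp
    have 2: "norm (?f u - ?f z) \<le> 1 / 4 * \<rho>"
      using diff[OF u z] u by (simp add: dist_norm norm_minus_commute)
    have "norm (?f u - z) \<le> norm (?f u - ?f z) + norm (?f z - z)"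
      using dist_triangle[of "?f u" z "?f z"] by (simp only: dist_norm)
    then show ?thesis using 1 2 by (simp add: dist_norm norm_minus_commute)
  qed
  moreover have "dist (?f u) (?f w) \<le> 1 / 4 * dist u w" if "u \<in> cball z \<rho>" "w \<in> cball z \<rho>" for u w
    using diff[OF that] by (simp add: dist_norm)
  ultimately have "\<exists>!u. u \<in> cball z \<rho> \<and> ?f u = u"
    using z by (intro Banach_fix[where c = "1 / 4"]) (auto simp: complete_eq_closed)
  then obtain u where u: "u \<in> cball z \<rho>" "?f u = u" by blast
  then have "(F u - \<tau>) / \<alpha> = 0" by (simp only: diff_eq_eq) simp
  then have "F u = \<tau>" using assms(2) by simp
  then show ?thesis using u(1) by blast
qed

lemma norm_mult_minus_one:
  fixes x y :: complex
  assumes "norm (x - 1) \<le> a" "norm (y - 1) \<le> b"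
  shows "norm (x * y - 1) \<le> (1 + a) * (1 + b) - 1"
proof -
  have "0 \<le> a" using assms(1) norm_ge_zero order_trans by blast
  have e: "x * y - 1 = (x - 1) * (y - 1) + (x - 1) + (y - 1)" by (simp add: algebra_simps)
  have "norm (x * y - 1) \<le> norm ((x - 1) * (y - 1)) + norm (x - 1) + norm (y - 1)"
    unfolding e by (rule norm_triangle_le, rule add_right_mono, rule norm_triangle_ineq)
  moreover have "norm ((x - 1) * (y - 1)) \<le> a * b"
    unfolding norm_mult using assms \<open>0 \<le> a\<close> by (intro mult_mono) auto
  ultimately show ?thesis using assms by (simp add: algebra_simps)
qed

text \<open>Relative errors multiply. The ratios (u - 1) / (g - 1) and (u + 1) / (g + 1) are within
  1/32 of 1 and enter squared, \<open>q' / q\<close> is within 1/16 of 1, and (33/32)^4 * 17/16 <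
  5/4.\<close>

lemma double_zero_variation:
  fixes g u :: complex
  assumes g: "g \<noteq> 1" "g \<noteq> -1" and u: "norm (u - g) \<le> norm (g - 1) / 32" "norm (u - g) \<le> norm (g + 1) / 32"
    and q: "norm (q' - q) \<le> norm q / 16"
  shows "norm ((u\<^sup>2 - 1)\<^sup>2 * q' - (g\<^sup>2 - 1)\<^sup>2 * q) \<le> norm ((g\<^sup>2 - 1)\<^sup>2 * q) / 4"
proof (cases "q = 0")
  case True
  then show ?thesis using q by simp
next
  case False
  have g': "g - 1 \<noteq> 0" "g + 1 \<noteq> 0" using g by (auto simp: add_eq_0_iff2)
  define x where "x = (u - 1) / (g - 1)"
  define y where "y = (u + 1) / (g + 1)"
  define e where "e = q' / q"
  have "x - 1 = (u - g) / (g - 1)" "y - 1 = (u - g) / (g + 1)" "e - 1 = (q' - q) / q"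
    using g' False by (simp_all add: x_def y_def e_def field_simps)
  then have n: "norm (x - 1) \<le> 1 / 32" "norm (y - 1) \<le> 1 / 32" "norm (e - 1) \<le> 1 / 16"
    using g' False u q by (simp_all only: norm_divide) (simp_all add: divide_simps)
  have "norm ((x * y) * (x * y) * e - 1) \<le> (1 + ((1 + ((1 + 1/32) * (1 + 1/32) - 1)) * (1 + ((1 + 1/32) * (1 + 1/32) - 1)) - 1)) * (1 + 1/16) - 1"
    by (intro norm_mult_minus_one n)
  also have "\<dots> \<le> 1 / 4" by simp
  finally have n2: "norm ((x * y) * (x * y) * e - 1) \<le> 1 / 4" .
  have abc: "u - 1 = x * (g - 1)" "u + 1 = y * (g + 1)" "q' = e * q"
    using g' False by (simp_all add: x_def y_def e_def)
  have sq: "w\<^sup>2 - 1 = (w - 1) * (w + 1)" for w :: complex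
    by (simp add: algebra_simps power2_eq_square)
  have "(u\<^sup>2 - 1)\<^sup>2 * q' = ((x * (g - 1)) * (y * (g + 1)))\<^sup>2 * (e * q)"
    unfolding sq abc ..
  moreover have "((x * X) * (y * Y))\<^sup>2 * (e * q) - (X * Y)\<^sup>2 * q = ((X * Y)\<^sup>2 * q) * ((x * y) * (x * y) * e - 1)" for X Y
    by (simp add: algebra_simps power2_eq_square)
  ultimately have "(u\<^sup>2 - 1)\<^sup>2 * q' - (g\<^sup>2 - 1)\<^sup>2 * q = ((g\<^sup>2 - 1)\<^sup>2 * q) * ((x * y) * (x * y) * e - 1)"
    unfolding sq[of g] by metis
  then have "norm ((u\<^sup>2 - 1)\<^sup>2 * q' - (g\<^sup>2 - 1)\<^sup>2 * q) = norm ((g\<^sup>2 - 1)\<^sup>2 * q) * norm ((x * y) * (x * y) * e - 1)"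
    by (simp only: norm_mult)
  also have "\<dots> \<le> norm ((g\<^sup>2 - 1)\<^sup>2 * q) * (1 / 4)" by (intro mult_left_mono n2) simp
  finally show ?thesis by simp
qed

text \<open>The distances to \<open>1\<close> and \<open>-1\<close> add up to at least 2, so the
  larger one is at least 1 and their product is at least the smaller one.\<close>

lemma double_zero_lower_bound:
  fixes g :: complex
  assumes "d = min (norm (g - 1)) (norm (g + 1))"
  shows "d\<^sup>2 \<le> norm ((g\<^sup>2 - 1)\<^sup>2)"
proof -
  have "2 \<le> norm (g - 1) + norm (g + 1)"
    using norm_triangle_ineq4[of "g + 1" "g - 1"] by simp
  moreover have "0 \<le> norm (g - 1)" "0 \<le> norm (g + 1)" by auto
  ultimately have "d \<le> norm (g - 1) * norm (g + 1)"
  proof (cases "norm (g - 1) \<le> norm (g + 1)")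
    case True
    then have "1 \<le> norm (g + 1)" using \<open>2 \<le> norm (g - 1) + norm (g + 1)\<close> by simp
    then show ?thesis using mult_left_mono[of 1 "norm (g + 1)" "norm (g - 1)"] True assms by simp
  next
    case False
    then have "1 \<le> norm (g - 1)" using \<open>2 \<le> norm (g - 1) + norm (g + 1)\<close> by simp
    then show ?thesis using mult_right_mono[of 1 "norm (g - 1)" "norm (g + 1)"] False assms by simp
  qed
  also have "\<dots> = norm (g\<^sup>2 - 1)" unfolding norm_mult[symmetric] by (simp add: algebra_simps power2_eq_square)
  finally have "d \<le> norm (g\<^sup>2 - 1)" .
  moreover have "0 \<le> d" using assms by simp
  ultimately show ?thesis unfolding norm_power by (intro power_mono)
qed

text \<open>The new arc is sought in discs around the old one whose radius is a fixed multiple of the distance to the double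
  zeros \<open>1, -1\<close>. On such a disc the form is nearly constant, so its primitive is injective there and covers a disc of radius
  of order \<open>d t ^ 3\<close>.\<close>

lemma perturbed_arc:
  fixes g :: "real \<Rightarrow> complex"
  assumes gc: "continuous_on {0..1} g" and g01: "g 0 = 1" "g 1 = -1"
    and gn: "\<And>t. t \<in> {0<..<1} \<Longrightarrow> g t \<noteq> 1 \<and> g t \<noteq> -1"
    and dg: "\<And>t. t \<in> {0<..<1} \<Longrightarrow> (g has_vector_derivative g' t) (at t)"
    and U: "open U" "q holomorphic_on U" and \<delta>: "\<And>t. t \<in> {0..1} \<Longrightarrow> ball (g t) \<delta> \<subseteq> U"
    and m: "0 < m" "\<And>u. u \<in> U \<Longrightarrow> m \<le> norm (q u)"
    and var: "\<And>t u. t \<in> {0..1} \<Longrightarrow> u \<in> ball (g t) \<delta> \<Longrightarrow> norm (q u - q (g t)) \<le> norm (q (g t)) / 16"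
    and d: "\<And>t. d t = min (norm (g t - 1)) (norm (g t + 1))"
    and c: "0 < c" "c \<le> 1 / 64" "\<And>t. t \<in> {0..1} \<Longrightarrow> 2 * c * d t \<le> \<delta>"
    and \<phi>: "\<And>t. t \<in> {0<..<1} \<Longrightarrow> (\<phi> has_vector_derivative ((g t)\<^sup>2 - 1)\<^sup>2 * q (g t) * g' t) (at t)"
    and small: "\<And>t. t \<in> {0<..<1} \<Longrightarrow> norm (\<phi> t - of_real t) \<le> 3 / 4 * c * m * d t ^ 3"
  obtains h where "path h" "pathstart h = 1" "pathfinish h = -1"
    "\<And>t. t \<in> {0<..<1} \<Longrightarrow> h t \<in> U - {1, -1} \<and> (h has_vector_derivative 1 / (((h t)\<^sup>2 - 1)\<^sup>2 * q (h t))) (at t)"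
proof -
  let ?I = "{0<..<1::real}"
  define A where "A u = (u\<^sup>2 - 1)\<^sup>2 * q u" for u
  \<comment> \<open>As \<open>c\<close> is at most 1/64, the radius is at most d t / 32, which
    \<open>double_zero_variation\<close> requires. The solution is sought in the concentric disc of
    half this radius, so that at nearby times it still lies in the same disc
    \<open>B s\<close>.\<close>
  define B where "B t = ball (g t) (2 * c * d t)" for t
  have d0: "0 < d t" if "t \<in> ?I" for t using gn[OF that] by (auto simp: d add_eq_0_iff2)
  have r0: "0 < 2 * c * d t" if "t \<in> ?I" for t using d0[OF that] c(1) by simp
  have BU: "B t \<subseteq> U" if "t \<in> ?I" for t
    using \<delta>[of t] c(3)[of t] that unfolding B_def by (meson atLeastAtMost_iff greaterThanLessThan_iff less_imp_le order_trans subset_ball)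
  have An: "norm (A u - A (g t)) \<le> norm (A (g t)) / 4" if t: "t \<in> ?I" and u: "u \<in> B t" for t u
    unfolding A_def
  proof (rule double_zero_variation)
    have "norm (u - g t) \<le> 2 * c * d t" using u by (simp add: B_def dist_norm norm_minus_commute)
    also have "\<dots> \<le> 1 / 32 * d t" using c(2) d0[OF t] by (intro mult_right_mono) auto
    finally show "norm (u - g t) \<le> norm (g t - 1) / 32" "norm (u - g t) \<le> norm (g t + 1) / 32"
      by (auto simp: d)
    have "u \<in> ball (g t) \<delta>" using u c(3)[of t] t by (auto simp: B_def)
    then show "norm (q u - q (g t)) \<le> norm (q (g t)) / 16" using var[of t u] t by auto
  qed (use gn[OF t] in auto)
  have Ag: "m * (d t)\<^sup>2 \<le> norm (A (g t))" if t: "t \<in> ?I" for t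
  proof -
    have "m \<le> norm (q (g t))" using BU[OF t] r0[OF t] by (intro m) (auto simp: B_def)
    then have "(d t)\<^sup>2 * m \<le> norm (((g t)\<^sup>2 - 1)\<^sup>2) * norm (q (g t))"
      using double_zero_lower_bound[OF d[of t]] m(1) by (intro mult_mono) auto
    then show ?thesis by (simp add: A_def norm_mult mult.commute)
  qed
  have Ag0: "0 < norm (A (g t))" if t: "t \<in> ?I" for t
    using Ag[OF t] m(1) d0[OF t] by (meson less_le_trans mult_pos_pos zero_less_power)
  have Anz: "A u \<noteq> 0" if "t \<in> ?I" "u \<in> B t" for t u
    using An[OF that] Ag0[OF that(1)] by auto
  have Ahol: "A holomorphic_on U" unfolding A_def by (intro holomorphic_intros U)
  \<comment> \<open>Normalising each local primitive by \<open>\<phi>\<close> at the centre makes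
    primitives on overlapping discs agree.\<close>
  have "\<exists>F. F (g t) = \<phi> t \<and> (\<forall>u\<in>B t. (F has_field_derivative A u) (at u))" if t: "t \<in> ?I" for t
  proof -
    obtain F where "\<And>u. u \<in> B t \<Longrightarrow> (F has_field_derivative A u) (at u within B t)"
      using holomorphic_convex_primitive'[of "B t" A] holomorphic_on_subset[OF Ahol BU[OF t]]
      unfolding B_def by auto
    then have F: "\<And>u. u \<in> B t \<Longrightarrow> (F has_field_derivative A u) (at u)"
      by (simp add: B_def at_within_open[OF _ open_ball])
    show ?thesis
      by (rule exI[of _ "\<lambda>u. F u - F (g t) + \<phi> t"]) (auto intro!: derivative_eq_intros F)
  qed
  then obtain F where F: "\<And>t. t \<in> ?I \<Longrightarrow> F t (g t) = \<phi> t"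
    "\<And>t u. t \<in> ?I \<Longrightarrow> u \<in> B t \<Longrightarrow> (F t has_field_derivative A u) (at u)" by metis
  have near: "norm (F t u - F t w - A (g t) * (u - w)) \<le> norm (A (g t)) / 4 * norm (u - w)"
    if "t \<in> ?I" "u \<in> B t" "w \<in> B t" for t u w
    using near_affine_bound[of "g t" "2 * c * d t" "F t" A "A (g t)" "norm (A (g t)) / 4" u w] F(2) An that
    unfolding B_def by blast
  have inj: "inj_on (F t) (B t)" if t: "t \<in> ?I" for t
  proof (rule inj_onI)
    fix u w assume uw: "u \<in> B t" "w \<in> B t" "F t u = F t w"
    have "norm (A (g t)) * norm (u - w) \<le> norm (A (g t)) / 4 * norm (u - w)"
      using near[OF t uw(1,2)] uw(3) by (simp add: norm_mult)
    then have "norm (A (g t)) * norm (u - w) \<le> norm (A (g t)) * (norm (u - w) / 4)" by simp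
    then have "norm (u - w) \<le> norm (u - w) / 4" using Ag0[OF t] by (simp only: mult_le_cancel_left_pos)
    then have "norm (u - w) \<le> 0" by linarith
    then show "u = w" by simp
  qed
  have "\<exists>u\<in>cball (g t) (c * d t). F t u = of_real t" if t: "t \<in> ?I" for t
  proof (rule near_affine_solution[of "g t" "2 * c * d t"])
    show "norm (F t u - F t w - A (g t) * (u - w)) \<le> norm (A (g t)) / 4 * norm (u - w)"
      if "u \<in> ball (g t) (2 * c * d t)" "w \<in> ball (g t) (2 * c * d t)" for u w
      using near[OF t] that by (simp add: B_def)
    show "A (g t) \<noteq> 0" "0 < c * d t" "c * d t < 2 * c * d t" using Ag0[OF t] d0[OF t] c(1) by auto
    have "norm (of_real t - F t (g t)) \<le> 3 / 4 * c * d t * (m * (d t)\<^sup>2)"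
      using small[OF t] F(1)[OF t] by (simp add: norm_minus_commute power3_eq_cube power2_eq_square algebra_simps)
    also have "\<dots> \<le> 3 / 4 * c * d t * norm (A (g t))"
      using Ag[OF t] d0[OF t] c(1) by (intro mult_left_mono) auto
    finally show "norm (of_real t - F t (g t)) \<le> 3 / 4 * norm (A (g t)) * (c * d t)" by (simp add: algebra_simps)
  qed
  then obtain u where u: "\<And>t. t \<in> ?I \<Longrightarrow> u t \<in> cball (g t) (c * d t)" "\<And>t. t \<in> ?I \<Longrightarrow> F t (u t) = of_real t"
    by metis
  have cd: "0 < c * d t" if "t \<in> ?I" for t by (rule mult_pos_pos[OF c(1) d0[OF that]])
  have uB: "u t \<in> B t" if "t \<in> ?I" for t using u(1)[OF that] cd[OF that] by (simp add: B_def)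
  have un: "norm (u t - g t) \<le> norm (g t - 1) / 64" "norm (u t - g t) \<le> norm (g t + 1) / 64" if t: "t \<in> ?I" for t
  proof -
    have "norm (u t - g t) \<le> c * d t" using u(1)[OF t] by (simp add: dist_norm norm_minus_commute)
    also have "\<dots> \<le> 1 / 64 * d t" using c(2) d0[OF t] by (intro mult_right_mono) auto
    finally show "norm (u t - g t) \<le> norm (g t - 1) / 64" "norm (u t - g t) \<le> norm (g t + 1) / 64"
      by (auto simp: d)
  qed
  have gcont: "isCont g t" if "t \<in> ?I" for t using dg[OF that] has_vector_derivative_continuous by blast
  have du: "(u has_vector_derivative 1 / A (u s)) (at s)" if s: "s \<in> ?I" for s
  proof -
    have FB: "F s holomorphic_on B s" unfolding holomorphic_on_def
      using F(2)[OF s] field_differentiable_def has_field_derivative_at_within by blast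
    have oB: "open (B s)" by (simp add: B_def)
    obtain G where G: "G holomorphic_on (F s ` B s)" "\<And>z. z \<in> B s \<Longrightarrow> deriv (F s) z * deriv G (F s z) = 1"
       "\<And>z. z \<in> B s \<Longrightarrow> G (F s z) = z"
      using holomorphic_has_inverse[OF FB oB inj[OF s]] by metis
    have oFB: "open (F s ` B s)" by (rule open_mapping_thm3[OF FB oB inj[OF s]])
    have "((\<lambda>t. dist (g t) (g s) + c * d t) \<longlongrightarrow> dist (g s) (g s) + c * d s) (at s)"
      unfolding d using gcont[OF s] by (intro tendsto_intros) (auto simp: continuous_at)
    then have "eventually (\<lambda>t. dist (g t) (g s) + c * d t < 2 * c * d s) (at s)"
      by (rule order_tendstoD) (use r0[OF s] in simp)
    then have "eventually (\<lambda>t. dist (g t) (g s) + c * d t < 2 * c * d s) (nhds s)"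
      unfolding eventually_nhds_conv_at using r0[OF s] by simp
    moreover have "eventually (\<lambda>t. t \<in> ?I) (nhds s)" using s by (intro eventually_nhds_in_open) auto
    ultimately have "eventually (\<lambda>t. t \<in> ?I \<and> dist (g t) (g s) + c * d t < 2 * c * d s) (nhds s)"
      by eventually_elim auto
    then obtain e where e: "e > 0" "\<And>t. t \<in> ball s e \<Longrightarrow> t \<in> ?I \<and> dist (g t) (g s) + c * d t < 2 * c * d s"
      unfolding eventually_nhds_metric by (auto simp: dist_commute)
    have gB: "g t \<in> B s" if "t \<in> ball s e" for t
      using e(2)[OF that] cd[of t] by (simp add: B_def dist_commute)
    have uBs: "u t \<in> B s" if t: "t \<in> ball s e" for t
    proof -
      have "dist (u t) (g s) \<le> dist (u t) (g t) + dist (g t) (g s)" by (rule dist_triangle)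
      also have "\<dots> \<le> c * d t + dist (g t) (g s)" using u(1)[of t] e(2)[OF t] by (simp add: dist_commute)
      also have "\<dots> < 2 * c * d s" using e(2)[OF t] by simp
      finally show ?thesis by (simp add: B_def dist_commute)
    qed
    have Fg: "F s (g t) = \<phi> t" if t: "t \<in> ball s e" for t
    proof -
      have "((\<lambda>t. F s (g t) - \<phi> t) has_vector_derivative 0) (at x within ball s e)" if x: "x \<in> ball s e" for x
      proof -
        have xI: "x \<in> ?I" using e(2)[OF x] by simp
        have "((\<lambda>t. F s (g t)) has_vector_derivative g' x * A (g x)) (at x)"
          by (rule has_vector_derivative_compose_field[OF dg[OF xI] F(2)[OF s gB[OF x]]])
        from has_vector_derivative_diff[OF this \<phi>[OF xI]]
        have "((\<lambda>t. F s (g t) - \<phi> t) has_vector_derivative 0) (at x)" by (simp add: A_def mult.commute)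
        then show ?thesis by (rule has_vector_derivative_at_within)
      qed
      then obtain C where C: "\<And>x. x \<in> ball s e \<Longrightarrow> F s (g x) - \<phi> x = C"
        using has_vector_derivative_zero_constant[of "ball s e" "\<lambda>t. F s (g t) - \<phi> t"] by auto
      have "C = 0" using C[of s] F(1)[OF s] e(1) by simp
      then show ?thesis using C[OF t] by simp
    qed
    \<comment> \<open>\<open>F s\<close> and \<open>F t\<close> have the same derivative on the
      convex intersection of their discs and agree at \<open>g t\<close>. So \<open>u\<close> is,
      near \<open>s\<close>, a single local inverse of \<open>F s\<close> restricted to the real
      line, which makes it differentiable.\<close>
    have Fu: "F s (u t) = of_real t" if t: "t \<in> ball s e" for t
    proof -
      have tI: "t \<in> ?I" using e(2)[OF t] by simp
      have "((\<lambda>z. F s z - F t z) has_field_derivative 0) (at z within B s \<inter> B t)" if "z \<in> B s \<inter> B t" for z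
      proof -
        have "((\<lambda>z. F s z - F t z) has_field_derivative A z - A z) (at z)"
          using that by (intro DERIV_diff F(2) s tI) auto
        then show ?thesis by (simp add: has_field_derivative_at_within)
      qed
      moreover have "convex (B s \<inter> B t)" unfolding B_def by (intro convex_Int convex_ball)
      ultimately obtain C where C: "\<And>z. z \<in> B s \<inter> B t \<Longrightarrow> F s z - F t z = C"
        using has_field_derivative_zero_constant[of "B s \<inter> B t" "\<lambda>z. F s z - F t z"] by auto
      have "g t \<in> B t" using r0[OF tI] by (simp add: B_def)
      then have "C = 0" using C[of "g t"] gB[OF t] Fg[OF t] F(1)[OF tI] by simp
      then show ?thesis using C[of "u t"] uB[OF tI] uBs[OF t] u(2)[OF tI] by simp
    qed
    have ss: "s \<in> ball s e" using e(1) by simp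
    have uG: "u t = G (of_real t)" if "t \<in> ball s e" for t using G(3)[OF uBs[OF that]] Fu[OF that] by simp
    have "deriv (F s) (u s) = A (u s)" using DERIV_imp_deriv[OF F(2)[OF s uB[OF s]]] .
    then have dG: "deriv G (of_real s) = 1 / A (u s)"
      using G(2)[OF uB[OF s]] u(2)[OF s] Anz[OF s uB[OF s]] by (simp add: field_simps)
    have "of_real s \<in> F s ` B s" using u(2)[OF s] uB[OF s] by (metis imageI)
    then have "(G has_field_derivative 1 / A (u s)) (at (of_real s))"
      using holomorphic_derivI[OF G(1) oFB] dG by metis
    moreover have "(complex_of_real has_vector_derivative 1) (at s)"
      by (auto intro!: derivative_eq_intros)
    ultimately have "((\<lambda>t. G (of_real t)) has_vector_derivative 1 * (1 / A (u s))) (at s)"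
      by (intro has_vector_derivative_compose_field)
    then have "((\<lambda>t. G (of_real t)) has_vector_derivative 1 / A (u s)) (at s)" by simp
    then show ?thesis
      by (rule has_vector_derivative_transform_within_open[OF _ open_ball ss]) (use uG in simp)
  qed
  have evI: "eventually (\<lambda>t. t \<in> ?I) (at_right 0)" "eventually (\<lambda>t. t \<in> ?I) (at_left 1)"
    using eventually_at_right_real[of 0 1] eventually_at_left_real[of 0 1] by auto
  have glim: "(g \<longlongrightarrow> 1) (at_right 0)" "(g \<longlongrightarrow> -1) (at_left 1)"
    using continuous_on_Icc_at_rightD[OF gc] continuous_on_Icc_at_leftD[OF gc] g01 by simp_all
  \<comment> \<open>The distance from \<open>u\<close> to \<open>g\<close> is at most 1/64 of the
    distance from \<open>g\<close> to the end point, so \<open>u\<close> has the same limit.\<close>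
  have ulim: "(u \<longlongrightarrow> e) F"
    if F: "(g \<longlongrightarrow> e) F" "eventually (\<lambda>t. norm (u t - g t) \<le> norm (g t - e) / 64) F" for e F
  proof -
    have "((\<lambda>t. norm (g t - e) / 64) \<longlongrightarrow> norm (e - e) / 64) F" by (intro tendsto_intros F(1)) auto
    then have lim: "((\<lambda>t. norm (g t - e) / 64) \<longlongrightarrow> 0) F" by simp
    from tendsto_add[OF Lim_null_comparison[OF F(2) lim] F(1)] show ?thesis by simp
  qed
  have "(u \<longlongrightarrow> 1) (at_right 0)"
    by (rule ulim[OF glim(1)]) (use evI(1) in \<open>rule eventually_mono\<close>, rule un)
  moreover have "(u \<longlongrightarrow> -1) (at_left 1)"
    by (rule ulim[OF glim(2)]) (use evI(2) in \<open>rule eventually_mono\<close>, simp only: diff_minus_eq_add un)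
  ultimately obtain h where h: "continuous_on {0..1} h" "h 0 = 1" "h 1 = -1" and hu: "\<And>t. t \<in> ?I \<Longrightarrow> h t = u t"
    using endpoint_extension[OF has_vector_derivative_continuous[OF du]] by blast
  have "path h" using h(1) by (simp add: path_def)
  moreover have "h t \<in> U - {1, -1} \<and> (h has_vector_derivative 1 / (((h t)\<^sup>2 - 1)\<^sup>2 * q (h t))) (at t)" if t: "t \<in> ?I" for t
  proof (intro conjI)
    have "u t \<noteq> 1"
    proof
      assume "u t = 1"
      then have "norm (g t - 1) \<le> norm (g t - 1) / 64" using un(1)[OF t] by (metis norm_minus_commute)
      then have "norm (g t - 1) = 0" using norm_ge_zero[of "g t - 1"] by linarith
      then show False using gn[OF t] by simp
    qed
    moreover have "u t \<noteq> -1"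
    proof
      assume "u t = -1"
      then have "u t - g t = - (g t + 1)" by simp
      then have "norm (g t + 1) \<le> norm (g t + 1) / 64" using un(2)[OF t] by (metis norm_minus_cancel)
      then have "norm (g t + 1) = 0" using norm_ge_zero[of "g t + 1"] by linarith
      then show False using gn[OF t] by (simp add: add_eq_0_iff2)
    qed
    ultimately show "h t \<in> U - {1, -1}" unfolding hu[OF t] using uB[OF t] BU[OF t] by blast
    have "(h has_vector_derivative 1 / A (u t)) (at t)"
      by (rule has_vector_derivative_transform_within_open[OF du[OF t], of ?I]) (use t hu in auto)
    then show "(h has_vector_derivative 1 / (((h t)\<^sup>2 - 1)\<^sup>2 * q (h t))) (at t)"
      unfolding hu[OF t] by (simp add: A_def)
  qed
  ultimately show ?thesis using that[of h] h(2,3) by (auto simp: pathstart_def pathfinish_def)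
qed

text \<open>At a double zero of the form a primitive differs from its value there by at most a
  multiple of the cube of the distance. Along an arc of length 1 this difference is exactly the
  elapsed time.\<close>

lemma harc_cubic_at_endpoint:
  assumes hg: "harc l p 1 g" and p: "p \<noteq> 0" "p\<^sup>2 \<noteq> 1" "l \<noteq> 0" and t0: "t0 \<in> {0, 1}"
  obtains r C where "0 < r" "0 < C"
    "\<And>t. \<lbrakk>t \<in> {0..1}; \<bar>t - t0\<bar> < r\<rbrakk> \<Longrightarrow> norm (g t - g t0) < 1 \<and> \<bar>t - t0\<bar> \<le> C * norm (g t - g t0) ^ 3"
proof -
  define e where "e = g t0"
  have g01: "path g" "g 0 = 1" "g 1 = -1" using hg by (auto simp: harc_def pathstart_def pathfinish_def)
  then have e2: "e\<^sup>2 = 1" using t0 by (auto simp: e_def)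
  have eU: "e \<in> - {0, p, 1 / p}"
  proof -
    have "e \<in> path_image g" using t0 unfolding e_def path_image_def by auto
    then show ?thesis using harc_avoids[OF hg p(1,2)] by (metis ComplI insertE singletonD)
  qed
  have oU: "open (- {0, p, 1 / p})" by (intro open_Compl finite_imp_closed) auto
  obtain R where R: "R > 0" "ball e R \<subseteq> - {0, p, 1 / p}" using oU eU open_contains_ball by blast
  obtain F where "\<And>u. u \<in> ball e R \<Longrightarrow> (F has_field_derivative lform l p u) (at u within ball e R)"
    using holomorphic_convex_primitive'[of "ball e R" "lform l p"] holomorphic_on_subset[OF lform_holomorphic R(2)] by auto
  then have F: "\<And>u. u \<in> ball e R \<Longrightarrow> (F has_field_derivative lform l p u) (at u)"
    by (simp add: at_within_open[OF _ open_ball])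
  define \<rho> where "\<rho> = min R 1 / 2"
  have \<rho>: "0 < \<rho>" "\<rho> < R" "\<rho> < 1" using R(1) by (auto simp: \<rho>_def)
  define k where "k u = l * (u + e)\<^sup>2 / (u * (u - p)\<^sup>2 * (u - 1 / p)\<^sup>2)" for u
  have Wk: "lform l p u = (u - e)\<^sup>2 * k u" for u
  proof -
    have "u\<^sup>2 - 1 = (u - e) * (u + e)" using e2 by (simp add: algebra_simps power2_eq_square)
    then show ?thesis by (simp add: lform_def k_def power_mult_distrib)
  qed
  have sub: "u \<noteq> 0 \<and> u \<noteq> p \<and> u \<noteq> 1 / p" if "u \<in> cball e \<rho>" for u
  proof -
    have "u \<in> ball e R" using that \<rho>(2) by simp
    then have "u \<in> - {0, p, 1 / p}" using R(2) by blast
    then show ?thesis by simp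
  qed
  have "continuous_on (cball e \<rho>) k"
    unfolding k_def using sub by (intro continuous_intros ballI) simp
  then have "bounded (k ` cball e \<rho>)" by (intro compact_imp_bounded compact_continuous_image) auto
  then obtain C where C: "0 < C" "\<And>u. u \<in> cball e \<rho> \<Longrightarrow> norm (k u) \<le> C"
    unfolding bounded_pos by blast
  have gc: "continuous_on {0..1} g" using g01 by (simp add: path_def)
  have "t0 \<in> {0..1}" using t0 by auto
  then obtain r where r: "r > 0" "\<And>t. \<lbrakk>t \<in> {0..1}; dist t t0 < r\<rbrakk> \<Longrightarrow> dist (g t) (g t0) < \<rho>"
    using gc \<rho>(1) unfolding continuous_on_iff by metis
  show ?thesis
  proof (rule that[OF r(1) C(1)])
    fix t assume t: "t \<in> {0..1}" "\<bar>t - t0\<bar> < r"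
    have near: "norm (g s - e) < \<rho>" if "s \<in> {0..1}" "\<bar>s - t0\<bar> < r" for s
      using r(2)[of s] that by (simp add: dist_norm e_def)
    have 1: "norm (F (g t) - F e) \<le> C * norm (g t - e) ^ 2 * norm (g t - e)"
    proof (rule field_differentiable_bound[of "cball e (norm (g t - e))" F "lform l p"])
      fix z assume z: "z \<in> cball e (norm (g t - e))"
      then have zn: "norm (z - e) \<le> norm (g t - e)" by (simp add: dist_norm norm_minus_commute)
      then have z\<rho>: "norm (z - e) \<le> \<rho>" using near[OF t] by simp
      have "z \<in> ball e R" using z\<rho> \<rho>(2) by (simp add: dist_norm norm_minus_commute)
      then show "(F has_field_derivative lform l p z) (at z within cball e (norm (g t - e)))"
        by (rule has_field_derivative_at_within[OF F])
      have "norm (lform l p z) = norm (z - e) ^ 2 * norm (k z)" by (simp add: Wk norm_mult norm_power)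
      also have "\<dots> \<le> norm (g t - e) ^ 2 * C"
        using zn z\<rho> C by (intro mult_mono power_mono) (auto simp: dist_norm norm_minus_commute)
      finally show "norm (lform l p z) \<le> C * norm (g t - e) ^ 2" by (simp add: mult.commute)
    qed (auto simp: dist_norm norm_minus_commute)
    define A where "A = min t t0" define B where "B = max t t0"
    have AB: "A \<le> B" "{A..B} \<subseteq> {0..1}" "\<And>s. s \<in> {A..B} \<Longrightarrow> \<bar>s - t0\<bar> < r"
      using t t0 by (auto simp: A_def B_def min_def max_def split: if_splits)
    have gB: "g s \<in> ball e R" if "s \<in> {A..B}" for s
    proof -
      have "norm (g s - e) < \<rho>" by (rule near) (use AB that in blast)+
      then show ?thesis using \<rho>(2) by (simp add: dist_norm norm_minus_commute)
    qed
    have "norm ((F (g B) - of_real B) - (F (g A) - of_real A)) \<le> 0 * (B - A)"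
    proof (rule vector_derivative_bound[OF AB(1), of "\<lambda>s. F (g s) - of_real s" "\<lambda>_. 0"])
      have "continuous_on (ball e R) F" using F DERIV_isCont continuous_at_imp_continuous_on by blast
      then show "continuous_on {A..B} (\<lambda>s. F (g s) - of_real s)"
        using gB by (intro continuous_intros continuous_on_compose2[of "ball e R" F _ g] continuous_on_subset[OF gc AB(2)]) auto
      fix s assume s: "s \<in> {A<..<B}"
      then have s': "s \<in> {A..B}" "s \<in> {0<..<1}" using AB(2) t t0 by (auto simp: A_def B_def min_def max_def split: if_splits)
      have "lform l p (g s) \<noteq> 0" using lform_nonzero[OF p(3)] harc_regular(1)[OF hg s'(2)] by auto
      then have "((\<lambda>s. F (g s)) has_vector_derivative 1) (at s)"
        using has_vector_derivative_compose_field[OF harc_regular(2)[OF hg s'(2)] F[OF gB[OF s'(1)]]] by simp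
      moreover have "(complex_of_real has_vector_derivative 1) (at s)"
        by (auto intro!: derivative_eq_intros)
      ultimately show "((\<lambda>s. F (g s) - of_real s) has_vector_derivative 0) (at s)"
        using has_vector_derivative_diff by fastforce
    qed auto
    then have "F (g B) - F (g A) = of_real (B - A)" by (simp add: algebra_simps)
    then have "norm (F (g B) - F (g A)) = \<bar>B - A\<bar>" by (simp only: norm_of_real)
    then have "norm (F (g t) - F e) = \<bar>t - t0\<bar>"
      by (auto simp: A_def B_def e_def min_def max_def norm_minus_commute split: if_splits)
    then have "\<bar>t - t0\<bar> \<le> C * norm (g t - g t0) ^ 3"
      using 1 by (simp add: e_def power2_eq_square power3_eq_cube mult.assoc)
    then show "norm (g t - g t0) < 1 \<and> \<bar>t - t0\<bar> \<le> C * norm (g t - g t0) ^ 3"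
      using near[OF t] \<rho>(3) by (simp add: e_def)
  qed
qed

text \<open>Converts an error that vanishes linearly in time at both ends into the cubic error
  allowed by \<open>perturbed_arc\<close>. Away from the ends the distance to the zeros has a
  positive minimum by compactness.\<close>

lemma harc_cubic_bound:
  assumes hg: "harc l p 1 g" and p: "p \<noteq> 0" "p\<^sup>2 \<noteq> 1" "l \<noteq> 0"
  obtains C where "0 < C"
    "\<And>t. t \<in> {0..1} \<Longrightarrow> min t (1 - t) \<le> C * (min (norm (g t - 1)) (norm (g t + 1))) ^ 3"
proof -
  have g01: "path g" "g 0 = 1" "g 1 = -1" using hg by (auto simp: harc_def pathstart_def pathfinish_def)
  have gc: "continuous_on {0..1} g" using g01 by (simp add: path_def)
  let ?d = "\<lambda>t. min (norm (g t - 1)) (norm (g t + 1))"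
  have two: "2 \<le> norm (g t - 1) + norm (g t + 1)" for t
    using norm_triangle_ineq4[of "g t + 1" "g t - 1"] by simp
  obtain r0 C0 where 0: "0 < r0" "0 < C0"
    "\<And>t. \<lbrakk>t \<in> {0..1}; \<bar>t - 0\<bar> < r0\<rbrakk> \<Longrightarrow> norm (g t - g 0) < 1 \<and> \<bar>t - 0\<bar> \<le> C0 * norm (g t - g 0) ^ 3"
    using harc_cubic_at_endpoint[OF hg p, of 0] by blast
  obtain r1 C1 where 1: "0 < r1" "0 < C1"
    "\<And>t. \<lbrakk>t \<in> {0..1}; \<bar>t - 1\<bar> < r1\<rbrakk> \<Longrightarrow> norm (g t - g 1) < 1 \<and> \<bar>t - 1\<bar> \<le> C1 * norm (g t - g 1) ^ 3"
    using harc_cubic_at_endpoint[OF hg p, of 1] by blast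
  define r where "r = min (1 / 2) (min r0 r1)"
  have r: "0 < r" "r \<le> r0" "r \<le> r1" "r \<le> 1 / 2" using 0(1) 1(1) by (auto simp: r_def)
  have "continuous_on {r..1 - r} ?d"
    using r by (intro continuous_intros continuous_on_subset[OF gc]) auto
  then obtain x where x: "x \<in> {r..1 - r}" "\<And>t. t \<in> {r..1 - r} \<Longrightarrow> ?d x \<le> ?d t"
    using continuous_attains_inf[of "{r..1 - r}" ?d] r by auto
  have dx: "0 < ?d x"
  proof -
    have "x \<in> {0<..<1}" using x(1) r by auto
    then show ?thesis using harc_regular(1)[OF hg, of x] by (auto simp: add_eq_0_iff2)
  qed
  define d0 where "d0 = ?d x"
  have d0: "0 < d0" "\<And>t. t \<in> {r..1 - r} \<Longrightarrow> d0 \<le> ?d t" unfolding d0_def using dx x(2) by blast+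
  define C where "C = C0 + C1 + 1 / d0 ^ 3"
  have iC: "0 < 1 / d0 ^ 3" using d0 by simp
  have C: "0 < C" "C0 \<le> C" "C1 \<le> C" "1 / d0 ^ 3 \<le> C" unfolding C_def using 0(2) 1(2) iC by linarith+
  show ?thesis
  proof (rule that[OF C(1)])
    fix t :: real assume t: "t \<in> {0..1}"
    consider "t < r" | "1 - t < r" | "t \<in> {r..1 - r}" by force
    then show "min t (1 - t) \<le> C * ?d t ^ 3"
    proof cases
      case 1
      then have n: "norm (g t - 1) < 1" "t \<le> C0 * norm (g t - 1) ^ 3" using 0(3)[of t] t r g01 by auto
      then have "?d t = norm (g t - 1)" using two[of t] by simp
      moreover have "C0 * norm (g t - 1) ^ 3 \<le> C * norm (g t - 1) ^ 3" using C by (intro mult_right_mono) auto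
      ultimately show ?thesis using n by (metis min.coboundedI1 order_trans)
    next
      case 2
      then have n: "norm (g t + 1) < 1" "1 - t \<le> C1 * norm (g t + 1) ^ 3" using 1(3)[of t] t r g01 by auto
      then have "?d t = norm (g t + 1)" using two[of t] by simp
      moreover have "C1 * norm (g t + 1) ^ 3 \<le> C * norm (g t + 1) ^ 3" using C by (intro mult_right_mono) auto
      ultimately show ?thesis using n by (metis min.coboundedI2 order_trans)
    next
      case 3
      have "1 = 1 / d0 ^ 3 * d0 ^ 3" using d0(1) by simp
      also have "\<dots> \<le> C * ?d t ^ 3"
        using C(1,4) d0(2)[OF 3] d0(1) by (intro mult_mono power_mono) simp_all
      finally show ?thesis using t by auto
    qed
  qed
qed

lemma dist_triple_le: "dist (a, b, c) (a', b', c') \<le> dist a a' + dist b b' + dist c c'"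
proof -
  have "dist (a, b, c) (a', b', c') \<le> dist a a' + (dist b b' + dist c c')"
    unfolding dist_Pair_Pair
    by (intro order_trans[OF sqrt_sum_squares_le_sum] add_mono order_refl) (auto intro!: sqrt_sum_squares_le_sum)
  then show ?thesis by simp
qed

text \<open>The old arc serves as approximate solution for the new form. Its integral has a
  derivative close to 1 and, by the assumption on winding numbers, the exact final value 1. So its
  deviation from \<open>t\<close> can be estimated from either end, which makes it small enough near
  both zeros.\<close>

lemma harc_perturb:
  assumes hg: "harc l0 p0 1 g" and p0: "p0 \<noteq> 0" "p0\<^sup>2 \<noteq> 1" "l0 \<noteq> 0"
  shows "\<exists>\<epsilon>>0. \<forall>l p. dist l l0 < \<epsilon> \<and> dist p p0 < \<epsilon> \<and>
      2 * of_real pi * \<i> * l * (winding_number g 0 + res_ratio p * (winding_number g p - winding_number g (1 / p))) = 1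
      \<longrightarrow> (\<exists>h. harc l p 1 h)"
proof -
  have g01: "path g" "g 0 = 1" "g 1 = -1" using hg by (auto simp: harc_def pathstart_def pathfinish_def)
  have gc: "continuous_on {0..1} g" using g01 by (simp add: path_def)
  define Q where "Q = (\<lambda>(l, p, u). l / (u * (u - p)\<^sup>2 * (u - 1 / p)\<^sup>2 :: complex))"
  \<comment> \<open>The factor \<open>u * p - 1\<close> in place of \<open>u - 1 / p\<close> makes
    the condition polynomial, so that openness is immediate.\<close>
  define \<Omega> where "\<Omega> = {(l, p, u). l * (p * (p\<^sup>2 - 1) * u * (u - p) * (u * p - 1)) \<noteq> (0 :: complex)}"
  have WQ: "lform l p u = (u\<^sup>2 - 1)\<^sup>2 * Q (l, p, u)" for l p u by (simp add: lform_def Q_def)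
  have \<Omega>D: "l \<noteq> 0 \<and> p \<noteq> 0 \<and> p\<^sup>2 \<noteq> 1 \<and> u \<noteq> 0 \<and> u \<noteq> p \<and> u \<noteq> 1 / p" if "(l, p, u) \<in> \<Omega>" for l p u
    using that by (auto simp: \<Omega>_def)
  have o\<Omega>: "open \<Omega>"
    unfolding \<Omega>_def case_prod_beta by (intro open_Collect_neq continuous_intros)
  define S where "S = (\<lambda>t. (l0, p0, g t)) ` {0..1}"
  have "compact S" unfolding S_def by (intro compact_continuous_image continuous_intros gc) auto
  have "S \<subseteq> \<Omega>"
  proof -
    have "g t \<noteq> 0 \<and> g t \<noteq> p0 \<and> g t * p0 \<noteq> 1" if "t \<in> {0..1}" for t
    proof -
      have "g t \<in> path_image g" using that by (simp add: path_image_def)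
      then have "g t \<noteq> 0" "g t \<noteq> p0" "g t \<noteq> 1 / p0" using harc_avoids[OF hg p0(1,2)] by metis+
      then show ?thesis using p0(1) by (metis nonzero_eq_divide_eq)
    qed
    then show ?thesis unfolding S_def
    proof (intro image_subsetI)
      show "(l0, p0, g t) \<in> \<Omega>" if "t \<in> {0..1}" and *: "\<And>t. t \<in> {0..1} \<Longrightarrow> g t \<noteq> 0 \<and> g t \<noteq> p0 \<and> g t * p0 \<noteq> 1" for t
        using *[OF that(1)] p0 by (simp add: \<Omega>_def)
    qed
  qed
  obtain \<eta> where \<eta>: "\<eta> > 0" "(\<Union>x\<in>S. cball x \<eta>) \<subseteq> \<Omega>"
    using compact_subset_open_imp_cball_epsilon_subset[OF \<open>compact S\<close> o\<Omega> \<open>S \<subseteq> \<Omega>\<close>] by blast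
  define K where "K = (\<Union>x\<in>S. cball x \<eta>)"
  have "compact K" unfolding K_def by (rule compact_minkowski_sum_cball[OF \<open>compact S\<close>])
  have K\<Omega>: "K \<subseteq> \<Omega>" using \<eta> by (simp add: K_def)
  have KD: "l \<noteq> 0 \<and> p \<noteq> 0 \<and> p\<^sup>2 \<noteq> 1 \<and> u \<noteq> 0 \<and> u \<noteq> p \<and> u \<noteq> 1 / p" if "(l, p, u) \<in> K" for l p u
    using \<Omega>D K\<Omega> that by blast
  have cQ: "continuous_on K Q"
    unfolding Q_def case_prod_beta using KD by (intro continuous_intros) auto
  have inK: "(l, p, u) \<in> K" if "t \<in> {0..1}" "dist l l0 + dist p p0 + dist u (g t) \<le> \<eta>" for l p u t
  proof -
    have "(l, p, u) \<in> cball (l0, p0, g t) \<eta>"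
      using that(2) dist_triple_le[of l p u l0 p0 "g t"] by (simp add: dist_commute)
    then show ?thesis using that(1) unfolding K_def S_def by blast
  qed
  have Kne: "K \<noteq> {}" using inK[of 0 l0 p0 "g 0"] \<eta>(1) by auto
  obtain k0 where "k0 \<in> K" "\<And>k. k \<in> K \<Longrightarrow> norm (Q k0) \<le> norm (Q k)"
    using continuous_attains_inf[OF \<open>compact K\<close> Kne continuous_on_norm[OF cQ]] by blast
  moreover define m where "m = norm (Q k0)"
  ultimately have m: "0 < m" "\<And>k. k \<in> K \<Longrightarrow> m \<le> norm (Q k)"
    using KD by (cases k0; auto simp: Q_def)+
  have unif: "\<exists>d>0. \<forall>x\<in>K. \<forall>y\<in>K. dist x y < d \<longrightarrow> norm (Q x - Q y) < e" if "0 < e" for e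
    using compact_uniformly_continuous[OF cQ \<open>compact K\<close>] that
    unfolding uniformly_continuous_on_def dist_norm by metis
  obtain \<delta>1 where \<delta>1: "\<delta>1 > 0" "\<And>x y. \<lbrakk>x \<in> K; y \<in> K; dist x y < \<delta>1\<rbrakk> \<Longrightarrow> norm (Q x - Q y) < m / 16"
    using unif[of "m / 16"] m(1) by auto
  define \<delta> where "\<delta> = min (\<eta> / 2) \<delta>1"
  have \<delta>: "0 < \<delta>" "\<delta> \<le> \<eta> / 2" "\<delta> \<le> \<delta>1" using \<eta>(1) \<delta>1(1) by (auto simp: \<delta>_def)
  define d where "d t = min (norm (g t - 1)) (norm (g t + 1))" for t
  obtain C where C: "0 < C" "\<And>t. t \<in> {0..1} \<Longrightarrow> min t (1 - t) \<le> C * d t ^ 3"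
    using harc_cubic_bound[OF hg p0] unfolding d_def by metis
  have "bounded (g ` {0..1})" by (intro compact_imp_bounded compact_continuous_image gc) auto
  then obtain B where B: "0 < B" "\<And>t. t \<in> {0..1} \<Longrightarrow> norm (g t) \<le> B" unfolding bounded_pos by blast
  have dB: "d t \<le> B + 1" if "t \<in> {0..1}" for t
    using norm_triangle_ineq4[of "g t" 1] B(2)[OF that] by (simp add: d_def)
  define c where "c = min (1 / 64) (\<delta> / (2 * (B + 1)))"
  have c: "0 < c" "c \<le> 1 / 64" "c \<le> \<delta> / (2 * (B + 1))" 
    using \<delta>(1) B(1) unfolding c_def
    by - (simp, rule min.cobounded1, rule min.cobounded2)
  have cd: "2 * c * d t \<le> \<delta>" if "t \<in> {0..1}" for t
  proof -
    have "2 * c * d t \<le> 2 * (\<delta> / (2 * (B + 1))) * (B + 1)"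
      using c dB[OF that] B(1) by (intro mult_mono) (auto simp: d_def)
    also have "\<dots> = \<delta>" using B(1) by (simp add: field_simps)
    finally show ?thesis .
  qed
  \<comment> \<open>Chosen so that e * C * (d t)^3 is the error 3/4 * c * m * (d t)^3 that
    \<open>perturbed_arc\<close> permits.\<close>
  define e where "e = 3 / 4 * c * m / C"
  have e: "0 < e" using c m(1) C(1) by (simp add: e_def)
  obtain \<delta>2 where \<delta>2: "\<delta>2 > 0" "\<And>x y. \<lbrakk>x \<in> K; y \<in> K; dist x y < \<delta>2\<rbrakk> \<Longrightarrow> norm (Q x - Q y) < m * e"
    using unif[of "m * e"] m(1) e by auto
  \<comment> \<open>The two parameters together use at most half of \<open>\<eta>\<close>; the other
    half is left to the discs of radius \<open>\<delta>\<close>. The half of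
    \<open>\<delta>2\<close> provides for two parameters in the same way.\<close>
  define \<epsilon> where "\<epsilon> = min (\<eta> / 4) (\<delta>2 / 2)"
  have \<epsilon>: "0 < \<epsilon>" "\<epsilon> \<le> \<eta> / 4" "\<epsilon> \<le> \<delta>2 / 2" using \<eta>(1) \<delta>2(1) by (auto simp: \<epsilon>_def)
  have "\<exists>h. harc l p 1 h" if lp: "dist l l0 < \<epsilon>" "dist p p0 < \<epsilon>"
    and tot: "2 * of_real pi * \<i> * l * (winding_number g 0 + res_ratio p * (winding_number g p - winding_number g (1 / p))) = 1" for l p
  proof -
    have inK1: "(l, p, u) \<in> K" if "t \<in> {0..1}" "u \<in> ball (g t) \<delta>" for t u
      by (rule inK[OF that(1)]) (use that(2) lp \<epsilon>(2) \<delta>(2) in \<open>simp add: dist_commute\<close>)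
    have gK: "(l, p, g t) \<in> K" "(l0, p0, g t) \<in> K" if "t \<in> {0..1}" for t
      using inK1[OF that, of "g t"] inK[OF that, of l0 p0 "g t"] \<delta>(1) \<eta>(1) by auto
    have lp0: "l \<noteq> 0" "p \<noteq> 0" "p\<^sup>2 \<noteq> 1" using KD[OF gK(1)[of 0]] by auto
    have av: "0 \<notin> path_image g" "p \<notin> path_image g" "1 / p \<notin> path_image g"
      unfolding path_image_def using KD[OF gK(1)] by (metis imageE)+
    let ?q = "\<lambda>u. Q (l, p, u)"
    define U where "U = (\<Union>t\<in>{0..1}. ball (g t) \<delta>)"
    have UK: "(l, p, u) \<in> K" if "u \<in> U" for u using inK1 that by (auto simp: U_def)
    obtain \<phi> where \<phi>: "continuous_on {0..1} \<phi>" "\<phi> 0 = 0"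
      "\<And>t. t \<in> {0<..<1} \<Longrightarrow> (\<phi> has_vector_derivative lform l p (g t) * (of_real 1 / lform l0 p0 (g t))) (at t)"
      "\<phi> 1 = 1"
    proof (rule lform_integral_along[OF g01(1) _ _ av lp0(2,3) harc_regular(2)[OF hg], of l])
      show "pathstart g = 1" "pathfinish g = -1" using g01 by (simp_all add: pathstart_def pathfinish_def)
    qed (use that tot in metis)+
    have d\<phi>: "norm (lform l p (g t) * (of_real 1 / lform l0 p0 (g t)) - 1) \<le> e" if t: "t \<in> {0<..<1}" for t
    proof -
      have t': "t \<in> {0..1}" using t by auto
      have "g t \<noteq> 1" "g t \<noteq> -1" using harc_regular(1)[OF hg t] by auto
      then have nz: "((g t)\<^sup>2 - 1)\<^sup>2 \<noteq> 0" by (simp add: power2_eq_1_iff)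
      have q0: "Q (l0, p0, g t) \<noteq> 0" using m gK(2)[OF t'] by (metis norm_zero not_le)
      have eq: "lform l p (g t) * (of_real 1 / lform l0 p0 (g t)) - 1 = (Q (l, p, g t) - Q (l0, p0, g t)) / Q (l0, p0, g t)"
        unfolding WQ using nz q0 by (simp add: diff_divide_distrib)
      have "dist (l, p, g t) (l0, p0, g t) < \<delta>2"
        using dist_triple_le[of l p "g t" l0 p0 "g t"] lp \<epsilon>(3) by simp
      then have "norm (Q (l, p, g t) - Q (l0, p0, g t)) \<le> e * m"
        using \<delta>2(2)[OF gK[OF t']] by (simp add: mult.commute)
      also have "\<dots> \<le> e * norm (Q (l0, p0, g t))" using e m(2)[OF gK(2)[OF t']] by (intro mult_left_mono) auto
      finally show ?thesis unfolding eq norm_divide using q0 by (simp add: divide_le_eq)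
    qed
    have d\<phi>': "((\<lambda>t. \<phi> t - of_real t) has_vector_derivative lform l p (g t) * (of_real 1 / lform l0 p0 (g t)) - 1) (at t)"
      if t: "t \<in> {0<..<1}" for t
      by (intro has_vector_derivative_diff \<phi>(3)[OF t]) (auto intro!: derivative_eq_intros)
    have c\<phi>: "continuous_on {0..1} (\<lambda>t. \<phi> t - of_real t)" by (intro continuous_intros \<phi>(1))
    \<comment> \<open>Integrating from 0 gives the bound e t and, as \<open>\<phi> 1 = 1\<close>,
      integrating back from 1 gives e (1 - t).\<close>
    have small: "norm (\<phi> t - of_real t) \<le> 3 / 4 * c * m * d t ^ 3" if t: "t \<in> {0<..<1}" for t
    proof -
      have "norm ((\<phi> t - of_real t) - (\<phi> 0 - of_real 0)) \<le> e * (t - 0)"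
        using t by (intro vector_derivative_bound[OF _ continuous_on_subset[OF c\<phi>] d\<phi>' d\<phi>]) auto
      moreover have "norm ((\<phi> 1 - of_real 1) - (\<phi> t - of_real t)) \<le> e * (1 - t)"
        using t by (intro vector_derivative_bound[OF _ continuous_on_subset[OF c\<phi>] d\<phi>' d\<phi>]) auto
      ultimately have "norm (\<phi> t - of_real t) \<le> e * t" "norm (\<phi> t - of_real t) \<le> e * (1 - t)"
        using \<phi>(2,4) by (auto simp: norm_minus_commute)
      then have "norm (\<phi> t - of_real t) \<le> e * min t (1 - t)" by (simp add: min_def)
      also have "\<dots> \<le> e * (C * d t ^ 3)" using C(2)[of t] t e by (intro mult_left_mono) auto
      also have "\<dots> = 3 / 4 * c * m * d t ^ 3" using C(1) by (simp add: e_def)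
      finally show ?thesis .
    qed
    obtain h where h: "path h" "pathstart h = 1" "pathfinish h = -1"
      "\<And>t. t \<in> {0<..<1} \<Longrightarrow> h t \<in> U - {1, -1} \<and> (h has_vector_derivative 1 / (((h t)\<^sup>2 - 1)\<^sup>2 * ?q (h t))) (at t)"
    proof (rule perturbed_arc[of g "\<lambda>t. of_real 1 / lform l0 p0 (g t)" U ?q \<delta> m d c \<phi>])
      show "open U" by (auto simp: U_def)
      have "?q holomorphic_on U" unfolding Q_def using KD[OF UK] by (auto intro!: holomorphic_intros)
      then show "?q holomorphic_on U" .
      show "g t \<noteq> 1 \<and> g t \<noteq> -1" if "t \<in> {0<..<1}" for t using harc_regular(1)[OF hg that] by auto
      show "(g has_vector_derivative of_real 1 / lform l0 p0 (g t)) (at t)" if "t \<in> {0<..<1}" for t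
        using harc_regular(2)[OF hg that] .
      show "ball (g t) \<delta> \<subseteq> U" if "t \<in> {0..1}" for t using that by (auto simp: U_def)
      show "m \<le> norm (?q u)" if "u \<in> U" for u by (rule m(2)[OF UK[OF that]])
      show "norm (?q u - ?q (g t)) \<le> norm (?q (g t)) / 16" if "t \<in> {0..1}" "u \<in> ball (g t) \<delta>" for t u
      proof -
        have "dist (l, p, u) (l, p, g t) < \<delta>1" using that(2) \<delta>(3) by (simp add: dist_Pair_Pair dist_commute)
        then have "norm (?q u - ?q (g t)) < m / 16" by (intro \<delta>1(2) inK1[OF that] gK(1)[OF that(1)])
        then show ?thesis using m(2)[OF gK(1)[OF that(1)]] by simp
      qed
      show "(\<phi> has_vector_derivative ((g t)\<^sup>2 - 1)\<^sup>2 * ?q (g t) * (of_real 1 / lform l0 p0 (g t))) (at t)" if "t \<in> {0<..<1}" for t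
        using \<phi>(3)[OF that] unfolding WQ[of l p] .
    qed (use gc g01 m(1) d_def c cd small in auto)
    have "harc l p 1 h"
      unfolding harc_def
    proof (intro conjI ballI h)
      fix t :: real assume t: "t \<in> {0<..<1}"
      have "h t \<in> U" "h t \<noteq> 1" "h t \<noteq> -1" using h(4)[OF t] by auto
      then show "h t \<notin> {0, 1, -1, p, 1 / p}" using KD[OF UK] by simp
      show "(h has_vector_derivative of_real 1 / lform l p (h t)) (at t)"
        using h(4)[OF t] unfolding WQ by simp
    qed simp
    then show ?thesis by blast
  qed
  then show ?thesis using \<epsilon>(1) by blast
qed

section \<open>Limits of horizontal arcs\<close>

text \<open>Gronwall's estimate for ln (1 + |f|^2), which is differentiable also where
  \<open>f\<close> vanishes. Its derivative is at most 4 M because 2 a (1 + a) <= 4 (1 + a^2); at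
  the end |f| <= 1 + |f|^2 returns to the norm.\<close>

lemma gronwall_norm_bound:
  fixes f :: "real \<Rightarrow> complex"
  assumes cf: "continuous_on {0..1} f" and f0: "f 0 = 0" and M: "0 \<le> M"
    and d: "\<And>t. t \<in> {0<..<1} \<Longrightarrow> (f has_vector_derivative f' t) (at t)"
    and b: "\<And>t. t \<in> {0<..<1} \<Longrightarrow> norm (f' t) \<le> M * (1 + norm (f t))"
    and t: "t \<in> {0..1}"
  shows "norm (f t) \<le> exp (4 * M)"
proof -
  let ?u = "\<lambda>s. ln (1 + f s \<bullet> f s)"
  let ?u' = "\<lambda>s. (f s \<bullet> f' s + f' s \<bullet> f s) / (1 + f s \<bullet> f s)"
  have pos: "0 < 1 + f s \<bullet> f s" for s using inner_ge_zero[of "f s"] by linarith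
  have "norm (?u t - ?u 0) \<le> 4 * M * (t - 0)"
  proof (rule vector_derivative_bound[where f' = ?u'])
    show "0 \<le> t" using t by simp
    show "continuous_on {0..t} ?u"
      by (intro continuous_intros continuous_on_subset[OF cf]) (use t pos less_imp_neq in \<open>auto simp: less_le\<close>)
    fix s assume s: "s \<in> {0<..<t}"
    then have s': "s \<in> {0<..<1}" using t by auto
    have "((\<lambda>s. f s \<bullet> f s) has_vector_derivative f s \<bullet> f' s + f' s \<bullet> f s) (at s)"
      by (rule bounded_bilinear.has_vector_derivative[OF bounded_bilinear_inner d[OF s'] d[OF s']])
    then have "((\<lambda>s. f s \<bullet> f s) has_real_derivative f s \<bullet> f' s + f' s \<bullet> f s) (at s)"
      by (simp add: has_real_derivative_iff_has_vector_derivative)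
    then have "(?u has_real_derivative ?u' s) (at s)"
      using pos[of s] by (auto intro!: derivative_eq_intros)
    then show "(?u has_vector_derivative ?u' s) (at s)"
      by (simp add: has_real_derivative_iff_has_vector_derivative)
    define a where "a = norm (f s)"
    have a: "0 \<le> a" "f s \<bullet> f s = a\<^sup>2" by (simp_all add: a_def power2_norm_eq_inner)
    have "\<bar>f s \<bullet> f' s + f' s \<bullet> f s\<bar> \<le> 2 * (a * norm (f' s))"
      using Cauchy_Schwarz_ineq2[of "f s" "f' s"] by (simp add: inner_commute a_def)
    also have "\<dots> \<le> 2 * (a * (M * (1 + a)))"
      using b[OF s'] a(1) by (intro mult_left_mono) (auto simp: a_def)
    also have "\<dots> = M * (2 * a + 2 * a\<^sup>2)" by (simp add: algebra_simps power2_eq_square)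
    also have "\<dots> \<le> M * (4 * (1 + a\<^sup>2))"
    proof (rule mult_left_mono[OF _ M])
      have "0 \<le> (a - 1)\<^sup>2" by simp
      then have "2 * a \<le> 1 + a\<^sup>2" by (simp add: power2_eq_square algebra_simps)
      moreover have "0 \<le> a\<^sup>2" by simp
      moreover have "4 * (1 + a\<^sup>2) = 4 + 4 * a\<^sup>2" by simp
      ultimately show "2 * a + 2 * a\<^sup>2 \<le> 4 * (1 + a\<^sup>2)" by argo
    qed
    finally have "\<bar>f s \<bullet> f' s + f' s \<bullet> f s\<bar> \<le> 4 * M * (1 + f s \<bullet> f s)" by (simp add: a(2) algebra_simps)
    then show "norm (?u' s) \<le> 4 * M" using pos[of s] by (simp add: abs_divide divide_le_eq)
  qed
  then have "ln (1 + f t \<bullet> f t) \<le> 4 * M * t" using f0 by simp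
  also have "\<dots> \<le> 4 * M * 1" using t M by (intro mult_left_mono) auto
  finally have "exp (ln (1 + f t \<bullet> f t)) \<le> exp (4 * M)" by simp
  then have "1 + f t \<bullet> f t \<le> exp (4 * M)" using pos[of t] by simp
  moreover have "f t \<bullet> f t = (norm (f t))\<^sup>2" by (simp add: power2_norm_eq_inner)
  moreover have "0 \<le> (norm (f t) - 1)\<^sup>2" by simp
  then have "2 * norm (f t) \<le> 1 + (norm (f t))\<^sup>2" by (simp add: power2_eq_square algebra_simps)
  then have "norm (f t) \<le> 1 + (norm (f t))\<^sup>2" using norm_ge_zero[of "f t"] by linarith
  ultimately show ?thesis by simp
qed

text \<open>With \<open>y = v - 1 / v\<close> (a multiple of \<open>sqrt ((z - a) * (z - b))\<close>) and \<open>s\<close> a multiple of \<open>z\<close>, the velocity blows up at the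
  double zeros, but the cubes of \<open>y\<close> and of \<open>y / s\<close> have velocities polynomially bounded in \<open>y\<close> and \<open>y / s\<close>. Gronwall's
  inequality then keeps an arc of length 1 away from \<open>z = \<infinity>\<close> and from \<open>z = 0\<close>.\<close>

lemma harc_cube_derivatives:
  assumes hg: "harc l p 1 g" and p: "p \<noteq> 0" "l \<noteq> 0" and t: "t \<in> {0<..<1}"
  defines "y \<equiv> \<lambda>t. g t - 1 / g t" and "x \<equiv> \<lambda>t. g t + 1 / g t"
  defines "s \<equiv> \<lambda>t. 1 + p\<^sup>2 - p * x t"
  defines "\<kappa> \<equiv> 1 / (l * p\<^sup>2)"
  shows "g t \<noteq> 0" "y t \<noteq> 0" "s t \<noteq> 0"
    "(g has_vector_derivative \<kappa> * g t * (s t)\<^sup>2 / (y t)\<^sup>2) (at t)"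
    "((\<lambda>t. y t ^ 3) has_vector_derivative 3 * \<kappa> * x t * (s t)\<^sup>2) (at t)"
    "((\<lambda>t. (y t / s t) ^ 3) has_vector_derivative 3 * \<kappa> * (x t / s t + p * (y t / s t)\<^sup>2)) (at t)"
proof -
  define v where "v = g t"
  have v: "v \<noteq> 0" "v \<noteq> 1" "v \<noteq> -1" "v \<noteq> p" "v \<noteq> 1 / p" using harc_regular(1)[OF hg t] by (auto simp: v_def)
  have yv: "y t = (v - 1) * (v + 1) / v" using v(1) by (simp add: y_def v_def field_simps)
  have sv: "s t = - p * (v - p) * (v - 1 / p) / v"
    using v(1) p(1) by (simp add: s_def x_def v_def field_simps power2_eq_square)
  have v1: "v + 1 \<noteq> 0" using v(3) by (simp add: add_eq_0_iff2)
  show g0: "g t \<noteq> 0" using v(1) by (simp add: v_def)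
  show y0: "y t \<noteq> 0" unfolding yv using v v1 by simp
  show s0: "s t \<noteq> 0" unfolding sv using v p(1) by simp
  \<comment> \<open>In these variables the form is l p^2 y^2 / (v s^2) dv.\<close>
  have "of_real 1 / lform l p v = \<kappa> * v * (s t)\<^sup>2 / (y t)\<^sup>2"
  proof -
    define D where "D = (v - p) * (v - 1 / p)"
    define E where "E = (v - 1) * (v + 1)"
    have "E = v\<^sup>2 - 1" by (simp add: E_def algebra_simps power2_eq_square)
    then have WE: "lform l p v = l * E\<^sup>2 / (v * D\<^sup>2)"
      by (simp add: lform_def D_def power_mult_distrib mult.assoc)
    have sE: "s t = - p * D / v" "y t = E / v" by (simp_all add: sv yv D_def E_def)
    have "D \<noteq> 0" "E \<noteq> 0" using v v1 by (simp_all add: D_def E_def)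
    then show ?thesis unfolding WE sE using v(1) p
      by (simp add: \<kappa>_def power_divide power_mult_distrib field_simps power2_eq_square)
  qed
  then show dg: "(g has_vector_derivative \<kappa> * g t * (s t)\<^sup>2 / (y t)\<^sup>2) (at t)"
    using harc_regular(2)[OF hg t] by (simp add: v_def)
  define d where "d = \<kappa> * g t * (s t)\<^sup>2 / (y t)\<^sup>2"
  have dinv: "((\<lambda>v. 1 / v) has_field_derivative - (1 / (g t)\<^sup>2)) (at (g t))"
    using g0 by (auto intro!: derivative_eq_intros simp: power2_eq_square)
  note dg' = dg[folded d_def]
  note di = has_vector_derivative_compose_field[OF dg' dinv]
  have dy: "(y has_vector_derivative d - d * - (1 / (g t)\<^sup>2)) (at t)"
    unfolding y_def by (intro has_vector_derivative_diff dg' di)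
  have dx: "(x has_vector_derivative d + d * - (1 / (g t)\<^sup>2)) (at t)"
    unfolding x_def by (intro has_vector_derivative_add dg' di)
  have y': "d - d * - (1 / (g t)\<^sup>2) = \<kappa> * x t * (s t)\<^sup>2 / (y t)\<^sup>2"
  proof -
    have "d - d * - (1 / (g t)\<^sup>2) = d / g t * x t"
      using g0 by (simp add: x_def field_simps power2_eq_square)
    then show ?thesis using g0 by (simp add: d_def)
  qed
  have x': "d + d * - (1 / (g t)\<^sup>2) = \<kappa> * (s t)\<^sup>2 / y t"
  proof -
    have "d + d * - (1 / (g t)\<^sup>2) = d / g t * y t"
      using g0 by (simp add: y_def field_simps power2_eq_square)
    then show ?thesis using g0 y0 by (simp add: d_def power2_eq_square)
  qed
  have ds: "(s has_vector_derivative - (p * (\<kappa> * (s t)\<^sup>2 / y t))) (at t)"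
    unfolding s_def using has_vector_derivative_diff[OF has_vector_derivative_const[of "1 + p\<^sup>2"]
        has_vector_derivative_mult_right[OF dx[unfolded x'], of p]] by (simp add: s_def)
  have cube: "((\<lambda>z. z ^ 3) has_field_derivative 3 * z\<^sup>2) (at z)" for z :: complex
    by (auto intro!: derivative_eq_intros)
  have "((\<lambda>t. y t ^ 3) has_vector_derivative (\<kappa> * x t * (s t)\<^sup>2 / (y t)\<^sup>2) * (3 * (y t)\<^sup>2)) (at t)"
    by (rule has_vector_derivative_compose_field[OF dy[unfolded y'] cube])
  moreover have "(\<kappa> * x t * (s t)\<^sup>2 / (y t)\<^sup>2) * (3 * (y t)\<^sup>2) = 3 * \<kappa> * x t * (s t)\<^sup>2"
    using y0 by simp
  ultimately show "((\<lambda>t. y t ^ 3) has_vector_derivative 3 * \<kappa> * x t * (s t)\<^sup>2) (at t)"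
    by simp
  have "((\<lambda>z. 1 / z) has_field_derivative - (1 / (s t)\<^sup>2)) (at (s t))"
    using s0 by (auto intro!: derivative_eq_intros simp: power2_eq_square)
  note inv_s = has_vector_derivative_compose_field[OF ds this]
  have "((\<lambda>t. y t * (1 / s t)) has_vector_derivative y t * (- (p * (\<kappa> * (s t)\<^sup>2 / y t)) * - (1 / (s t)\<^sup>2))
      + (\<kappa> * x t * (s t)\<^sup>2 / (y t)\<^sup>2) * (1 / s t)) (at t)"
    by (rule has_vector_derivative_mult[OF dy[unfolded y'] inv_s])
  then have "((\<lambda>t. y t / s t) has_vector_derivative y t * (- (p * (\<kappa> * (s t)\<^sup>2 / y t)) * - (1 / (s t)\<^sup>2))
      + (\<kappa> * x t * (s t)\<^sup>2 / (y t)\<^sup>2) * (1 / s t)) (at t)" by simp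
  note D = has_vector_derivative_compose_field[OF this cube]
  have eq: "(y t * (- (p * (\<kappa> * (s t)\<^sup>2 / y t)) * - (1 / (s t)\<^sup>2))
      + (\<kappa> * x t * (s t)\<^sup>2 / (y t)\<^sup>2) * (1 / s t)) * (3 * (y t / s t)\<^sup>2) = 3 * \<kappa> * (x t / s t + p * (y t / s t)\<^sup>2)"
  proof -
    have 1: "y t * (- (p * (\<kappa> * (s t)\<^sup>2 / y t)) * - (1 / (s t)\<^sup>2)) = p * \<kappa>"
      using y0 s0 by simp
    have 2: "(\<kappa> * x t * (s t)\<^sup>2 / (y t)\<^sup>2) * (1 / s t) = \<kappa> * x t * s t / (y t)\<^sup>2"
      using s0 by (simp add: power2_eq_square)
    show ?thesis unfolding 1 2 using y0 s0 by (simp add: power_divide field_simps power2_eq_square)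
  qed
  show "((\<lambda>t. (y t / s t) ^ 3) has_vector_derivative 3 * \<kappa> * (x t / s t + p * (y t / s t)\<^sup>2)) (at t)"
    using D unfolding eq .
qed


lemma cube_estimates:
  fixes a :: real
  assumes "0 \<le> a"
  shows "a \<le> 1 + a ^ 3" "a\<^sup>2 \<le> 1 + a ^ 3" "(1 + a) ^ 3 \<le> 4 * (1 + a ^ 3)"
proof -
  have p: "0 \<le> a ^ 3" "0 \<le> a\<^sup>2" using assms by auto
  show 1: "a \<le> 1 + a ^ 3"
  proof (cases "a \<le> 1")
    case True then show ?thesis using p by linarith
  next
    case False
    then have "a ^ 1 \<le> a ^ 3" by (intro power_increasing) auto
    then show ?thesis by simp
  qed
  show 2: "a\<^sup>2 \<le> 1 + a ^ 3"
  proof (cases "a \<le> 1")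
    case True then have "a\<^sup>2 \<le> 1" using assms by (simp add: power_le_one)
    then show ?thesis using p by linarith
  next
    case False
    then have "a ^ 2 \<le> a ^ 3" by (intro power_increasing) auto
    then show ?thesis by simp
  qed
  have "0 \<le> 3 * ((a + 1) * (a - 1)\<^sup>2)" using assms by simp
  also have "\<dots> = 4 * (1 + a ^ 3) - (1 + a) ^ 3"
    by (simp add: algebra_simps power2_eq_square power3_eq_cube)
  finally show "(1 + a) ^ 3 \<le> 4 * (1 + a ^ 3)" by simp
qed

text \<open>The last two bounds are those for the velocities of \<open>y\<^sup>3\<close> and, up to the factor \<open>y\<^sup>2\<close>, of \<open>v\<close>.\<close>

definition arc_bounds :: "real \<Rightarrow> complex \<Rightarrow> complex \<Rightarrow> complex \<Rightarrow> bool" where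
  "arc_bounds R l p v \<longleftrightarrow> norm v \<le> R \<and> 1 / R \<le> norm v \<and> 1 / R \<le> norm ((v - p) * (1 - p * v))
     \<and> norm (3 * (1 / (l * p\<^sup>2)) * (v + 1 / v) * (1 + p\<^sup>2 - p * (v + 1 / v))\<^sup>2) \<le> R
     \<and> norm ((1 / (l * p\<^sup>2)) * v * (1 + p\<^sup>2 - p * (v + 1 / v))\<^sup>2) \<le> R"

text \<open>Two applications of Gronwall. Both cubes start at 0 because y vanishes at
  \<open>1\<close>. The first bounds y, hence x and s from above; with these bounds the second
  controls y / s and thereby 1 / s, which keeps the arc away from \<open>p\<close> and
  \<open>1 / p\<close>. The constants depend only on \<open>B\<close>, \<open>k\<close> and
  \<open>\<beta>\<close>, so they serve a whole convergent sequence of parameters.\<close>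

lemma harc_uniform_bounds:
  fixes B k \<beta> :: real
  assumes "0 \<le> B" "0 \<le> k" "0 < \<beta>"
  obtains R where "0 < R"
    "\<And>l p g t. \<lbrakk>harc l p 1 g; p \<noteq> 0; p\<^sup>2 \<noteq> 1; l \<noteq> 0; norm p \<le> B; norm (1 / (l * p\<^sup>2)) \<le> k; \<beta> \<le> norm (1 - p\<^sup>2); t \<in> {0..1}\<rbrakk>
      \<Longrightarrow> arc_bounds R l p (g t)"
proof -
  \<comment> \<open>\<open>M1\<close> and \<open>M2\<close> are the Gronwall rates of the two cubes,
    \<open>Y\<close>, \<open>S\<close> and \<open>S1\<close> bound y, s and 1 / s, and
    \<open>C\<close> compares 1 / s with 1 + |y / s|. The factor 24 is 3 * 2 * 4, from the
    derivative of the cube, |x| <= 2 (1 + |y|) and \<open>cube_estimates\<close>.\<close>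
  define M1 where "M1 = 24 * k * (1 + B) ^ 4"
  define Y where "Y = 1 + exp (4 * M1)"
  define S where "S = 1 + B\<^sup>2 + B * (2 + Y)"
  define C where "C = (B\<^sup>2 * Y + 2 * (1 + B\<^sup>2) + S) / \<beta>\<^sup>2"
  define M2 where "M2 = 3 * k * ((2 + Y) * (C * 2) + B)"
  define S1 where "S1 = C * (2 + exp (4 * M2))"
  define R where "R = (1 + Y) + (1 + Y) * S1 + 3 * k * (2 + Y) * S\<^sup>2 + k * (1 + Y) * S\<^sup>2"
  have Y: "1 \<le> Y" by (simp add: Y_def)
  have S: "1 \<le> S" using assms Y by (simp add: S_def)
  have C: "0 < C" using assms Y S by (simp add: C_def add_nonneg_pos add_pos_nonneg)
  have M1: "0 \<le> M1" using assms by (simp add: M1_def)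
  have M2: "0 \<le> M2" using assms C Y by (simp add: M2_def)
  have S1: "0 < S1" using C by (simp add: S1_def add_pos_pos)
  have Rparts: "0 \<le> (1 + Y) * S1" "0 \<le> 3 * k * (2 + Y) * S\<^sup>2" "0 \<le> k * (1 + Y) * S\<^sup>2"
    using Y S1 assms by auto
  have R: "1 + Y \<le> R" "(1 + Y) * S1 \<le> R" "3 * k * (2 + Y) * S\<^sup>2 \<le> R" "k * (1 + Y) * S\<^sup>2 \<le> R" "0 < R"
    using Rparts Y unfolding R_def by linarith+
  show ?thesis
  proof (rule that[OF R(5)])
    fix l p :: complex and g :: "real \<Rightarrow> complex" and t :: real
    assume hg: "harc l p 1 g" and p: "p \<noteq> 0" "p\<^sup>2 \<noteq> 1" "l \<noteq> 0"
      and bd: "norm p \<le> B" "norm (1 / (l * p\<^sup>2)) \<le> k" "\<beta> \<le> norm (1 - p\<^sup>2)" and t: "t \<in> {0..1}"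
    define \<kappa> where "\<kappa> = 1 / (l * p\<^sup>2)"
    define x where "x t = g t + 1 / g t" for t
    define y where "y t = g t - 1 / g t" for t
    define s where "s t = 1 + p\<^sup>2 - p * x t" for t
    have \<kappa>: "norm \<kappa> \<le> k" using bd(2) by (simp add: \<kappa>_def)
    have g01: "path g" "g 0 = 1" "g 1 = -1" using hg by (auto simp: harc_def pathstart_def pathfinish_def)
    have gc: "continuous_on {0..1} g" using g01 by (simp add: path_def)
    have gn: "g t \<noteq> 0" "g t \<noteq> p" "g t \<noteq> 1 / p" if "t \<in> {0..1}" for t
      using harc_avoids[OF hg p(1,2)] that unfolding path_image_def by (metis imageI)+
    have gs: "(g t - p) * (1 - p * g t) = g t * s t" if "t \<in> {0..1}" for t
      using gn(1)[OF that] by (simp add: s_def x_def field_simps power2_eq_square)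
    have sn: "s t \<noteq> 0" if "t \<in> {0..1}" for t
    proof -
      have "1 - p * g t \<noteq> 0" using gn(3)[OF that] p(1) by (simp add: field_simps)
      then show ?thesis using gs[OF that] gn(2)[OF that] by (metis mult_eq_0_iff right_minus_eq)
    qed
    have xy: "(x t)\<^sup>2 = 4 + (y t)\<^sup>2" if "t \<in> {0..1}" for t
      using gn(1)[OF that] by (simp add: x_def y_def field_simps power2_eq_square)
    have xb: "norm (x t) \<le> 2 + norm (y t)" if "t \<in> {0..1}" for t
    proof -
      have "norm (x t) ^ 2 \<le> norm (4 :: complex) + norm (y t) ^ 2"
        unfolding norm_power[symmetric] xy[OF that] by (rule norm_triangle_ineq)
      also have "\<dots> \<le> (2 + norm (y t))\<^sup>2" by (simp add: power2_eq_square algebra_simps)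
      finally show ?thesis by (rule power2_le_imp_le) simp
    qed
    have sb: "norm (s t) \<le> 1 + B\<^sup>2 + B * norm (x t)" for t
    proof -
      have "norm (s t) \<le> norm (1 + p\<^sup>2) + norm (p * x t)" unfolding s_def by (rule norm_triangle_ineq4)
      also have "\<dots> \<le> (norm (1 :: complex) + norm (p\<^sup>2)) + norm (p * x t)" by (intro add_right_mono norm_triangle_ineq)
      also have "\<dots> \<le> 1 + B\<^sup>2 + B * norm (x t)"
        unfolding norm_mult norm_power using bd(1) by (intro add_mono mult_right_mono power_mono) auto
      finally show ?thesis .
    qed
    have cx: "continuous_on {0..1} x" and cy: "continuous_on {0..1} y" and cs: "continuous_on {0..1} s"
      unfolding x_def y_def s_def using gn(1) by (intro continuous_intros gc ballI; simp)+
    note jk = harc_cube_derivatives[OF hg p(1,3), folded x_def y_def \<kappa>_def, folded s_def]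
    have y3: "norm (y t ^ 3) \<le> exp (4 * M1)" if "t \<in> {0..1}" for t
    proof (rule gronwall_norm_bound[OF _ _ M1 jk(5) _ that])
      show "continuous_on {0..1} (\<lambda>t. y t ^ 3)" by (intro continuous_intros cy)
      show "y 0 ^ 3 = 0" by (simp add: y_def g01)
      fix t :: real assume t: "t \<in> {0<..<1}"
      define n where "n = norm (y t)"
      have n: "0 \<le> n" by (simp add: n_def)
      have "norm (x t) \<le> 2 + n" using xb[of t] t by (simp add: n_def)
      then have "norm (x t) \<le> 2 + 2 * n" using n by linarith
      then have x1: "norm (x t) \<le> 2 * (1 + n)" by simp
      have "norm (s t) \<le> 1 + B\<^sup>2 + B * (2 + n)"
        using sb[of t] mult_left_mono[OF xb[of t] assms(1)] t by (simp add: n_def)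
      also have "\<dots> = (1 + B)\<^sup>2 * 1 + B * n" by (simp add: power2_eq_square algebra_simps)
      also have "\<dots> \<le> (1 + B)\<^sup>2 * 1 + (1 + B)\<^sup>2 * n"
      proof (intro add_left_mono mult_right_mono n)
        have "0 \<le> B\<^sup>2" by simp
        then show "B \<le> (1 + B)\<^sup>2" using assms(1) by (simp add: power2_eq_square algebra_simps)
      qed
      finally have s1: "norm (s t) \<le> (1 + B)\<^sup>2 * (1 + n)" by (simp add: algebra_simps)
      have "norm (3 * \<kappa> * x t * (s t)\<^sup>2) \<le> 3 * k * (2 * (1 + n)) * ((1 + B)\<^sup>2 * (1 + n))\<^sup>2"
        unfolding norm_mult norm_power using \<kappa> x1 s1 assms n by (intro mult_mono power_mono) auto
      also have "\<dots> = 6 * k * (1 + B) ^ 4 * (1 + n) ^ 3"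
        by (simp add: power2_eq_square power3_eq_cube power4_eq_xxxx)
      also have "\<dots> \<le> 6 * k * (1 + B) ^ 4 * (4 * (1 + n ^ 3))"
        using cube_estimates(3)[OF n] assms by (intro mult_left_mono) auto
      also have "\<dots> = 24 * k * (1 + B) ^ 4 * (1 + n ^ 3)"
        using mult.assoc[of "6 * k * (1 + B) ^ 4" 4 "1 + n ^ 3"] by simp
      finally show "norm (3 * \<kappa> * x t * (s t)\<^sup>2) \<le> M1 * (1 + norm (y t ^ 3))"
        by (simp add: M1_def n_def norm_power)
    qed
    have yb: "norm (y t) \<le> Y" if "t \<in> {0..1}" for t
      using cube_estimates(1)[OF norm_ge_zero, of "y t"] y3[OF that] unfolding Y_def norm_power by linarith
    have xb': "norm (x t) \<le> 2 + Y" if "t \<in> {0..1}" for t using xb[OF that] yb[OF that] by simp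
    have sb': "norm (s t) \<le> S" if "t \<in> {0..1}" for t
      using sb[of t] mult_left_mono[OF xb'[OF that] assms(1)] by (simp add: S_def)
    have isb: "norm (1 / s t) \<le> C * (1 + norm (y t / s t))" if t: "t \<in> {0..1}" for t
    proof -
      \<comment> \<open>The identity shows that y and s cannot be small together unless p^2 is near
        1. After division by s it bounds 1 / s by y / s.\<close>
      have "(1 - p\<^sup>2)\<^sup>2 = p\<^sup>2 * (y t)\<^sup>2 + 2 * (1 + p\<^sup>2) * s t - (s t)\<^sup>2"
      proof -
        have "p\<^sup>2 * (y t)\<^sup>2 = p\<^sup>2 * ((x t)\<^sup>2 - 4)" using xy[OF t] by simp
        then show ?thesis by (simp add: s_def power2_eq_square algebra_simps)
      qed
      then have "(1 - p\<^sup>2)\<^sup>2 * (1 / s t) = p\<^sup>2 * y t * (y t / s t) + 2 * (1 + p\<^sup>2) - s t"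
        using sn[OF t] by (simp add: field_simps power2_eq_square)
      then have "norm (1 - p\<^sup>2) ^ 2 * norm (1 / s t) = norm (p\<^sup>2 * y t * (y t / s t) + 2 * (1 + p\<^sup>2) - s t)"
        unfolding norm_mult[symmetric] norm_power[symmetric] by simp
      also have "\<dots> \<le> norm (p\<^sup>2 * y t * (y t / s t)) + norm (2 * (1 + p\<^sup>2)) + norm (s t)"
        by (rule norm_triangle_le_diff, rule add_right_mono, rule norm_triangle_ineq)
      also have "\<dots> \<le> B\<^sup>2 * Y * norm (y t / s t) + 2 * (1 + B\<^sup>2) + S"
      proof (intro add_mono sb'[OF t])
        show "norm (p\<^sup>2 * y t * (y t / s t)) \<le> B\<^sup>2 * Y * norm (y t / s t)"
          unfolding norm_mult norm_power using bd(1) yb[OF t] Y by (intro mult_mono power_mono) auto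
        have "norm (1 + p\<^sup>2) \<le> 1 + norm p ^ 2" using norm_triangle_ineq[of 1 "p\<^sup>2"] by (simp add: norm_power)
        also have "\<dots> \<le> 1 + B\<^sup>2" using bd(1) by (intro add_left_mono power_mono) auto
        finally show "norm (2 * (1 + p\<^sup>2)) \<le> 2 * (1 + B\<^sup>2)"
          by (metis norm_mult norm_numeral mult_left_mono zero_le_numeral)
      qed
      also have "\<dots> \<le> (B\<^sup>2 * Y + 2 * (1 + B\<^sup>2) + S) * (1 + norm (y t / s t))"
      proof -
        have "0 \<le> (2 * (1 + B\<^sup>2) + S) * norm (y t / s t)" "0 \<le> B\<^sup>2 * Y" using S Y by auto
        then show ?thesis by (simp add: algebra_simps)
      qed
      finally have "norm (1 - p\<^sup>2) ^ 2 * norm (1 / s t) \<le> \<beta>\<^sup>2 * (C * (1 + norm (y t / s t)))"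
        using assms(3) by (simp add: C_def)
      moreover have "\<beta>\<^sup>2 * norm (1 / s t) \<le> norm (1 - p\<^sup>2) ^ 2 * norm (1 / s t)"
        using bd(3) assms(3) by (intro mult_right_mono power_mono) auto
      ultimately have "\<beta>\<^sup>2 * norm (1 / s t) \<le> \<beta>\<^sup>2 * (C * (1 + norm (y t / s t)))" by linarith
      then show ?thesis using assms(3) by (simp only: mult_le_cancel_left_pos zero_less_power)
    qed
    have "norm ((y t / s t) ^ 3) \<le> exp (4 * M2)"
    proof (rule gronwall_norm_bound[OF _ _ M2 jk(6) _ t])
      show "continuous_on {0..1} (\<lambda>t. (y t / s t) ^ 3)" using sn by (intro continuous_intros cy cs) auto
      show "(y 0 / s 0) ^ 3 = 0" by (simp add: y_def g01)
      fix t :: real assume t: "t \<in> {0<..<1}"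
      define n where "n = norm (y t / s t)"
      have n: "0 \<le> n" by (simp add: n_def)
      have t': "t \<in> {0..1}" using t by auto
      have is1: "norm (1 / s t) \<le> C * (2 * (1 + n ^ 3))"
      proof -
        have "norm (1 / s t) \<le> C * (1 + n)" using isb[OF t'] by (simp add: n_def)
        also have "\<dots> \<le> C * (2 * (1 + n ^ 3))"
        proof (rule mult_left_mono)
          have "1 + n \<le> 2 + 2 * n ^ 3" using cube_estimates(1)[OF n] zero_le_power[OF n, of 3] by linarith
          then show "1 + n \<le> 2 * (1 + n ^ 3)" by simp
        qed (use C in simp)
        finally show ?thesis .
      qed
      have "norm (x t / s t + p * (y t / s t)\<^sup>2) \<le> norm (x t * (1 / s t)) + norm (p * (y t / s t)\<^sup>2)"
        using norm_triangle_ineq[of "x t / s t" "p * (y t / s t)\<^sup>2"] by simp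
      also have "\<dots> \<le> (2 + Y) * (C * (2 * (1 + n ^ 3))) + B * (1 + n ^ 3)"
        unfolding norm_mult norm_power n_def[symmetric]
        using xb'[OF t'] is1 bd(1) cube_estimates(2)[OF n] Y assms n
        by (intro add_mono mult_mono) auto
      also have "\<dots> = ((2 + Y) * (C * 2) + B) * (1 + n ^ 3)" by (simp add: algebra_simps)
      finally have b: "norm (x t / s t + p * (y t / s t)\<^sup>2) \<le> ((2 + Y) * (C * 2) + B) * (1 + n ^ 3)" .
      have "norm (3 * \<kappa> * (x t / s t + p * (y t / s t)\<^sup>2)) \<le> 3 * k * (((2 + Y) * (C * 2) + B) * (1 + n ^ 3))"
        unfolding norm_mult[of "3 * \<kappa>"] norm_mult[of 3] using \<kappa> b assms by (intro mult_mono) auto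
      then show "norm (3 * \<kappa> * (x t / s t + p * (y t / s t)\<^sup>2)) \<le> M2 * (1 + norm ((y t / s t) ^ 3))"
        by (simp add: M2_def n_def norm_power mult.assoc)
    qed
    then have "norm (y t / s t) \<le> 1 + exp (4 * M2)"
      using cube_estimates(1)[of "norm (y t / s t)"] by (simp add: norm_power)
    then have "C * (1 + norm (y t / s t)) \<le> S1" unfolding S1_def using C by (intro mult_left_mono) auto
    then have is1: "norm (1 / s t) \<le> S1" using isb[OF t] by linarith
    then have s1: "1 / S1 \<le> norm (s t)"
      using S1 sn[OF t] by (simp add: norm_divide field_simps)
    have gxy: "g t = (x t + y t) / 2" "1 / g t = (x t - y t) / 2" by (simp_all add: x_def y_def)
    have "norm (x t + y t) \<le> 2 * (1 + Y)" "norm (x t - y t) \<le> 2 * (1 + Y)"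
      using norm_triangle_ineq[of "x t" "y t"] norm_triangle_ineq4[of "x t" "y t"] xb'[OF t] yb[OF t] by simp_all
    then have "norm ((x t + y t) / 2) \<le> 1 + Y" "norm ((x t - y t) / 2) \<le> 1 + Y"
      by (simp_all add: norm_divide)
    then have gb: "norm (g t) \<le> 1 + Y" "norm (1 / g t) \<le> 1 + Y"
      using gxy by metis+
    then have "1 / (1 + Y) \<le> 1 / norm (1 / g t)"
      using gn(1)[OF t] Y by (intro divide_left_mono) auto
    then have gl: "1 / (1 + Y) \<le> norm (g t)" by (simp add: norm_divide)
    have iR: "1 / R \<le> 1 / (1 + Y)" using R Y by (intro divide_left_mono) auto
    have "1 / ((1 + Y) * S1) = 1 / (1 + Y) * (1 / S1)" by simp
    also have "\<dots> \<le> norm (g t) * norm (s t)" using gl s1 Y S1 by (intro mult_mono) auto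
    also have "\<dots> = norm ((g t - p) * (1 - p * g t))" unfolding gs[OF t] norm_mult ..
    finally have gsl: "1 / ((1 + Y) * S1) \<le> norm ((g t - p) * (1 - p * g t))" .
    have "1 / R \<le> 1 / ((1 + Y) * S1)" using R Y S1 by (intro divide_left_mono) auto
    moreover have "norm (3 * \<kappa> * x t * (s t)\<^sup>2) \<le> 3 * k * (2 + Y) * S\<^sup>2"
      unfolding norm_mult norm_power using \<kappa> xb'[OF t] sb'[OF t] assms Y by (intro mult_mono power_mono) auto
    moreover have "norm (\<kappa> * g t * (s t)\<^sup>2) \<le> k * (1 + Y) * S\<^sup>2"
      unfolding norm_mult norm_power using \<kappa> gb sb'[OF t] assms Y by (intro mult_mono power_mono) auto
    ultimately show "arc_bounds R l p (g t)"
      using R gb(1) gl iR gsl unfolding arc_bounds_def \<kappa>_def s_def x_def by linarith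
  qed
qed

text \<open>The velocity is not bounded near the zeros, but that of y^3 is. If y is small somewhere
  on a short time interval, it stays small, and \<open>g\<close> stays near one of the zeros; if it
  is small nowhere, the velocity of \<open>g\<close> is bounded by R / \<epsilon>^2.\<close>

lemma harc_equicontinuous:
  fixes R e :: real
  assumes "0 < R" "0 < e"
  obtains d where "0 < d"
    "\<And>l p g a b. \<lbrakk>harc l p 1 g; p \<noteq> 0; l \<noteq> 0; \<And>t. t \<in> {0..1} \<Longrightarrow> arc_bounds R l p (g t);
       0 \<le> a; a \<le> b; b \<le> 1; b - a < d\<rbrakk> \<Longrightarrow> norm (g a - g b) < e"
proof -
  \<comment> \<open>When |y| <= 2 \<epsilon>, the product of the distances to the zeros is at most 2
    \<epsilon> R. The bound 1 / (4 R) makes this less than 1, and e / (16 R) makes the final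
    distance 4 \<epsilon> R less than e.\<close>
  define \<epsilon> where "\<epsilon> = min (e / (16 * R)) (1 / (4 * R))"
  have \<epsilon>: "0 < \<epsilon>" "\<epsilon> \<le> e / (16 * R)" "\<epsilon> \<le> 1 / (4 * R)"
    unfolding \<epsilon>_def using assms by - (simp, rule min.cobounded1, rule min.cobounded2)
  then have \<epsilon>R: "\<epsilon> * R \<le> e / 16" "\<epsilon> * R \<le> 1 / 4" using assms(1) by (simp_all add: field_simps)
  \<comment> \<open>7 \<epsilon>^3 is (2 \<epsilon>)^3 - \<epsilon>^3, the change of y^3 that still
    keeps |y| below 2 \<epsilon>. The second bound limits the motion at speed R / \<epsilon>^2 to e
    / 2.\<close>
  define d where "d = min (7 * \<epsilon> ^ 3 / R) (e * \<epsilon>\<^sup>2 / (2 * R))"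
  have d: "0 < d" "d \<le> 7 * \<epsilon> ^ 3 / R" "d \<le> e * \<epsilon>\<^sup>2 / (2 * R)"
    unfolding d_def using assms \<epsilon>(1) by - (simp, rule min.cobounded1, rule min.cobounded2)
  show ?thesis
  proof (rule that[OF d(1)])
    fix l p :: complex and g :: "real \<Rightarrow> complex" and a b :: real
    assume hg: "harc l p 1 g" and p: "p \<noteq> 0" "l \<noteq> 0"
      and bounds: "\<And>t. t \<in> {0..1} \<Longrightarrow> arc_bounds R l p (g t)"
      and ab: "0 \<le> a" "a \<le> b" "b \<le> 1" "b - a < d"
    have gc: "continuous_on {0..1} g" using hg by (auto simp: harc_def path_def)
    have g0: "g t \<noteq> 0 \<and> norm (g t) \<le> R" if "t \<in> {0..1}" for t
    proof -
      have "0 < 1 / R" using assms(1) by simp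
      then show ?thesis using bounds[OF that] unfolding arc_bounds_def by (metis less_le_trans norm_zero less_irrefl)
    qed
    have bd: "norm (3 * (1 / (l * p\<^sup>2)) * (g t + 1 / g t) * (1 + p\<^sup>2 - p * (g t + 1 / g t))\<^sup>2) \<le> R
        \<and> norm ((1 / (l * p\<^sup>2)) * g t * (1 + p\<^sup>2 - p * (g t + 1 / g t))\<^sup>2) \<le> R" if "t \<in> {0<..<1}" for t
      using bounds[of t] that by (simp add: arc_bounds_def)
    define y where "y t = g t - 1 / g t" for t
    define x where "x t = g t + 1 / g t" for t
    define s where "s t = 1 + p\<^sup>2 - p * x t" for t
    define \<kappa> where "\<kappa> = 1 / (l * p\<^sup>2)"
    note jk = harc_cube_derivatives[OF hg p, folded x_def y_def \<kappa>_def, folded s_def]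
    note bd' = bd[folded x_def y_def \<kappa>_def, folded s_def]
    have cy: "continuous_on {0..1} y" unfolding y_def using g0 by (intro continuous_intros gc) auto
    have lip: "norm (y u ^ 3 - y v ^ 3) \<le> R * (u - v)" if "0 \<le> v" "v \<le> u" "u \<le> 1" for u v
    proof (rule vector_derivative_bound[OF that(2), of "\<lambda>t. y t ^ 3" "\<lambda>t. 3 * \<kappa> * x t * (s t)\<^sup>2"])
      show "continuous_on {v..u} (\<lambda>t. y t ^ 3)"
        using that by (intro continuous_intros continuous_on_subset[OF cy]) auto
    qed (use that jk(5) bd' in auto)
    show "norm (g a - g b) < e"
    proof (cases "\<exists>u\<in>{a..b}. norm (y u) \<le> \<epsilon>")
      case True
      then obtain u where u: "u \<in> {a..b}" "norm (y u) \<le> \<epsilon>" by blast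
      have yb: "norm (y t) \<le> 2 * \<epsilon>" if t: "t \<in> {a..b}" for t
      proof -
        have "norm (y t ^ 3 - y u ^ 3) \<le> R * \<bar>t - u\<bar>"
          using lip[of u t] lip[of t u] t u ab by (cases "t \<le> u") (auto simp: norm_minus_commute)
        also have "\<dots> \<le> R * (7 * \<epsilon> ^ 3 / R)"
          using t u ab d(2) assms(1) by (intro mult_left_mono) auto
        also have "\<dots> = 7 * \<epsilon> ^ 3" using assms(1) by simp
        finally have "norm (y t ^ 3 - y u ^ 3) \<le> 7 * \<epsilon> ^ 3" .
        moreover have "norm (y t ^ 3) \<le> norm (y t ^ 3 - y u ^ 3) + norm (y u ^ 3)"
          using norm_triangle_ineq[of "y t ^ 3 - y u ^ 3" "y u ^ 3"] by simp
        moreover have "norm (y u ^ 3) \<le> \<epsilon> ^ 3" unfolding norm_power using u(2) by (intro power_mono) auto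
        ultimately have "norm (y t) ^ 3 \<le> 8 * \<epsilon> ^ 3" unfolding norm_power by linarith
        then have "norm (y t) ^ 3 \<le> (2 * \<epsilon>) ^ 3" by (simp add: power_mult_distrib)
        then show ?thesis using \<epsilon>(1) by (intro power_le_imp_le_base[of "norm (y t)" 2]) (auto simp: numeral_3_eq_3)
      qed
      have prod: "norm (g t - 1) * norm (g t + 1) \<le> 2 * (\<epsilon> * R)" if t: "t \<in> {a..b}" for t
      proof -
        have t': "t \<in> {0..1}" using t ab by auto
        have "(g t - 1) * (g t + 1) = y t * g t"
          using g0[OF t'] by (simp add: y_def field_simps power2_eq_square)
        then have "norm (g t - 1) * norm (g t + 1) = norm (y t) * norm (g t)" by (metis norm_mult)
        also have "\<dots> \<le> 2 * \<epsilon> * R" using yb[OF t] g0[OF t'] \<epsilon>(1) by (intro mult_mono) auto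
        finally show ?thesis by simp
      qed
      \<comment> \<open>On the imaginary axis both distances are at least 1, contrary to their small
        product. So the real part keeps its sign and the whole segment stays near the same
        zero.\<close>
      have Re0: "Re (g t) \<noteq> 0" if t: "t \<in> {a..b}" for t
      proof
        assume "Re (g t) = 0"
        then have "1 \<le> norm (g t - 1)" "1 \<le> norm (g t + 1)"
          using abs_Re_le_cmod[of "g t - 1"] abs_Re_le_cmod[of "g t + 1"] by auto
        then have "1 * 1 \<le> norm (g t - 1) * norm (g t + 1)" by (intro mult_mono) auto
        then show False using prod[OF t] \<epsilon>R(2) by simp
      qed
      have cR: "continuous_on {a..b} (\<lambda>t. Re (g t))"
        using ab by (intro continuous_intros continuous_on_subset[OF gc]) auto
      have "connected ((\<lambda>t. Re (g t)) ` {a..b})" by (rule connected_continuous_image[OF cR]) simp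
      then have same: "\<not> (Re (g s) < 0 \<and> 0 < Re (g t))" if "s \<in> {a..b}" "t \<in> {a..b}" for s t
        using connectedD_interval[of "(\<lambda>t. Re (g t)) ` {a..b}" "Re (g s)" "Re (g t)" 0] Re0 that by force
      have abI: "a \<in> {a..b}" "b \<in> {a..b}" using ab by auto
      have pos: "norm (g t - 1) \<le> 2 * (\<epsilon> * R)" if t: "t \<in> {a..b}" "0 < Re (g t)" for t
      proof -
        have "1 \<le> norm (g t + 1)" using abs_Re_le_cmod[of "g t + 1"] t(2) by auto
        then have "norm (g t - 1) * 1 \<le> norm (g t - 1) * norm (g t + 1)" by (intro mult_left_mono) auto
        then show ?thesis using prod[OF t(1)] by simp
      qed
      have neg: "norm (g t + 1) \<le> 2 * (\<epsilon> * R)" if t: "t \<in> {a..b}" "Re (g t) < 0" for t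
      proof -
        have "1 \<le> norm (g t - 1)" using abs_Re_le_cmod[of "g t - 1"] t(2) by auto
        then have "1 * norm (g t + 1) \<le> norm (g t - 1) * norm (g t + 1)" by (intro mult_right_mono) auto
        then show ?thesis using prod[OF t(1)] by simp
      qed
      have "norm (g a - g b) \<le> 4 * (\<epsilon> * R)"
      proof (cases "0 < Re (g a)")
        case True
        then have "0 < Re (g b)" using same[OF abI(2,1)] Re0[OF abI(2)] by linarith
        then show ?thesis
          using pos[OF abI(1) True] pos[OF abI(2)] norm_triangle_ineq4[of "g a - 1" "g b - 1"] by simp
      next
        case False
        then have a: "Re (g a) < 0" using Re0[OF abI(1)] by linarith
        then have "Re (g b) < 0" using same[OF abI] Re0[OF abI(2)] by linarith
        then show ?thesis
          using neg[OF abI(1) a] neg[OF abI(2)] norm_triangle_ineq4[of "g a + 1" "g b + 1"] by simp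
      qed
      then show ?thesis using \<epsilon>R(1) assms(2) by linarith
    next
      case False
      have "norm (g b - g a) \<le> R / \<epsilon>\<^sup>2 * (b - a)"
      proof (rule vector_derivative_bound[OF ab(2)])
        show "continuous_on {a..b} g" using ab by (intro continuous_on_subset[OF gc]) auto
        fix t assume t: "t \<in> {a<..<b}"
        then have t': "t \<in> {0<..<1}" using ab by auto
        show "(g has_vector_derivative \<kappa> * g t * (s t)\<^sup>2 / (y t)\<^sup>2) (at t)" by (rule jk(4)[OF t'])
        have "t \<in> {a..b}" using t by simp
        then have "\<epsilon> \<le> norm (y t)" using False by (meson linear)
        then have "\<epsilon>\<^sup>2 \<le> norm (y t) ^ 2" using \<epsilon>(1) by (intro power_mono) auto
        moreover have "norm (\<kappa> * g t * (s t)\<^sup>2) \<le> R" using bd'[OF t'] by simp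
        ultimately show "norm (\<kappa> * g t * (s t)\<^sup>2 / (y t)\<^sup>2) \<le> R / \<epsilon>\<^sup>2"
          unfolding norm_divide norm_power using \<epsilon>(1) assms(1) by (intro frac_le) auto
      qed
      also have "\<dots> \<le> R / \<epsilon>\<^sup>2 * (e * \<epsilon>\<^sup>2 / (2 * R))"
        using ab d(3) assms(1) \<epsilon>(1) by (intro mult_left_mono) auto
      also have "\<dots> = e / 2" using assms(1) \<epsilon>(1) by simp
      finally show ?thesis using assms(2) by (simp add: norm_minus_commute)
    qed
  qed
qed

text \<open>In the reciprocal the poles of the form become zeros, so of all values of v only
  \<open>1\<close> and \<open>-1\<close> are excluded. At the poles this agrees with the value of
  \<open>1 / lform l p v\<close> under division by zero.\<close>

lemma inverse_lform_continuous:
  "continuous_on {(l, p, v). l * p * (v\<^sup>2 - 1) \<noteq> 0} (\<lambda>(l, p, v). v * (v - p)\<^sup>2 * (v - 1 / p)\<^sup>2 / (l * (v\<^sup>2 - 1)\<^sup>2) :: complex)"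
  unfolding case_prod_beta by (intro continuous_intros) auto

lemma inverse_lform: "1 / lform l p v = v * (v - p)\<^sup>2 * (v - 1 / p)\<^sup>2 / (l * (v\<^sup>2 - 1)\<^sup>2)"
  by (simp add: lform_def)

text \<open>Around a time at which the limit avoids the zeros, the velocities converge uniformly, so
  limit and derivative may be exchanged.\<close>

lemma limit_of_solutions:
  fixes G :: "nat \<Rightarrow> real \<Rightarrow> complex"
  assumes hg: "\<And>n. harc (L n) (P n) 1 (G n)" and lim: "L \<longlonglongrightarrow> l" "P \<longlonglongrightarrow> p" and lp: "l \<noteq> 0" "p \<noteq> 0"
    and unif: "uniform_limit {0..1} G g sequentially" and gc: "continuous_on {0..1} g"
    and t: "t \<in> {0<..<1}" "g t \<noteq> 1" "g t \<noteq> -1"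
  shows "(g has_vector_derivative 1 / lform l p (g t)) (at t)"
proof -
  define H where "H = (\<lambda>(l, p, v). v * (v - p)\<^sup>2 * (v - 1 / p)\<^sup>2 / (l * (v\<^sup>2 - 1)\<^sup>2) :: complex)"
  have HW: "1 / lform l p v = H (l, p, v)" for l p v by (simp add: H_def inverse_lform)
  define \<Omega> where "\<Omega> = {(l, p, v). l * p * (v\<^sup>2 - 1) \<noteq> (0 :: complex)}"
  have o\<Omega>: "open \<Omega>" unfolding \<Omega>_def case_prod_beta by (intro open_Collect_neq continuous_intros)
  have cg: "isCont g t" using gc t(1)
    by (metis continuous_on_eq_continuous_at continuous_on_subset
          greaterThanLessThan_subseteq_atLeastAtMost_iff open_greaterThanLessThan order_refl)
  have "(l, p, g t) \<in> \<Omega>" using lp t(2,3) by (auto simp: \<Omega>_def power2_eq_1_iff)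
  then obtain r where r: "r > 0" "cball (l, p, g t) r \<subseteq> \<Omega>" using o\<Omega> open_contains_cball by blast
  have "continuous_on (cball (l, p, g t) r) H"
    unfolding H_def by (rule continuous_on_subset[OF inverse_lform_continuous r(2)[unfolded \<Omega>_def]])
  then have uc: "uniformly_continuous_on (cball (l, p, g t) r) H"
    by (rule compact_uniformly_continuous) simp
  obtain \<tau> where \<tau>: "\<tau> > 0" "\<And>s. dist s t < \<tau> \<Longrightarrow> s \<in> {0<..<1} \<and> dist (g s) (g t) < r / 2"
  proof -
    have "eventually (\<lambda>s. dist (g s) (g t) < r / 2) (at t)"
      using tendstoD[of g "g t" "at t" "r / 2"] cg r(1) by (simp add: continuous_at)
    then have "eventually (\<lambda>s. dist (g s) (g t) < r / 2) (nhds t)"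
      unfolding eventually_nhds_conv_at using r(1) by simp
    moreover have "eventually (\<lambda>s. s \<in> {0<..<1}) (nhds t)"
      using t(1) by (intro eventually_nhds_in_open) auto
    ultimately have "eventually (\<lambda>s. s \<in> {0<..<1} \<and> dist (g s) (g t) < r / 2) (nhds t)"
      by eventually_elim auto
    then show ?thesis using that unfolding eventually_nhds_metric by blast
  qed
  let ?B = "ball t \<tau>"
  have key: "eventually (\<lambda>n. \<forall>s\<in>?B. norm (1 / lform (L n) (P n) (G n s) - 1 / lform l p (g s)) < e) sequentially" if e: "e > 0" for e
  proof -
    obtain \<delta> where \<delta>: "\<delta> > 0" "\<And>x y. \<lbrakk>x \<in> cball (l, p, g t) r; y \<in> cball (l, p, g t) r; dist x y < \<delta>\<rbrakk> \<Longrightarrow> dist (H x) (H y) < e"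
      using uc[unfolded uniformly_continuous_on_def, rule_format, OF e] by blast
    define \<mu> where "\<mu> = min (\<delta> / 3) (r / 6)"
    have \<mu>: "0 < \<mu>" "\<mu> \<le> \<delta> / 3" "\<mu> \<le> r / 6" using \<delta>(1) r(1) by (auto simp: \<mu>_def)
    have "eventually (\<lambda>n. dist (L n) l < \<mu>) sequentially" "eventually (\<lambda>n. dist (P n) p < \<mu>) sequentially"
      "eventually (\<lambda>n. \<forall>s\<in>{0..1}. dist (G n s) (g s) < \<mu>) sequentially"
      using lim \<mu>(1) unif by (auto simp: tendsto_iff uniform_limit_iff)
    then show ?thesis
    proof eventually_elim
      case (elim n)
      show ?case
      proof
        fix s assume s: "s \<in> ?B"
        then have s': "s \<in> {0..1}" "dist (g s) (g t) < r / 2" using \<tau>(2)[of s] by (auto simp: dist_commute)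
        have Gs: "dist (G n s) (g s) < \<mu>" using elim(3) s'(1) by blast
        have "dist (L n, P n, G n s) (l, p, g s) < \<delta>"
          using dist_triple_le[of "L n" "P n" "G n s" l p "g s"] elim Gs \<mu>(2) by linarith
        moreover have "(L n, P n, G n s) \<in> cball (l, p, g t) r"
        proof -
          have "dist (G n s) (g t) \<le> dist (G n s) (g s) + dist (g s) (g t)" by (rule dist_triangle)
          then have "dist (L n, P n, G n s) (l, p, g t) \<le> r"
            using dist_triple_le[of "L n" "P n" "G n s" l p "g t"] elim Gs \<mu>(3) s'(2) by linarith
          then show ?thesis by (simp add: dist_commute)
        qed
        moreover have "(l, p, g s) \<in> cball (l, p, g t) r"
          using dist_triple_le[of l p "g s" l p "g t"] s'(2) r(1) by (simp add: dist_commute)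
        ultimately have "dist (H (L n, P n, G n s)) (H (l, p, g s)) < e" by (intro \<delta>(2))
        then show "norm (1 / lform (L n) (P n) (G n s) - 1 / lform l p (g s)) < e"
          unfolding HW by (simp only: dist_norm)
      qed
    qed
  qed
  have "\<exists>h. \<forall>s\<in>?B. (\<lambda>n. G n s) \<longlonglongrightarrow> h s \<and> (h has_derivative (\<lambda>x. x *\<^sub>R (1 / lform l p (g s)))) (at s within ?B)"
  proof (rule has_derivative_sequence[of ?B G "\<lambda>n s x. x *\<^sub>R (1 / lform (L n) (P n) (G n s))" "\<lambda>s x. x *\<^sub>R (1 / lform l p (g s))" t "g t"])
    show "convex ?B" by simp
    show "t \<in> ?B" using \<tau>(1) by simp
    show "(G n has_derivative (\<lambda>x. x *\<^sub>R (1 / lform (L n) (P n) (G n s)))) (at s within ?B)" if "s \<in> ?B" for n s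
      using harc_regular(2)[OF hg, of s n] \<tau>(2)[of s] that
      by (auto simp: has_vector_derivative_def dist_commute intro: has_derivative_at_withinI)
    show "(\<lambda>n. G n t) \<longlonglongrightarrow> g t" by (rule tendsto_uniform_limitI[OF unif]) (use t(1) in auto)
    fix e :: real assume "e > 0"
    from key[OF this] show "eventually (\<lambda>n. \<forall>s\<in>?B. \<forall>h. norm (h *\<^sub>R (1 / lform (L n) (P n) (G n s)) - h *\<^sub>R (1 / lform l p (g s))) \<le> e * norm h) sequentially"
    proof eventually_elim
      case (elim n)
      show ?case
      proof (intro ballI allI)
        fix s h assume s: "s \<in> ?B"
        have "norm (h *\<^sub>R (1 / lform (L n) (P n) (G n s)) - h *\<^sub>R (1 / lform l p (g s))) = norm h * norm (1 / lform (L n) (P n) (G n s) - 1 / lform l p (g s))"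
          by (simp only: scaleR_diff_right[symmetric] norm_scaleR real_norm_def)
        also have "\<dots> \<le> norm h * e" using elim s by (intro mult_left_mono) (auto simp: less_imp_le)
        finally show "norm (h *\<^sub>R (1 / lform (L n) (P n) (G n s)) - h *\<^sub>R (1 / lform l p (g s))) \<le> e * norm h"
          by (simp add: mult.commute)
      qed
    qed
  qed
  then obtain h where h: "\<And>s. s \<in> ?B \<Longrightarrow> (\<lambda>n. G n s) \<longlonglongrightarrow> h s"
    "\<And>s. s \<in> ?B \<Longrightarrow> (h has_derivative (\<lambda>x. x *\<^sub>R (1 / lform l p (g s)))) (at s within ?B)" by blast
  have hgeq: "h s = g s" if "s \<in> ?B" for s
    using LIMSEQ_unique[OF h(1)[OF that] tendsto_uniform_limitI[OF unif]] \<tau>(2)[of s] that by (simp add: dist_commute)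
  have tB: "t \<in> ?B" using \<tau>(1) by simp
  have "(h has_vector_derivative 1 / lform l p (g t)) (at t)"
    using h(2)[OF tB] by (simp add: has_vector_derivative_def at_within_open[OF tB open_ball])
  then show ?thesis
    by (rule has_vector_derivative_transform_within_open[OF _ open_ball tB]) (use hgeq in simp)
qed

text \<open>Arzela and Ascoli give a limit curve from \<open>1\<close> to \<open>-1\<close> that
  satisfies the equation with unit rate wherever it is not at a zero. It may visit the zeros at
  interior times; the part between two suitable visits is an arc whose length is the time spent on
  it.\<close>

lemma harc_limit:
  assumes hg: "\<And>n. harc (L n) (P n) 1 (G n)" and lim: "L \<longlonglongrightarrow> l" "P \<longlonglongrightarrow> p"
    and lp: "l \<noteq> 0" "p \<noteq> 0" "p\<^sup>2 \<noteq> 1"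
  shows "\<exists>T g. T \<le> 1 \<and> harc l p T g"
proof -
  define B where "B = norm p + 1"
  define k where "k = norm (1 / (l * p\<^sup>2)) + 1"
  define \<beta> where "\<beta> = norm (1 - p\<^sup>2) / 2"
  have pos: "0 \<le> B" "0 \<le> k" "0 < \<beta>" using lp(3) by (auto simp: B_def k_def \<beta>_def)
  have lp2: "l * p\<^sup>2 \<noteq> 0" using lp by simp
  have "eventually (\<lambda>n. norm (P n) < B) sequentially"
    using order_tendstoD(2)[OF tendsto_norm[OF lim(2)], of B] by (simp add: B_def)
  moreover have "eventually (\<lambda>n. norm (1 / (L n * (P n)\<^sup>2)) < k) sequentially"
    by (rule order_tendstoD(2)[of _ "norm (1 / (l * p\<^sup>2))"]) (use lim lp2 in \<open>auto intro!: tendsto_intros simp: k_def\<close>)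
  moreover have "eventually (\<lambda>n. \<beta> < norm (1 - (P n)\<^sup>2)) sequentially"
    by (rule order_tendstoD(1)[of _ "norm (1 - p\<^sup>2)"]) (use lim lp(3) in \<open>auto intro!: tendsto_intros simp: \<beta>_def\<close>)
  moreover have "eventually (\<lambda>n. L n * (P n)\<^sup>2 \<noteq> 0) sequentially"
    by (rule tendsto_imp_eventually_ne[of _ "l * p\<^sup>2"]) (use lim lp2 in \<open>auto intro!: tendsto_intros\<close>)
  ultimately have "eventually (\<lambda>n. norm (P n) \<le> B \<and> norm (1 / (L n * (P n)\<^sup>2)) \<le> k \<and> \<beta> \<le> norm (1 - (P n)\<^sup>2) \<and> L n * (P n)\<^sup>2 \<noteq> 0) sequentially"
    by eventually_elim auto
  then obtain N where N: "\<And>n. n \<ge> N \<Longrightarrow> norm (P n) \<le> B \<and> norm (1 / (L n * (P n)\<^sup>2)) \<le> k \<and> \<beta> \<le> norm (1 - (P n)\<^sup>2) \<and> L n * (P n)\<^sup>2 \<noteq> 0"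
    unfolding eventually_sequentially by blast
  obtain R where R: "0 < R"
    and Rb: "\<And>l p g t. \<lbrakk>harc l p 1 g; p \<noteq> 0; p\<^sup>2 \<noteq> 1; l \<noteq> 0; norm p \<le> B; norm (1 / (l * p\<^sup>2)) \<le> k; \<beta> \<le> norm (1 - p\<^sup>2); t \<in> {0..1}\<rbrakk>
      \<Longrightarrow> arc_bounds R l p (g t)"
    using harc_uniform_bounds[OF pos] by metis
  \<comment> \<open>Dropping the first \<open>N\<close> terms makes the uniform bounds hold for
    every index.\<close>
  let ?G = "\<lambda>n. G (n + N)" let ?P = "\<lambda>n. P (n + N)" let ?L = "\<lambda>n. L (n + N)"
  have nz: "?P n \<noteq> 0" "?L n \<noteq> 0" "(?P n)\<^sup>2 \<noteq> 1" for n
    using N[of "n + N"] pos(3) by auto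
  have bnd: "arc_bounds R (?L n) (?P n) (?G n t)"
    if "t \<in> {0..1}" for n t
    by (rule Rb[OF hg nz(1,3,2) _ _ _ that]) (use N[of "n + N"] in simp_all)
  have equi: "\<exists>d>0. \<forall>n y. y \<in> {0..1} \<and> norm (x - y) < d \<longrightarrow> norm (?G n x - ?G n y) < e" if x: "x \<in> {0..1}" "0 < e" for x e
  proof -
    obtain d where d: "0 < d"
    "\<And>l p g a b. \<lbrakk>harc l p 1 g; p \<noteq> 0; l \<noteq> 0; \<And>t. t \<in> {0..1} \<Longrightarrow> arc_bounds R l p (g t);
       0 \<le> a; a \<le> b; b \<le> 1; b - a < d\<rbrakk> \<Longrightarrow> norm (g a - g b) < e"
      using harc_equicontinuous[OF R x(2)] by blast
    have *: "norm (?G n a - ?G n b) < e" if "0 \<le> a" "a \<le> b" "b \<le> 1" "b - a < d" for n a b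
      by (rule d(2)[OF hg nz(1,2) _ that]) (rule bnd)
    show ?thesis
    proof (intro exI[of _ d] conjI allI impI d(1))
      fix n y assume y: "y \<in> {0..1} \<and> norm (x - y) < d"
      show "norm (?G n x - ?G n y) < e"
        using *[of x y n] *[of y x n] x(1) y by (cases "x \<le> y") (auto simp: norm_minus_commute)
    qed
  qed
  obtain g \<sigma> where g: "continuous_on {0..1} g" "strict_mono (\<sigma> :: nat \<Rightarrow> nat)"
    "\<And>e. 0 < e \<Longrightarrow> \<exists>M. \<forall>n x. n \<ge> M \<and> x \<in> {0..1} \<longrightarrow> norm (?G (\<sigma> n) x - g x) < e"
  proof (rule Arzela_Ascoli[of "{0..1::real}" ?G R])
    show "norm (?G n x) \<le> R" if "x \<in> {0..1}" for n x using bnd[OF that] by (simp add: arc_bounds_def)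
  qed (use equi in auto)
  let ?H = "\<lambda>n. ?G (\<sigma> n)"
  have unif: "uniform_limit {0..1} ?H g sequentially"
    unfolding uniform_limit_iff eventually_sequentially dist_norm using g(3) by blast
  have pt: "(\<lambda>n. ?H n t) \<longlonglongrightarrow> g t" if "t \<in> {0..1}" for t by (rule tendsto_uniform_limitI[OF unif that])
  have limP: "(\<lambda>n. ?P (\<sigma> n)) \<longlonglongrightarrow> p" "(\<lambda>n. ?L (\<sigma> n)) \<longlonglongrightarrow> l"
    using LIMSEQ_subseq_LIMSEQ[OF LIMSEQ_ignore_initial_segment[OF lim(2), of N] g(2)]
      LIMSEQ_subseq_LIMSEQ[OF LIMSEQ_ignore_initial_segment[OF lim(1), of N] g(2)] by (simp_all add: o_def)
  have g01: "g 0 = 1" "g 1 = -1"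
  proof -
    have "?H n 0 = 1" "?H n 1 = -1" for n using hg by (auto simp: harc_def pathstart_def pathfinish_def)
    then show "g 0 = 1" "g 1 = -1" using LIMSEQ_unique[OF pt[of 0]] LIMSEQ_unique[OF pt[of 1]] by auto
  qed
  have av: "g t \<noteq> 0" "g t \<noteq> p" "g t \<noteq> 1 / p" if t: "t \<in> {0..1}" for t
  proof -
    have "1 / R \<le> norm (g t)"
      by (rule LIMSEQ_le_const[OF tendsto_norm[OF pt[OF t]]]) (use bnd[OF t] in \<open>auto simp: arc_bounds_def\<close>)
    then show "g t \<noteq> 0" using R by auto
    have "(\<lambda>n. norm ((?H n t - ?P (\<sigma> n)) * (1 - ?P (\<sigma> n) * ?H n t))) \<longlonglongrightarrow> norm ((g t - p) * (1 - p * g t))"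
      by (intro tendsto_intros pt[OF t] limP)
    then have "1 / R \<le> norm ((g t - p) * (1 - p * g t))"
      by (rule LIMSEQ_le_const) (use bnd[OF t] in \<open>auto simp: arc_bounds_def\<close>)
    then have "(g t - p) * (1 - p * g t) \<noteq> 0" using R by auto
    then show "g t \<noteq> p" "g t \<noteq> 1 / p" using lp(2) by auto
  qed
  have ode: "(g has_vector_derivative 1 / lform l p (g t)) (at t)" if "t \<in> {0<..<1}" "g t \<noteq> 1" "g t \<noteq> -1" for t
    by (rule limit_of_solutions[OF hg limP(2,1) lp(1,2) unif g(1) that])
  \<comment> \<open>The first visit to \<open>-1\<close>, and below the last visit to
    \<open>1\<close> before it. Strictly between these times no zero is met.\<close>
  define t1 where "t1 = Inf {t \<in> {0..1}. g t = -1}"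
  have "closed {t \<in> {0..1}. g t = -1}" using continuous_closed_preimage_constant[OF g(1)] by simp
  moreover have "bdd_below {t \<in> {0..1}. g t = -1}" by (rule bdd_belowI[of _ 0]) auto
  moreover have "{t \<in> {0..1}. g t = -1} \<noteq> {}" using g01 by auto
  ultimately have t1: "t1 \<in> {0..1}" "g t1 = -1" and t1min: "\<And>t. t \<in> {0..1} \<Longrightarrow> g t = -1 \<Longrightarrow> t1 \<le> t"
    using closed_contains_Inf[of "{t \<in> {0..1}. g t = -1}"] cInf_lower[of _ "{t \<in> {0..1}. g t = -1}"]
    unfolding t1_def by auto
  define t0 where "t0 = Sup {t \<in> {0..t1}. g t = 1}"
  have "continuous_on {0..t1} g" by (rule continuous_on_subset[OF g(1)]) (use t1 in auto)
  then have "closed {t \<in> {0..t1}. g t = 1}" using continuous_closed_preimage_constant[of "{0..t1}" g] by simp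
  moreover have "bdd_above {t \<in> {0..t1}. g t = 1}" by (rule bdd_aboveI[of _ t1]) auto
  moreover have "{t \<in> {0..t1}. g t = 1} \<noteq> {}" using g01 t1 by auto
  ultimately have t0: "t0 \<in> {0..t1}" "g t0 = 1" and t0max: "\<And>t. t \<in> {0..t1} \<Longrightarrow> g t = 1 \<Longrightarrow> t \<le> t0"
    using closed_contains_Sup[of "{t \<in> {0..t1}. g t = 1}"] cSup_upper[of _ "{t \<in> {0..t1}. g t = 1}"]
    unfolding t0_def by auto
  define T where "T = t1 - t0"
  have "t0 \<noteq> t1" using t0 t1 by auto
  then have T: "0 < T" "T \<le> 1" using t0 t1 by (auto simp: T_def)
  have seg: "t0 + T * u \<in> {0..1}" if "u \<in> {0..1}" for u
  proof -
    have "T * u \<le> T * 1" "0 \<le> T * u" using that T(1) by (auto intro!: mult_left_mono simp del: mult_1_right)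
    then show ?thesis using t0 t1 by (auto simp: T_def)
  qed
  have "harc l p T (\<lambda>u. g (t0 + T * u))"
    unfolding harc_def
  proof (intro conjI ballI T(1))
    show "path (\<lambda>u. g (t0 + T * u))"
      unfolding path_def by (rule continuous_on_compose2[OF g(1)]) (use seg in \<open>auto intro!: continuous_intros\<close>)
    show "pathstart (\<lambda>u. g (t0 + T * u)) = 1" "pathfinish (\<lambda>u. g (t0 + T * u)) = -1"
      using t0(2) t1(2) by (simp_all add: pathstart_def pathfinish_def T_def)
    fix u :: real assume u: "u \<in> {0<..<1}"
    let ?t = "t0 + T * u"
    have "0 < T * u" "T * u < T" using u T(1) by auto
    then have tt: "t0 < ?t" "?t < t1" by (auto simp: T_def)
    then have t: "?t \<in> {0<..<1}" "?t \<in> {0..1}" "?t \<in> {0..t1}" using t0 t1 by auto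
    have ne: "g ?t \<noteq> 1" "g ?t \<noteq> -1" using t0max[OF t(3)] t1min[OF t(2)] tt by auto
    then show "g ?t \<notin> {0, 1, -1, p, 1 / p}" using av[OF t(2)] by simp
    have "((\<lambda>u. t0 + T * u) has_vector_derivative T) (at u)"
      by (auto intro!: derivative_eq_intros)
    from vector_diff_chain_at[OF this ode[OF t(1) ne]]
    show "((\<lambda>u. g (t0 + T * u)) has_vector_derivative of_real T / lform l p (g ?t)) (at u)"
      by (simp add: o_def scaleR_conv_of_real)
  qed
  then show ?thesis using T(2) by blast
qed

section \<open>Existence by deformation\<close>

text \<open>The coefficient for which half the sum of the periods around \<open>0\<close> and \<open>p\<close> is 1.\<close>

definition unit_coeff :: "complex \<Rightarrow> complex" where
  "unit_coeff p = - \<i> * (p\<^sup>2 - 1) / (2 * of_real pi * p\<^sup>2)"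

lemma one_plus_res_ratio: "p\<^sup>2 \<noteq> 1 \<Longrightarrow> 1 + res_ratio p = 2 * p\<^sup>2 / (p\<^sup>2 - 1)"
  by (simp add: res_ratio_def field_simps)

lemma unit_coeff_total:
  assumes "p \<noteq> 0" "p\<^sup>2 \<noteq> 1"
  shows "of_real pi * \<i> * unit_coeff p * (1 + res_ratio p) = 1" "unit_coeff p \<noteq> 0"
proof -
  have n: "p\<^sup>2 - 1 \<noteq> 0" using assms by simp
  show "of_real pi * \<i> * unit_coeff p * (1 + res_ratio p) = 1"
  proof -
    have "of_real pi * \<i> * (- \<i> * D / (2 * of_real pi * E)) * (2 * E / D) = 1" if "D \<noteq> 0" "E \<noteq> 0" for D E :: complex
      using that by (simp add: field_simps)
    from this[OF n, of "p\<^sup>2"] show ?thesis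
      unfolding one_plus_res_ratio[OF assms(2)] unit_coeff_def using assms(1) by simp
  qed
  show "unit_coeff p \<noteq> 0" using assms(1) n by (simp add: unit_coeff_def)
qed

text \<open>With r = \<open>res_ratio p\<close>, length 1 means m + n r = 1 + r for two signs m and
  n. As r is neither 0 (p^2 is not -1) nor -1 (p is not 0), both signs are 1.\<close>

lemma harc_unit_windings:
  assumes hg: "harc (unit_coeff p) p 1 g" and p: "p \<noteq> 0" "p\<^sup>2 \<noteq> 1" "p\<^sup>2 \<noteq> -1"
  shows "2 * winding_number g 0 = 1" "2 * (winding_number g p - winding_number g (1 / p)) = 1"
proof -
  note u = unit_coeff_total[OF p(1,2)]
  define m where "m = 2 * winding_number g 0"
  define n where "n = 2 * (winding_number g p - winding_number g (1 / p))"
  have mn: "m \<in> {1, -1}" "n \<in> {1, -1}" using harc_windings[OF hg p(1,2) u(2)] by (simp_all add: m_def n_def)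
  have "1 = of_real pi * \<i> * unit_coeff p * (m + res_ratio p * n)"
    using harc_length_formula[OF hg p(1,2) u(2)] by (simp add: m_def n_def algebra_simps)
  then have "of_real pi * \<i> * unit_coeff p * (m + res_ratio p * n) = of_real pi * \<i> * unit_coeff p * (1 + res_ratio p)"
    using u(1) by simp
  then have e: "m + res_ratio p * n = 1 + res_ratio p" using u(2) by simp
  have r0: "res_ratio p \<noteq> 0" using p by (simp add: res_ratio_def add_eq_0_iff2)
  have r1: "1 + res_ratio p \<noteq> 0" unfolding one_plus_res_ratio[OF p(2)] using p by simp
  have "m = 1 \<and> n = 1"
  proof -
    consider "m = 1" "n = 1" | "m = 1" "n = -1" | "m = -1" "n = 1" | "m = -1" "n = -1" using mn by auto
    then show ?thesis
    proof cases
      case 2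
      then have "2 * res_ratio p = 0" using e by (simp add: algebra_simps)
      then show ?thesis using r0 by simp
    next
      case 3 then show ?thesis using e by simp
    next
      case 4
      then have "2 * (1 + res_ratio p) = 0" using e by (simp add: algebra_simps)
      then show ?thesis using r1 by (metis mult_eq_0_iff zero_neq_numeral)
    qed simp
  qed
  then show "2 * winding_number g 0 = 1" "2 * (winding_number g p - winding_number g (1 / p)) = 1"
    by (simp_all add: m_def n_def)
qed

text \<open>As \<open>p\<close> moves a little, the doubled difference of winding numbers of the old
  arc about \<open>p\<close> and \<open>1 / p\<close> stays an odd integer at distance less than 1
  from 1, hence equal to 1. The coefficient \<open>unit_coeff p\<close> then keeps the integral
  along the old arc equal to 1, as \<open>harc_perturb\<close> demands.\<close>

lemma harc_unit_open:
  assumes hg: "harc (unit_coeff p0) p0 1 g" and p0: "p0 \<noteq> 0" "p0\<^sup>2 \<noteq> 1" "p0\<^sup>2 \<noteq> -1"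
  shows "\<exists>\<epsilon>>0. \<forall>p. dist p p0 < \<epsilon> \<longrightarrow> (\<exists>h. harc (unit_coeff p) p 1 h)"
proof -
  have gp: "path g" "pathstart g = 1" "pathfinish g = -1" using hg by (auto simp: harc_def)
  note av = harc_avoids[OF hg p0(1,2)]
  obtain \<epsilon> where \<epsilon>: "\<epsilon> > 0" "\<And>l p. \<lbrakk>dist l (unit_coeff p0) < \<epsilon>; dist p p0 < \<epsilon>;
      2 * of_real pi * \<i> * l * (winding_number g 0 + res_ratio p * (winding_number g p - winding_number g (1 / p))) = 1\<rbrakk>
      \<Longrightarrow> \<exists>h. harc l p 1 h"
    using harc_perturb[OF hg p0(1,2) unit_coeff_total(2)[OF p0(1,2)]] by blast
  define N where "N p = 2 * (winding_number g p - winding_number g (1 / p))" for p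
  have "((\<lambda>p. winding_number g p) \<longlongrightarrow> winding_number g p0) (at p0)"
    using continuous_at_winding_number[OF gp(1) av(2)] by (simp add: continuous_at)
  moreover have "((\<lambda>p. winding_number g (1 / p)) \<longlongrightarrow> winding_number g (1 / p0)) (at p0)"
  proof (rule isCont_tendsto_compose[OF continuous_at_winding_number[OF gp(1) av(3)]])
    show "((\<lambda>p. 1 / p) \<longlongrightarrow> 1 / p0) (at p0)" using p0(1) by (intro tendsto_intros)
  qed
  ultimately have "(N \<longlongrightarrow> N p0) (at p0)" unfolding N_def by (intro tendsto_intros)
  then have "eventually (\<lambda>p. dist (N p) 1 < 1) (at p0)"
    using harc_unit_windings(2)[OF hg p0] unfolding tendsto_iff N_def by simp
  then have evN: "eventually (\<lambda>p. dist (N p) 1 < 1) (nhds p0)"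
    unfolding eventually_nhds_conv_at using harc_unit_windings(2)[OF hg p0] by (simp add: N_def)
  have cl: "open (- path_image g)" using closed_path_image[OF gp(1)] by blast
  have ev1: "eventually (\<lambda>p. p \<in> - path_image g) (nhds p0)" using av(2) cl by (intro eventually_nhds_in_open) auto
  have i0: "((\<lambda>p. 1 / p) \<longlongrightarrow> 1 / p0) (nhds p0)"
    using p0(1) by (auto simp: tendsto_nhds_iff intro!: tendsto_intros)
  have ev2: "eventually (\<lambda>p. 1 / p \<in> - path_image g) (nhds p0)"
    by (rule topological_tendstoD[OF i0 cl]) (use av(3) in simp)
  have u0: "(unit_coeff \<longlongrightarrow> unit_coeff p0) (nhds p0)"
    unfolding unit_coeff_def using p0(1) by (auto simp: tendsto_nhds_iff intro!: tendsto_intros)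
  have ev3: "eventually (\<lambda>p. dist (unit_coeff p) (unit_coeff p0) < \<epsilon>) (nhds p0)"
    by (rule tendstoD[OF u0 \<epsilon>(1)])
  have ev4: "eventually (\<lambda>p. dist p p0 < \<epsilon>) (nhds p0)"
    unfolding eventually_nhds_metric using \<epsilon>(1) by blast
  have ev5: "eventually (\<lambda>p. p \<in> {p. p \<noteq> 0 \<and> p\<^sup>2 \<noteq> 1}) (nhds p0)"
    using p0 by (intro eventually_nhds_in_open open_Collect_conj open_Collect_neq continuous_intros) auto
  have "eventually (\<lambda>p. \<exists>h. harc (unit_coeff p) p 1 h) (nhds p0)"
    using evN ev1 ev2 ev3 ev4 ev5
  proof eventually_elim
    case (elim p)
    then have pn: "p \<noteq> 0" "p\<^sup>2 \<noteq> 1" by auto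
    obtain m n :: int where mn: "2 * winding_number g 0 = of_int m" "odd m"
      "2 * (winding_number g p - winding_number g (1 / p)) = of_int n" "odd n"
      using winding_numbers_odd[OF gp av(1) _ _ pn(1)] elim(2,3) by blast
    have "N p = of_int n" using mn(3) by (simp add: N_def)
    then have "norm (complex_of_int (n - 1)) < 1" using elim(1) by (simp add: dist_norm)
    then have "\<bar>real_of_int (n - 1)\<bar> < 1" by (simp only: norm_of_int)
    then have "n = 1" by linarith
    then have w: "winding_number g p - winding_number g (1 / p) = 1 / 2" "winding_number g 0 = 1 / 2"
      using mn(3) harc_unit_windings(1)[OF hg p0] by (simp_all add: field_simps)
    have "2 * of_real pi * \<i> * unit_coeff p * (1 / 2 + res_ratio p * (1 / 2)) = of_real pi * \<i> * unit_coeff p * (1 + res_ratio p)"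
      by (simp add: field_simps)
    then have "2 * of_real pi * \<i> * unit_coeff p * (winding_number g 0 + res_ratio p * (winding_number g p - winding_number g (1 / p))) = 1"
      unfolding w unit_coeff_total(1)[OF pn] .
    then show ?case by (rule \<epsilon>(2)[OF elim(4,5)])
  qed
  then show ?thesis unfolding eventually_nhds_metric by blast
qed

text \<open>For this coefficient the four sign choices give 1, -1, 1 / p^2 and - 1 / p^2. The value
  -1 is excluded because a length is positive.\<close>

lemma harc_unit_length:
  assumes hg: "harc (unit_coeff p) p T g" and p: "p \<noteq> 0" "p\<^sup>2 \<noteq> 1"
  shows "T = 1 \<or> of_real T = 1 / p\<^sup>2 \<or> of_real T = - 1 / p\<^sup>2"
proof -
  note u = unit_coeff_total[OF p]
  define m where "m = 2 * winding_number g 0"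
  define n where "n = 2 * (winding_number g p - winding_number g (1 / p))"
  have mn: "m \<in> {1, -1}" "n \<in> {1, -1}" using harc_windings[OF hg p u(2)] by (simp_all add: m_def n_def)
  have T: "of_real T = of_real pi * \<i> * unit_coeff p * (m + res_ratio p * n)"
    using harc_length_formula[OF hg p u(2)] by (simp add: m_def n_def algebra_simps)
  have T0: "0 < T" using hg by (simp add: harc_def)
  have r: "1 - res_ratio p = - 2 / (p\<^sup>2 - 1)" using p(2) by (simp add: res_ratio_def field_simps)
  have "of_real pi * \<i> * (- \<i> * D / (2 * of_real pi * E)) * (- 2 / D) = - 1 / E" if "D \<noteq> 0" "E \<noteq> 0" for D E :: complex
    using that by (simp add: field_simps)
  from this[of "p\<^sup>2 - 1" "p\<^sup>2"] have v: "of_real pi * \<i> * unit_coeff p * (1 - res_ratio p) = - 1 / p\<^sup>2"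
    unfolding r unit_coeff_def using p by simp
  consider "m = 1" "n = 1" | "m = 1" "n = -1" | "m = -1" "n = 1" | "m = -1" "n = -1" using mn by auto
  then show ?thesis
  proof cases
    case 1
    then have "complex_of_real T = 1" using T u(1) by simp
    then show ?thesis by simp
  next
    case 2 then show ?thesis using T v by simp
  next
    case 3
    then have "complex_of_real T = - (of_real pi * \<i> * unit_coeff p * (1 - res_ratio p))" using T by (simp add: algebra_simps)
    then show ?thesis unfolding v by simp
  next
    case 4
    then have "complex_of_real T = - (of_real pi * \<i> * unit_coeff p * (1 + res_ratio p))" using T by (simp add: algebra_simps)
    then have "complex_of_real T = complex_of_real (-1)" unfolding u(1) by simp
    then show ?thesis using T0 by (simp only: of_real_eq_iff)
  qed
qed

text \<open>On the unit circle v + 1 / v = 2 cos \<theta>, v - 1 / v = 2 i sin \<theta> and dv / v =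
  i d\<theta>, so an imaginary coefficient makes the form real. The sign \<open>\<sigma>\<close>
  selects the upper or lower half so that it becomes positive, and |P| > 2 keeps the poles off the
  circle. In the length bound \<open>c\<close> stands for cos \<theta>.\<close>

lemma harc_semicircle:
  fixes k P :: real and p :: complex
  assumes "p \<noteq> 0" "p\<^sup>2 \<noteq> 1" "p + 1 / p = of_real P" "2 < \<bar>P\<bar>" "k \<noteq> 0"
  obtains T g where "harc (\<i> * of_real k) p T g"
    "\<And>M. (\<And>c. \<bar>c\<bar> \<le> 1 \<Longrightarrow> 4 * pi * \<bar>k\<bar> * (1 - c\<^sup>2) / (2 * c - P)\<^sup>2 \<le> M) \<Longrightarrow> T \<le> M"
proof -
  define \<sigma> where "\<sigma> = (if 0 < k then 1 else -1 :: real)"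
  have \<sigma>: "\<sigma>\<^sup>2 = 1" "\<sigma> * k = \<bar>k\<bar>" "\<sigma> \<noteq> 0" "\<sigma> = 1 \<or> \<sigma> = -1" using assms(5) by (auto simp: \<sigma>_def)
  define \<theta> where "\<theta> t = \<sigma> * pi * t" for t
  define g where "g t = cis (\<theta> t)" for t
  define g' where "g' t = of_real (\<sigma> * pi) * (\<i> * g t)" for t
  define q where "q t = 4 * pi * \<bar>k\<bar> * (sin (\<theta> t))\<^sup>2 / (2 * cos (\<theta> t) - P)\<^sup>2" for t
  have "(g has_vector_derivative g' t) (at t)" for t
  proof -
    have "((\<lambda>z. exp (\<i> * z)) has_field_derivative \<i> * exp (\<i> * of_real (\<theta> t))) (at (of_real (\<theta> t)))"
      by (auto intro!: derivative_eq_intros)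
    moreover have "((\<lambda>t. complex_of_real (\<theta> t)) has_vector_derivative of_real (\<sigma> * pi)) (at t)"
      unfolding \<theta>_def by (auto intro!: derivative_eq_intros)
    ultimately show ?thesis
      using has_vector_derivative_compose_field[of "\<lambda>t. complex_of_real (\<theta> t)"]
      by (simp add: g_def[abs_def] g'_def cis_conv_exp)
  qed
  note dg = this
  have sn: "sin (\<theta> t) \<noteq> 0" if "t \<in> {0<..<1}" for t
  proof -
    have "0 < sin (pi * t)" using that by (intro sin_gt_zero) auto
    then show ?thesis using \<sigma>(4) by (auto simp: \<theta>_def)
  qed
  have den: "2 * cos (\<theta> t) - P \<noteq> 0" for t using assms(4) abs_cos_le_one[of "\<theta> t"] by (intro notI) linarith
  have g0: "g t \<noteq> 0" for t by (simp add: g_def)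
  have gg: "g t + 1 / g t = of_real (2 * cos (\<theta> t))" "g t - 1 / g t = \<i> * of_real (2 * sin (\<theta> t))" for t
    by (auto simp: g_def complex_eq_iff cis_inverse divide_inverse)
  have f1: "(g t)\<^sup>2 - 1 = g t * (\<i> * of_real (2 * sin (\<theta> t)))" for t
    unfolding gg(2)[symmetric] using g0[of t] by (simp add: field_simps power2_eq_square)
  have f2: "(g t - p) * (g t - 1 / p) = g t * of_real (2 * cos (\<theta> t) - P)" for t
  proof -
    have "(g t - p) * (g t - 1 / p) = g t * ((g t + 1 / g t) - (p + 1 / p))"
      using g0[of t] assms(1) by (simp add: field_simps)
    then show ?thesis unfolding gg(1) assms(3) by simp
  qed
  have reg: "g t \<notin> {0, 1, -1, p, 1 / p}" if "t \<in> {0<..<1}" for t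
  proof -
    have "(g t)\<^sup>2 - 1 \<noteq> 0" unfolding f1 using g0[of t] sn[OF that] by simp
    then have "g t \<noteq> 1" "g t \<noteq> -1" by (auto simp: power2_eq_square)
    moreover have "(g t - p) * (g t - 1 / p) \<noteq> 0" unfolding f2 using g0[of t] den[of t] by (simp del: of_real_diff)
    ultimately show ?thesis using g0[of t] by auto
  qed
  have pos: "lform (\<i> * of_real k) p (g t) * g' t = of_real (q t) \<and> 0 < q t" if t: "t \<in> {0<..<1}" for t
  proof
    show "0 < q t" unfolding q_def using assms(5) sn[OF t] den[of t] by simp
    have "lform (\<i> * of_real k) p (g t) * g' t = \<i> * of_real k * ((g t)\<^sup>2 - 1)\<^sup>2 / (g t * ((g t - p) * (g t - 1 / p))\<^sup>2) * g' t"
      by (simp add: lform_def power_mult_distrib mult.assoc)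
    also have "\<dots> = \<i> * of_real k * (g t * (\<i> * of_real (2 * sin (\<theta> t))))\<^sup>2 / (g t * (g t * of_real (2 * cos (\<theta> t) - P))\<^sup>2) * (of_real (\<sigma> * pi) * (\<i> * g t))"
      unfolding f1 f2 g'_def ..
    also have "\<dots> = (\<i> * \<i>) * (\<i> * \<i>) * of_real (\<sigma> * k) * of_real pi * (of_real (2 * sin (\<theta> t)))\<^sup>2 / (of_real (2 * cos (\<theta> t) - P))\<^sup>2"
      using g0[of t] den[of t] by (simp add: power_mult_distrib power2_eq_square field_simps del: of_real_diff i_squared)
    also have "\<dots> = of_real (q t)" by (simp add: \<sigma>(2) q_def power_mult_distrib)
    finally show "lform (\<i> * of_real k) p (g t) * g' t = of_real (q t)" .
  qed
  have "path g" unfolding path_def g_def \<theta>_def by (intro continuous_intros)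
  moreover have "pathstart g = 1" "pathfinish g = -1"
    using \<sigma>(4) by (auto simp: pathstart_def pathfinish_def g_def \<theta>_def complex_eq_iff)
  ultimately obtain T h where h: "harc (\<i> * of_real k) p T h" "\<And>M. (\<And>t. t \<in> {0<..<1} \<Longrightarrow> q t \<le> M) \<Longrightarrow> T \<le> M"
    using harc_reparametrize[of g p g' "\<i> * of_real k" q] assms(1,2) reg dg pos by metis
  have "T \<le> M" if M: "\<And>c. \<bar>c\<bar> \<le> 1 \<Longrightarrow> 4 * pi * \<bar>k\<bar> * (1 - c\<^sup>2) / (2 * c - P)\<^sup>2 \<le> M" for M
  proof (rule h(2))
    show "q t \<le> M" for t
      using M[of "cos (\<theta> t)"] by (simp add: q_def sin_squared_eq)
  qed
  with h(1) show ?thesis by (rule that)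
qed


text \<open>Together with rescaling by positive factors this covers all nonzero real multiples of a
  coefficient.\<close>

lemma harc_inverse:
  assumes hg: "harc l p T g" and p: "p \<noteq> 0" "p\<^sup>2 \<noteq> 1"
  shows "harc (- l) p T (\<lambda>t. 1 / g t)"
  unfolding harc_def
proof (intro conjI ballI)
  have gp: "path g" "g 0 = 1" "g 1 = -1" "0 < T" using hg by (auto simp: harc_def pathstart_def pathfinish_def)
  have nz: "g t \<noteq> 0" if "t \<in> {0..1}" for t
    using harc_avoids(1)[OF hg p] that unfolding path_image_def by (metis imageI)
  show "path (\<lambda>t. 1 / g t)" using gp(1) nz unfolding path_def by (intro continuous_intros) auto
  show "pathstart (\<lambda>t. 1 / g t) = 1" "pathfinish (\<lambda>t. 1 / g t) = -1" "0 < T"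
    using gp by (auto simp: pathstart_def pathfinish_def)
  fix t :: real assume t: "t \<in> {0<..<1}"
  show "1 / g t \<notin> {0, 1, -1, p, 1 / p}"
    by (rule ComplD[OF regular_inverse[OF harc_regular(1)[OF hg t]]])
  have g0: "g t \<noteq> 0" using nz t by auto
  have "((\<lambda>v. 1 / v) has_field_derivative - (1 / (g t)\<^sup>2)) (at (g t))"
    using g0 by (auto intro!: derivative_eq_intros simp: power2_eq_square)
  from has_vector_derivative_compose_field[OF harc_regular(2)[OF hg t] this]
  have "((\<lambda>t. 1 / g t) has_vector_derivative of_real T / lform l p (g t) * - (1 / (g t)\<^sup>2)) (at t)" .
  moreover have "of_real T / lform l p (g t) * - (1 / (g t)\<^sup>2) = of_real T / lform (- l) p (1 / g t)"
    unfolding lform_inverse[OF g0 p(1)] using lform_scale[of "-1" l p "g t"] by (simp add: mult.commute)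
  ultimately show "((\<lambda>t. 1 / g t) has_vector_derivative of_real T / lform (- l) p (1 / g t)) (at t)" by metis
qed

lemma harc_scale:
  assumes hg: "harc l p T g" and p: "p \<noteq> 0" "p\<^sup>2 \<noteq> 1" and c: "c \<noteq> (0 :: real)"
  shows "\<exists>T h. harc (of_real c * l) p T h"
proof -
  have pos: "harc (of_real d * l) p (d * T) g" if "harc l p T g" "0 < d" for d l g
    using that by (auto simp: harc_def lform_scale)
  show ?thesis
  proof (cases "0 < c")
    case True
    then show ?thesis using pos[OF hg] by blast
  next
    case False
    then have "harc (of_real (- c) * (- l)) p (- c * T) (\<lambda>t. 1 / g t)"
      using pos[OF harc_inverse[OF hg p], of "- c"] c by simp
    then show ?thesis by auto
  qed
qed

lemma harc_unit_length_one:
  assumes hg: "harc (unit_coeff p) p T g" and p: "Re p \<noteq> 0" "Im p \<noteq> 0"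
  shows "T = 1"
proof -
  have im: "Im (p\<^sup>2) \<noteq> 0" using p by (simp add: power2_eq_square)
  then have p': "p \<noteq> 0" "p\<^sup>2 \<noteq> 1" by auto
  have "False" if "of_real T = s / p\<^sup>2" "s \<in> {1, -1}" for s
  proof -
    have "p\<^sup>2 * of_real T = s" using that(1) p'(1) by simp
    moreover have "Im (q * of_real T) = Im q * T" for q by simp
    ultimately have "Im (p\<^sup>2) * T = Im s" by metis
    then show False using im that hg by (auto simp: harc_def)
  qed
  then show ?thesis using harc_unit_length[OF hg p'] by blast
qed

text \<open>At p = 1/3 and p = -1/3 the coefficient is 4 i / pi and the possible lengths are 1, 9
  and -9. Hence any bound below 9 on the length of the semicircle shows that it is 1.\<close>

lemma harc_unit_seed:
  fixes s :: real
  assumes "s \<in> {1, -1}"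
  shows "\<exists>g. harc (unit_coeff (of_real (s / 3))) (of_real (s / 3)) 1 g"
proof -
  define p :: complex where "p = of_real (s / 3)"
  have s2: "s\<^sup>2 = 1" using assms by auto
  have p2: "p\<^sup>2 = 1 / 9" using s2 unfolding p_def by (simp add: power_divide flip: of_real_power)
  have p: "p \<noteq> 0" "p\<^sup>2 \<noteq> 1" using p2 by auto
  have k: "unit_coeff p = \<i> * of_real (4 / pi)"
    unfolding unit_coeff_def p2 by (simp add: field_simps)
  have P: "p + 1 / p = of_real (s * 10 / 3)" using assms by (auto simp: p_def)
  obtain T g where g: "harc (\<i> * of_real (4 / pi)) p T g"
    "\<And>M. (\<And>c. \<bar>c\<bar> \<le> 1 \<Longrightarrow> 4 * pi * \<bar>4 / pi\<bar> * (1 - c\<^sup>2) / (2 * c - s * 10 / 3)\<^sup>2 \<le> M) \<Longrightarrow> T \<le> M"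
  proof -
    have "2 < \<bar>s * 10 / 3\<bar>" "4 / pi \<noteq> 0" using assms by auto
    from harc_semicircle[OF p P this] show ?thesis using that by metis
  qed
  have "T \<le> 8"
  proof (rule g(2))
    fix c :: real assume c: "\<bar>c\<bar> \<le> 1"
    have nz: "2 * c - s * 10 / 3 \<noteq> 0" using c assms by auto
    \<comment> \<open>The inequality needed is 54 c^2 - 120 s c + 82 >= 0. Six times its left side
      is this square plus 92.\<close>
    have "0 \<le> (18 * (s * c) - 20)\<^sup>2" by simp
    also have "\<dots> = 324 * (s\<^sup>2 * c\<^sup>2) - 720 * (s * c) + 400"
      by (simp add: power2_eq_square algebra_simps)
    finally have 1: "0 \<le> 324 * c\<^sup>2 - 720 * (s * c) + 400" unfolding s2 by simp
    have "9 * (2 * c - s * 10 / 3)\<^sup>2 = 36 * c\<^sup>2 - 120 * (s * c) + 100 * s\<^sup>2"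
      by (simp add: power2_eq_square algebra_simps)
    then have "9 * (2 * c - s * 10 / 3)\<^sup>2 = 36 * c\<^sup>2 - 120 * (s * c) + 100" unfolding s2 by simp
    then have "2 * (1 - c\<^sup>2) \<le> (2 * c - s * 10 / 3)\<^sup>2" using 1 by argo
    then have "16 * (1 - c\<^sup>2) \<le> 8 * (2 * c - s * 10 / 3)\<^sup>2" by simp
    then have "16 * (1 - c\<^sup>2) / (2 * c - s * 10 / 3)\<^sup>2 \<le> 8"
      using nz by (simp add: divide_le_eq)
    then show "4 * pi * \<bar>4 / pi\<bar> * (1 - c\<^sup>2) / (2 * c - s * 10 / 3)\<^sup>2 \<le> 8" by simp
  qed
  have hg: "harc (unit_coeff p) p T g" using g(1) unfolding k .
  have "T = 1"
  proof -
    consider "T = 1" | "complex_of_real T = 1 / p\<^sup>2" | "complex_of_real T = - 1 / p\<^sup>2"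
      using harc_unit_length[OF hg p] by blast
    then show ?thesis
    proof cases
      case 2
      then have "complex_of_real T = complex_of_real 9" unfolding p2 by simp
      then show ?thesis using \<open>T \<le> 8\<close> by (simp only: of_real_eq_iff)
    next
      case 3
      then have "complex_of_real T = complex_of_real (-9)" unfolding p2 by simp
      then show ?thesis using g(1) by (simp only: of_real_eq_iff) (simp add: harc_def)
    qed
  qed
  then show ?thesis using hg unfolding p_def by blast
qed

lemma unit_coeff_tendsto:
  assumes "f \<longlonglongrightarrow> p" "p \<noteq> 0"
  shows "(\<lambda>n. unit_coeff (f n)) \<longlonglongrightarrow> unit_coeff p"
  unfolding unit_coeff_def using assms by (auto intro!: tendsto_intros)

text \<open>The parameters on the segment \<open>\<pi>\<close> from the seed for which an arc of
  length 1 exists form an open and closed set. The real part never vanishes along the segment and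
  the imaginary part only at the start, so the exceptional values 0, 1, -1, i, -i are
  avoided.\<close>

lemma harc_unit_exists:
  fixes p :: complex
  assumes p: "Re p \<noteq> 0" "Im p \<noteq> 0"
  shows "\<exists>g. harc (unit_coeff p) p 1 g"
proof -
  define s where "s = sgn (Re p)"
  have s: "s \<in> {1, -1}" using p(1) by (auto simp: s_def sgn_if)
  define \<pi> where "\<pi> t = (1 - t) *\<^sub>R complex_of_real (s / 3) + t *\<^sub>R p" for t :: real
  have Im\<pi>: "Im (\<pi> t) = t * Im p" for t by (simp add: \<pi>_def)
  have Re\<pi>: "Re (\<pi> t) \<noteq> 0" if "t \<in> {0..1}" for t
  proof -
    have "Re (\<pi> t) = (1 - t) * (s / 3) + t * Re p" by (simp add: \<pi>_def)
    then have "s * Re (\<pi> t) = (1 - t) * (s * s / 3) + t * (s * Re p)" by (simp add: algebra_simps)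
    moreover have "s * Re p = \<bar>Re p\<bar>" by (simp add: s_def abs_sgn mult.commute)
    ultimately have "s * Re (\<pi> t) = (1 - t) * (s * s / 3) + t * \<bar>Re p\<bar>" by simp
    moreover have "s * s = 1" using s by auto
    moreover have "0 < (1 - t) * (1 / 3) + t * \<bar>Re p\<bar>"
      using that p(1) by (cases "t = 1") (auto intro!: add_pos_nonneg)
    ultimately show ?thesis by auto
  qed
  have \<pi>n: "\<pi> t \<noteq> 0" "(\<pi> t)\<^sup>2 \<noteq> 1" "(\<pi> t)\<^sup>2 \<noteq> -1" if t: "t \<in> {0..1}" for t
  proof -
    show "\<pi> t \<noteq> 0" using Re\<pi>[OF t] by auto
    show "(\<pi> t)\<^sup>2 \<noteq> 1" "(\<pi> t)\<^sup>2 \<noteq> -1"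
    proof -
      have "(\<pi> t)\<^sup>2 \<noteq> of_real r" if "r \<in> {1, -1}" for r
      proof (cases "t = 0")
        case True
        then have "(\<pi> t)\<^sup>2 = of_real (1 / 9)"
          using s by (auto simp: \<pi>_def power2_eq_square)
        then show ?thesis using that by (auto simp only: of_real_eq_iff)
      next
        case False
        then have "Im ((\<pi> t)\<^sup>2) \<noteq> 0" using Re\<pi>[OF t] p(2) by (simp add: power2_eq_square Im\<pi>)
        then show ?thesis by auto
      qed
      from this[of 1] this[of "-1"] show "(\<pi> t)\<^sup>2 \<noteq> 1" "(\<pi> t)\<^sup>2 \<noteq> -1" by auto
    qed
  qed
  have c\<pi>: "isCont \<pi> t" for t unfolding \<pi>_def by (intro continuous_intros)
  let ?I = "{0..1::real}"
  let ?A = "{t \<in> ?I. \<exists>g. harc (unit_coeff (\<pi> t)) (\<pi> t) 1 g}"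
  have "openin (top_of_set ?I) ?A"
    unfolding openin_euclidean_subtopology_iff
  proof (intro conjI ballI)
    fix t assume "t \<in> ?A"
    then obtain g where t: "t \<in> ?I" and g: "harc (unit_coeff (\<pi> t)) (\<pi> t) 1 g" by blast
    obtain \<epsilon> where \<epsilon>: "\<epsilon> > 0" "\<And>p. dist p (\<pi> t) < \<epsilon> \<Longrightarrow> \<exists>h. harc (unit_coeff p) p 1 h"
      using harc_unit_open[OF g \<pi>n[OF t]] by blast
    obtain e where "e > 0" "\<And>u. dist u t < e \<Longrightarrow> dist (\<pi> u) (\<pi> t) < \<epsilon>"
      using c\<pi>[of t] \<epsilon>(1) unfolding continuous_at_eps_delta by (metis dist_norm)
    then show "\<exists>e>0. \<forall>x'\<in>?I. dist x' t < e \<longrightarrow> x' \<in> ?A" using \<epsilon>(2) by blast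
  qed blast
  moreover have "closed ?A"
    unfolding closed_sequential_limits
  proof (intro allI impI)
    fix f t assume f: "(\<forall>n. f n \<in> ?A) \<and> f \<longlonglongrightarrow> t"
    then have fI: "f n \<in> ?I" for n by blast
    have t: "t \<in> ?I" using closed_sequentially[of ?I f t] fI f by auto
    from f have "\<exists>g. harc (unit_coeff (\<pi> (f n))) (\<pi> (f n)) 1 g" for n by blast
    then obtain G where G: "\<And>n. harc (unit_coeff (\<pi> (f n))) (\<pi> (f n)) 1 (G n)" by metis
    have lim: "(\<lambda>n. \<pi> (f n)) \<longlonglongrightarrow> \<pi> t" using isCont_tendsto_compose[OF c\<pi>] f by blast
    show "t \<in> ?A"
    \<comment> \<open>At the start p^2 is real and the limit argument could yield a shorter arc;
      there the seed itself is used.\<close>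
    proof (cases "t = 0")
      case True
      then show ?thesis using harc_unit_seed[OF s] by (simp add: \<pi>_def)
    next
      case False
      obtain T g where Tg: "harc (unit_coeff (\<pi> t)) (\<pi> t) T g"
        using harc_limit[OF G unit_coeff_tendsto[OF lim \<pi>n(1)[OF t]] lim
            unit_coeff_total(2)[OF \<pi>n(1,2)[OF t]] \<pi>n(1,2)[OF t]] by blast
      have "T = 1" using harc_unit_length_one[OF Tg Re\<pi>[OF t]] False p(2) by (simp add: Im\<pi>)
      then show ?thesis using Tg t by blast
    qed
  qed
  then have "closedin (top_of_set ?I) ?A" by (rule closed_subset[rotated]) blast
  moreover have "connected ?I" by simp
  ultimately have "?A = {} \<or> ?A = ?I" unfolding connected_clopen by blast
  moreover have "0 \<in> ?A" using harc_unit_seed[OF s] by (simp add: \<pi>_def)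
  ultimately have "1 \<in> ?A" by auto
  then show ?thesis by (simp add: \<pi>_def)
qed

text \<open>As \<open>unit_coeff p * (1 + res_ratio p)\<close> is imaginary, the condition says that
  \<open>l\<close> is a real multiple of \<open>unit_coeff p\<close>. So an arc for the unit
  coefficient, of whatever length, can be rescaled. For real \<open>p\<close> the condition makes
  \<open>l\<close> imaginary and a semicircle serves directly.\<close>

lemma harc_exists:
  assumes p: "p \<noteq> 0" "p\<^sup>2 \<noteq> 1" and l: "l \<noteq> 0" "Re (l * (1 + res_ratio p)) = 0"
  shows "\<exists>T g. harc l p T g"
proof (cases "Im p = 0")
  case True
  define r where "r = Re p"
  have pr: "p = of_real r" using True by (simp add: r_def complex_eq_iff)
  have r: "r \<noteq> 0" "r\<^sup>2 \<noteq> 1" using p unfolding pr by (auto simp flip: of_real_power)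
  have "1 + res_ratio p = of_real (2 * r\<^sup>2 / (r\<^sup>2 - 1))" using one_plus_res_ratio[OF p(2)] unfolding pr by simp
  then have "Re l * (2 * r\<^sup>2 / (r\<^sup>2 - 1)) = 0" using l(2) by simp
  then have "Re l = 0" using r by simp
  then have k: "l = \<i> * of_real (Im l)" "Im l \<noteq> 0" using l(1) by (auto simp: complex_eq_iff)
  have P: "p + 1 / p = of_real (r + 1 / r)" by (simp add: pr)
  have "2 < \<bar>r + 1 / r\<bar>"
  proof -
    have "0 < (\<bar>r\<bar> - 1)\<^sup>2" using r by (auto simp: power2_eq_1_iff abs_if split: if_splits)
    also have "\<dots> = (r\<^sup>2 + 1) - 2 * \<bar>r\<bar>" by (simp add: power2_eq_square algebra_simps)
    finally have "2 * \<bar>r\<bar> < r\<^sup>2 + 1" by simp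
    moreover have "\<bar>r + 1 / r\<bar> * \<bar>r\<bar> = r\<^sup>2 + 1"
    proof -
      have "(r + 1 / r) * r = r\<^sup>2 + 1" using r(1) by (simp add: field_simps power2_eq_square)
      then have "\<bar>r + 1 / r\<bar> * \<bar>r\<bar> = \<bar>r\<^sup>2 + 1\<bar>" by (simp only: abs_mult[symmetric])
      then show ?thesis by simp
    qed
    ultimately have "2 * \<bar>r\<bar> < \<bar>r + 1 / r\<bar> * \<bar>r\<bar>" by simp
    then show ?thesis using r(1) by simp
  qed
  from harc_semicircle[OF p P this k(2)] show ?thesis using k(1) by metis
next
  case False
  have ex: "\<exists>T g. harc (unit_coeff p) p T g"
  proof (cases "Re p = 0")
    case True
    \<comment> \<open>Parameters off the imaginary axis that tend to \<open>p\<close>. The limit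
      need not have length 1, but here any length is acceptable.\<close>
    define f where "f n = p + of_real (1 / (real n + 1))" for n
    have "\<exists>g. harc (unit_coeff (f n)) (f n) 1 g" for n
      by (rule harc_unit_exists) (use True False in \<open>auto simp: f_def\<close>)
    then obtain G where G: "\<And>n. harc (unit_coeff (f n)) (f n) 1 (G n)" by metis
    have "(\<lambda>n. 1 / (real n + 1)) \<longlonglongrightarrow> 0" using LIMSEQ_inverse_real_of_nat by (simp add: inverse_eq_divide add.commute)
    then have "f \<longlonglongrightarrow> p + of_real 0" unfolding f_def by (intro tendsto_intros)
    then have "f \<longlonglongrightarrow> p" by simp
    from harc_limit[OF G unit_coeff_tendsto[OF this p(1)] this unit_coeff_total(2)[OF p] p] show ?thesis by blast
  next
    case False
    then show ?thesis using harc_unit_exists[of p] \<open>Im p \<noteq> 0\<close> by blast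
  qed
  define k where "k = Im (l * (1 + res_ratio p))"
  have "l * (1 + res_ratio p) = \<i> * of_real k" using l(2) by (simp add: k_def complex_eq_iff)
  also have "\<dots> = \<i> * of_real k * (of_real pi * \<i> * unit_coeff p * (1 + res_ratio p))" unfolding unit_coeff_total(1)[OF p] by simp
  also have "\<dots> = (\<i> * \<i>) * (of_real k * of_real pi) * unit_coeff p * (1 + res_ratio p)" by (simp only: ac_simps)
  also have "\<dots> = of_real (- k * pi) * unit_coeff p * (1 + res_ratio p)" by simp
  finally have "l * (1 + res_ratio p) = of_real (- k * pi) * unit_coeff p * (1 + res_ratio p)" .
  moreover have "1 + res_ratio p \<noteq> 0" unfolding one_plus_res_ratio[OF p(2)] using p by simp
  ultimately have lk: "l = of_real (- k * pi) * unit_coeff p" by (metis mult_right_cancel)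
  then have "- k * pi \<noteq> 0" using l(1) by auto
  then show ?thesis using ex harc_scale[OF _ p] unfolding lk by blast
qed

section \<open>The two conditions on the coefficient and the return to \<open>a\<close> and
  \<open>b\<close>\<close>

lemma harc_necessary:
  assumes hg: "harc l p T g" and p: "p \<noteq> 0" "p\<^sup>2 \<noteq> 1" "l \<noteq> 0"
  shows "Re (l * (1 + res_ratio p)) = 0 \<or> Re (l * (1 - res_ratio p)) = 0"
proof -
  define m where "m = 2 * winding_number g 0"
  define n where "n = 2 * (winding_number g p - winding_number g (1 / p))"
  have mn: "m \<in> {1, -1}" "n \<in> {1, -1}" using harc_windings[OF hg p] by (simp_all add: m_def n_def)
  have "of_real T = of_real pi * \<i> * (l * (m + n * res_ratio p))"
    using harc_length_formula[OF hg p] by (simp add: m_def n_def algebra_simps)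
  \<comment> \<open>The length is real, and the factor i turns the imaginary part of the right side
    into a real part.\<close>
  then have "Im (of_real T) = Im (of_real pi * \<i> * (l * (m + n * res_ratio p)))" by metis
  then have "pi * Re (l * (m + n * res_ratio p)) = 0" by simp
  then have "Re (l * (m + n * res_ratio p)) = 0" by (metis mult_eq_0_iff pi_neq_zero)
  then show ?thesis using mn by (auto simp: algebra_simps)
qed

text \<open>The points over z = 0 solve a quadratic equation whose roots become rational in the
  square roots of \<open>a\<close> and \<open>b\<close>. Then \<open>res_ratio p\<close> is (a + b)
  / (2 * sa * sb), which turns 1 + \<open>res_ratio p\<close> and 1 - \<open>res_ratio p\<close>
  into the two quotients of the theorem, up to constant factors.\<close>

lemma square_root_parameter:
  fixes sa sb :: complex
  assumes "sa \<noteq> 0" "sb \<noteq> 0" "sa\<^sup>2 \<noteq> sb\<^sup>2"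
  defines "p \<equiv> - (sa + sb) / (sa - sb)"
  shows "p \<noteq> 0" "p\<^sup>2 \<noteq> 1" "p + 1 / p = - 2 * (sa\<^sup>2 + sb\<^sup>2) / (sa\<^sup>2 - sb\<^sup>2)"
    "(sa + sb)\<^sup>2 / (sa * sb) = 2 * (1 + res_ratio p)" "(sa - sb)\<^sup>2 / (sa * sb) = - 2 * (1 - res_ratio p)"
proof -
  define u where "u = sa + sb" define w where "w = sa - sb"
  have uw: "u * w = sa\<^sup>2 - sb\<^sup>2" by (simp add: u_def w_def algebra_simps power2_eq_square)
  then have n: "u \<noteq> 0" "w \<noteq> 0" using assms(3) by auto
  have pu: "p = - u / w" by (simp add: p_def u_def w_def)
  show "p \<noteq> 0" using n by (simp add: pu)
  have d: "u\<^sup>2 - w\<^sup>2 = 4 * (sa * sb)" "u\<^sup>2 + w\<^sup>2 = 2 * (sa\<^sup>2 + sb\<^sup>2)"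
    by (simp_all add: u_def w_def algebra_simps power2_eq_square)
  then have d0: "u\<^sup>2 - w\<^sup>2 \<noteq> 0" using assms(1,2) by simp
  have p2: "p\<^sup>2 = u\<^sup>2 / w\<^sup>2" by (simp add: pu power_divide)
  show "p\<^sup>2 \<noteq> 1" unfolding p2 using n d0 by simp
  have "p + 1 / p = - (u\<^sup>2 + w\<^sup>2) / (u * w)" unfolding pu using n by (simp add: field_simps power2_eq_square)
  then show "p + 1 / p = - 2 * (sa\<^sup>2 + sb\<^sup>2) / (sa\<^sup>2 - sb\<^sup>2)" unfolding uw d(2) by simp
  have r: "res_ratio p = (u\<^sup>2 + w\<^sup>2) / (u\<^sup>2 - w\<^sup>2)"
    unfolding res_ratio_def p2 using n d0 by (simp add: divide_simps)
  have s: "sa * sb = (u\<^sup>2 - w\<^sup>2) / 4" using d(1) by simp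
  show "(sa + sb)\<^sup>2 / (sa * sb) = 2 * (1 + res_ratio p)" "(sa - sb)\<^sup>2 / (sa * sb) = - 2 * (1 - res_ratio p)"
    unfolding r s u_def[symmetric] w_def[symmetric] using d0 by (simp_all add: field_simps)
qed

lemma connection_necessary:
  assumes "a \<noteq> 0" "b \<noteq> 0" "l \<noteq> 0" "a \<noteq> b" "sa\<^sup>2 = a" "sb\<^sup>2 = b"
    and "horizontal_curve l a b g" "has_endpoints g a b"
  shows "Re (l * ((sa + sb)\<^sup>2 / (sa * sb))) = 0 \<or> Re (l * ((sa - sb)\<^sup>2 / (sa * sb))) = 0"
proof -
  define p where "p = - (sa + sb) / (sa - sb)"
  have s: "sa \<noteq> 0" "sb \<noteq> 0" "sa\<^sup>2 \<noteq> sb\<^sup>2" using assms by auto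
  note p = square_root_parameter[OF s, folded p_def]
  obtain T h where "harc l p T h"
    using harc_of_horizontal_curve[OF assms(7,8) p(1,2) assms(4)] p(3) assms(5,6) by auto
  then have "Re (l * (1 + res_ratio p)) = 0 \<or> Re (l * (1 - res_ratio p)) = 0" by (rule harc_necessary[OF _ p(1,2) assms(3)])
  moreover have "l * (2 * (1 + res_ratio p)) = of_real 2 * (l * (1 + res_ratio p))" "l * (- 2 * (1 - res_ratio p)) = of_real (- 2) * (l * (1 - res_ratio p))"
    by (simp_all add: algebra_simps)
  then have "Re (l * (2 * (1 + res_ratio p))) = 2 * Re (l * (1 + res_ratio p))" "Re (l * (- 2 * (1 - res_ratio p))) = - 2 * Re (l * (1 - res_ratio p))"
    by (metis Re_complex_of_real Im_complex_of_real times_complex.sel(1) mult_zero_left diff_zero)+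
  ultimately show ?thesis unfolding p(4,5) by linarith
qed

lemma connection_exists:
  assumes "a \<noteq> 0" "b \<noteq> 0" "l \<noteq> 0" "a \<noteq> b" "sa\<^sup>2 = a" "sb\<^sup>2 = b"
    and "Re (l * ((sa + sb)\<^sup>2 / (sa * sb))) = 0"
  shows "\<exists>g. finite_critical_trajectory l a b g \<and> connects g a b"
proof -
  define p where "p = - (sa + sb) / (sa - sb)"
  have s: "sa \<noteq> 0" "sb \<noteq> 0" "sa\<^sup>2 \<noteq> sb\<^sup>2" using assms by auto
  note p = square_root_parameter[OF s, folded p_def]
  have "l * (2 * (1 + res_ratio p)) = of_real 2 * (l * (1 + res_ratio p))" by simp
  then have "Re (l * (2 * (1 + res_ratio p))) = 2 * Re (l * (1 + res_ratio p))"
    by (metis Re_complex_of_real Im_complex_of_real times_complex.sel(1) mult_zero_left diff_zero)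
  then have "Re (l * (1 + res_ratio p)) = 0" using assms(7) unfolding p(4) by linarith
  then obtain T g where "harc l p T g" using harc_exists[OF p(1,2) assms(3)] by blast
  then show ?thesis using trajectory_of_harc[OF _ p(1,2) assms(4) _ assms(3)] p(3) assms(5,6) by auto
qed

theorem proposition2:
  fixes a b l sa sb :: complex
  assumes "a \<noteq> 0" and "b \<noteq> 0" and "l \<noteq> 0" and "a \<noteq> b"
    and "sa\<^sup>2 = a" and "sb\<^sup>2 = b"
  shows "(\<exists>g. finite_critical_trajectory l a b g \<and> connects g a b) \<longleftrightarrow>
         Re (l * ((sa + sb)\<^sup>2 / (sa * sb))) = 0 \<or> Re (l * ((sa - sb)\<^sup>2 / (sa * sb))) = 0"
proof
  assume "\<exists>g. finite_critical_trajectory l a b g \<and> connects g a b"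
  then obtain g where hc: "horizontal_curve l a b g" and e: "has_endpoints g a b \<or> has_endpoints g b a"
    unfolding finite_critical_trajectory_def trajectory_def connects_def by blast
  from e show "Re (l * ((sa + sb)\<^sup>2 / (sa * sb))) = 0 \<or> Re (l * ((sa - sb)\<^sup>2 / (sa * sb))) = 0"
  proof
    assume "has_endpoints g a b"
    then show ?thesis by (rule connection_necessary[OF assms hc])
  next
    assume ba: "has_endpoints g b a"
    \<comment> \<open>The differential is symmetric in \<open>a\<close> and \<open>b\<close>, and so
      is the pair of conditions.\<close>
    have "horizontal_curve l b a g"
      using hc by (simp add: horizontal_curve_def quad_diff_def regular_points_def insert_commute mult.commute)
    then have "Re (l * ((sb + sa)\<^sup>2 / (sb * sa))) = 0 \<or> Re (l * ((sb - sa)\<^sup>2 / (sb * sa))) = 0"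
      using connection_necessary[OF assms(2,1,3) _ assms(6,5) _ ba] assms(4) by blast
    then show ?thesis by (simp add: add.commute mult.commute power2_commute)
  qed
next
  assume "Re (l * ((sa + sb)\<^sup>2 / (sa * sb))) = 0 \<or> Re (l * ((sa - sb)\<^sup>2 / (sa * sb))) = 0"
  then show "\<exists>g. finite_critical_trajectory l a b g \<and> connects g a b"
  proof
    assume "Re (l * ((sa + sb)\<^sup>2 / (sa * sb))) = 0"
    then show ?thesis by (rule connection_exists[OF assms])
  next
    assume m: "Re (l * ((sa - sb)\<^sup>2 / (sa * sb))) = 0"
    show ?thesis
    proof (rule connection_exists[OF assms(1-5)])
      \<comment> \<open>The other choice of root of \<open>b\<close> exchanges the two conditions;
        the sign it gives to the product of the roots does not affect the vanishing of the real
        part.\<close>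
      show "(- sb)\<^sup>2 = b" using assms(6) by simp
      show "Re (l * ((sa + - sb)\<^sup>2 / (sa * - sb))) = 0" using m by simp
    qed
  qed
qed

end
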